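(* Let $m\ge 0$ be an integer. If $m=0$, let $X$ be a compact metric space and $c\in C(X\times X)$; if $m\ge 1$, let $X$ be the closure of a bounded open set in $\mathbb{R}^d$ and $c\in C^{(m,m)}(X\times X)$. In both cases let $\varepsilon>0$ and assume that $c$ is symmetric, non-negative, and that $k_c=\exp(-c/\varepsilon)$ is a positive definite universal kernel. Let $(\mu_t)_t$ be a path in $\mathcal{P}(X)$ that is continuously differentiable from $(0,1)$ into the space $C^m(X)^*$ endowed with the weak-$*$ topology, such that the derivative $\dot\mu_t$ extends weak-$*$ continuously to the end points $t=0,1$. Then $\sup_{t\in[0,1]}\|\dot\mu_t\|_{C^{m,*}}<\infty$, and $(\mu_t)_t\in\mathrm{AC}^2((0,1);(C^m(X)^*,\|\cdot\|_{C^{m,*}}))$. In particular, $(\mu_t)_t$ is an admissible path for $\mathsf{d}_S$.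
   Context: $\mathcal{P}(X)$: Radon probability measures. $C^m(X)$ has norm $\|\phi\|_{C^m}=\sup_{|\alpha|\le m}\|\partial^\alpha\phi\|_\infty$; $\|\cdot\|_{C^{m,*}}$ is the dual norm on $C^m(X)^*$. $C^{(m,m)}(X\times X)$: functions whose mixed partial derivatives of order at most $m$ in each of the two variables separately are continuous. A kernel is universal if its reproducing kernel Hilbert space (RKHS) is dense in $C(X)$. Continuous differentiability in $C^m(X)^*$ with the weak-$*$ topology means: for each $\phi\in C^m(X)$, $t\mapsto\langle\mu_t,\phi\rangle$ is differentiable with derivative $\langle\dot\mu_t,\phi\rangle$, where $\dot\mu_t\in C^m(X)^*$ and $t\mapsto\dot\mu_t$ is weak-$*$ continuous. For a metric space $(\mathcal{X},\mathsf{d})$, $\gamma\in\mathrm{AC}^2((a,b);\mathcal{X})$ means that there is $m\in L^2(a,b)$ with $\mathsf{d}(\gamma(s),\gamma(t))\le\int_s^t m(\tau)\,d\tau$ for all $a<s\le t<b$. Admissibility: for $\mu\in\mathcal{P}(X)$, $f_{\mu,\mu}\in C(X)$ is the unique function with $\int_X\exp\left(\frac1\varepsilon(f_{\mu,\mu}(x)+f_{\mu,\mu}(y)-c(x,y))\right)d\mu(x)=1$ for all $y\in X$; $\mathcal{H}_c$ is the RKHS of $k_c$; $B(\mu)=\exp(-f_{\mu,\mu}/\varepsilon)\in\mathcal{H}_c$. A path $(\mu_t)_t$ is admissible for $\mathsf{d}_S$ if $(B(\mu_t))_t$ belongs to the Sobolev space $H^1((0,1);\mathcal{H}_c)$ (functions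 in $L^2((0,1);\mathcal{H}_c)$ with distributional derivative in $L^2((0,1);\mathcal{H}_c)$); equivalently $(B(\mu_t))_t\in\mathrm{AC}^2((0,1);\mathcal{H}_c)$. Such a path is extended to $[0,1]$ by continuity. *)

theory Defs
  imports "HOL-Analysis.Analysis"
begin

section \<open>Function spaces and their duals\<close>

text \<open>
  Functions on a set \<open>X\<close> are total functions of which only the values on \<open>X\<close> matter.
  Accordingly \<open>N\<close> below is a seminorm on \<open>D\<close> that vanishes exactly on the functions that are
  zero on \<open>X\<close>; a bounded functional does not see the values off \<open>X\<close>, so \<open>dual_space D N\<close>
  is the dual of the normed space of functions on \<open>X\<close>.
\<close>

definition dual_space :: "('a \<Rightarrow> real) set \<Rightarrow> (('a \<Rightarrow> real) \<Rightarrow> real) \<Rightarrow> (('a \<Rightarrow> real) \<Rightarrow> real) set" where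
  "dual_space D N = {L.
     (\<forall>\<phi>\<in>D. \<forall>\<psi>\<in>D. L (\<lambda>x. \<phi> x + \<psi> x) = L \<phi> + L \<psi>) \<and>
     (\<forall>\<phi>\<in>D. \<forall>r. L (\<lambda>x. r * \<phi> x) = r * L \<phi>) \<and>
     (\<exists>K. \<forall>\<phi>\<in>D. \<bar>L \<phi>\<bar> \<le> K * N \<phi>)}"

definition dual_norm :: "('a \<Rightarrow> real) set \<Rightarrow> (('a \<Rightarrow> real) \<Rightarrow> real) \<Rightarrow> (('a \<Rightarrow> real) \<Rightarrow> real) \<Rightarrow> real" where
  "dual_norm D N L = (SUP \<phi>\<in>{\<phi> \<in> D. N \<phi> \<le> 1}. \<bar>L \<phi>\<bar>)"

definition dual_dist ::
  "('a \<Rightarrow> real) set \<Rightarrow> (('a \<Rightarrow> real) \<Rightarrow> real) \<Rightarrow> (('a \<Rightarrow> real) \<Rightarrow> real) \<Rightarrow> (('a \<Rightarrow> real) \<Rightarrow> real) \<Rightarrow> real" where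
  "dual_dist D N L L' = dual_norm D N (\<lambda>\<phi>. L \<phi> - L' \<phi>)"

definition C_space :: "'a::topological_space set \<Rightarrow> ('a \<Rightarrow> real) set" where
  "C_space X = {\<phi>. continuous_on X \<phi>}"

definition C_norm :: "'a set \<Rightarrow> ('a \<Rightarrow> real) \<Rightarrow> real" where
  "C_norm X \<phi> = (SUP x\<in>X. \<bar>\<phi> x\<bar>)"

text \<open>
  Iterated partial derivatives along a list of basis vectors. A multi-index \<open>\<alpha>\<close>
  corresponds to the lists of length \<open>|\<alpha>|\<close> in which each basis vector \<open>b\<close> occurs \<open>\<alpha> b\<close> times;
  for the functions considered here the order of differentiation is immaterial.
\<close>

primrec partials :: "'a::euclidean_space list \<Rightarrow> ('a \<Rightarrow> real) \<Rightarrow> 'a \<Rightarrow> real" where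
  "partials [] f = f"
| "partials (b # bs) f = (\<lambda>x. deriv (\<lambda>t. partials bs f (x + t *\<^sub>R b)) 0)"

text \<open>
  For \<open>X\<close> the closure of an open set: \<open>f\<close> is continuous on \<open>X\<close>, all the partial derivatives
  listed in the suffix-closed set \<open>W\<close> exist in the interior of \<open>X\<close>, and each of them
  extends continuously to \<open>X\<close>.
\<close>

definition cont_diff_on :: "'a::euclidean_space list set \<Rightarrow> 'a set \<Rightarrow> ('a \<Rightarrow> real) \<Rightarrow> bool" where
  "cont_diff_on W X f \<longleftrightarrow>
     continuous_on X f \<and>
     (\<forall>b bs. b # bs \<in> W \<longrightarrow>
        (\<forall>x\<in>interior X. (\<lambda>t. partials bs f (x + t *\<^sub>R b)) field_differentiable (at 0))) \<and>
     (\<forall>bs\<in>W. \<exists>g. continuous_on X g \<and> (\<forall>x\<in>interior X. g x = partials bs f x))"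

definition Cm_words :: "nat \<Rightarrow> 'a::euclidean_space list set" where
  "Cm_words m = {bs. set bs \<subseteq> Basis \<and> length bs \<le> m}"

definition Cm_space :: "nat \<Rightarrow> 'a::euclidean_space set \<Rightarrow> ('a \<Rightarrow> real) set" where
  "Cm_space m X = {\<phi>. cont_diff_on (Cm_words m) X \<phi>}"

text \<open>
  By continuity, the supremum over the interior is the supremum over \<open>X\<close> of the extended
  derivatives.
\<close>

definition Cm_norm :: "nat \<Rightarrow> 'a::euclidean_space set \<Rightarrow> ('a \<Rightarrow> real) \<Rightarrow> real" where
  "Cm_norm m X \<phi> = (SUP (bs, x)\<in>Cm_words m \<times> interior X. \<bar>partials bs \<phi> x\<bar>)"

text \<open>
  The basis of the product space consists of the vectors \<open>(b, 0)\<close> (derivatives in the first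
  variable) and \<open>(0, b)\<close> (derivatives in the second variable).
\<close>

definition Cmm_words :: "nat \<Rightarrow> ('a::euclidean_space \<times> 'a) list set" where
  "Cmm_words m = {bs. set bs \<subseteq> Basis \<and>
     length (filter (\<lambda>b. snd b = 0) bs) \<le> m \<and> length (filter (\<lambda>b. fst b = 0) bs) \<le> m}"

definition Cmm_space :: "nat \<Rightarrow> 'a::euclidean_space set \<Rightarrow> ('a \<times> 'a \<Rightarrow> real) set" where
  "Cmm_space m X = {f. cont_diff_on (Cmm_words m) (X \<times> X) f}"


section \<open>Measures and paths\<close>

definition radon_prob :: "'a::topological_space set \<Rightarrow> 'a measure set" where
  "radon_prob X = {M. sets M = sets (restrict_space borel X) \<and> emeasure M (space M) = 1 \<and>
     (\<forall>A\<in>sets M. emeasure M A = (SUP K\<in>{K. K \<subseteq> A \<and> compact K}. emeasure M K))}"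

definition pairing :: "'a measure \<Rightarrow> ('a \<Rightarrow> real) \<Rightarrow> real" where
  "pairing M \<phi> = (\<integral>x. \<phi> x \<partial>M)"

text \<open>
  \<open>\<mu>'\<close> is the weak-* derivative of \<open>\<mu>\<close> on \<open>(0,1)\<close> together with its weak-* continuous
  extension to the end points.
\<close>

definition weakstar_C1_path ::
  "('a::topological_space \<Rightarrow> real) set \<Rightarrow> (('a \<Rightarrow> real) \<Rightarrow> real) \<Rightarrow> 'a set \<Rightarrow>
   (real \<Rightarrow> 'a measure) \<Rightarrow> (real \<Rightarrow> ('a \<Rightarrow> real) \<Rightarrow> real) \<Rightarrow> bool" where
  "weakstar_C1_path D N X \<mu> \<mu>' \<longleftrightarrow>
     (\<forall>t\<in>{0<..<1}. \<mu> t \<in> radon_prob X) \<and>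
     (\<forall>t\<in>{0..1}. \<mu>' t \<in> dual_space D N) \<and>
     (\<forall>\<phi>\<in>D. \<forall>t\<in>{0<..<1}. ((\<lambda>s. pairing (\<mu> s) \<phi>) has_real_derivative \<mu>' t \<phi>) (at t)) \<and>
     (\<forall>\<phi>\<in>D. continuous_on {0..1} (\<lambda>t. \<mu>' t \<phi>))"

definition L2_on :: "real \<Rightarrow> real \<Rightarrow> (real \<Rightarrow> 'h::real_normed_vector) \<Rightarrow> bool" where
  "L2_on a b u \<longleftrightarrow> set_borel_measurable lborel {a<..<b} u \<and>
     set_integrable lborel {a<..<b} (\<lambda>t. (norm (u t))\<^sup>2)"

definition AC2_on :: "'s set \<Rightarrow> ('s \<Rightarrow> 's \<Rightarrow> real) \<Rightarrow> real \<Rightarrow> real \<Rightarrow> (real \<Rightarrow> 's) \<Rightarrow> bool" where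
  "AC2_on S d a b \<gamma> \<longleftrightarrow> (\<forall>t\<in>{a<..<b}. \<gamma> t \<in> S) \<and>
     (\<exists>g :: real \<Rightarrow> real. L2_on a b g \<and>
        (\<forall>s t. a < s \<and> s \<le> t \<and> t < b \<longrightarrow> d (\<gamma> s) (\<gamma> t) \<le> (LBINT \<tau>:{s..t}. g \<tau>)))"

definition test_function :: "real \<Rightarrow> real \<Rightarrow> (real \<Rightarrow> real) \<Rightarrow> bool" where
  "test_function a b \<eta> \<longleftrightarrow> (\<forall>n t. (deriv ^^ n) \<eta> field_differentiable (at t)) \<and>
     (\<exists>a' b'. a < a' \<and> b' < b \<and> (\<forall>t. t \<notin> {a'..b'} \<longrightarrow> \<eta> t = 0))"

definition H1_on :: "real \<Rightarrow> real \<Rightarrow> (real \<Rightarrow> 'h::{banach, second_countable_topology}) \<Rightarrow> bool" where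
  "H1_on a b u \<longleftrightarrow> L2_on a b u \<and>
     (\<exists>v. L2_on a b v \<and>
        (\<forall>\<eta>. test_function a b \<eta> \<longrightarrow>
           (LBINT t:{a<..<b}. deriv \<eta> t *\<^sub>R u t) = - (LBINT t:{a<..<b}. \<eta> t *\<^sub>R v t)))"


section \<open>Kernels\<close>

definition pos_def_kernel :: "'a set \<Rightarrow> ('a \<Rightarrow> 'a \<Rightarrow> real) \<Rightarrow> bool" where
  "pos_def_kernel X k \<longleftrightarrow> (\<forall>x\<in>X. \<forall>y\<in>X. k x y = k y x) \<and>
     (\<forall>F r. finite F \<and> F \<subseteq> X \<longrightarrow> (\<Sum>x\<in>F. \<Sum>y\<in>F. r x * r y * k x y) \<ge> 0)"

text \<open>
  The Hilbert space \<open>'h\<close> is the reproducing kernel Hilbert space of \<open>k\<close> on \<open>X\<close>, where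
  \<open>h :: 'h\<close> stands for the function \<open>ev h\<close> on \<open>X\<close>: distinct elements are distinct functions,
  the functions \<open>k x\<close> belong to the space and they reproduce point values. (That the vector
  space operations of \<open>'h\<close> are the pointwise ones follows from the reproducing property.)
  For a continuous kernel on a compact \<open>X\<close> this Hilbert space is always separable, so the
  class \<open>second_countable_topology\<close>, needed for the Bochner integral in \<open>H1_on\<close>, is no restriction.
\<close>

definition is_rkhs :: "'a set \<Rightarrow> ('a \<Rightarrow> 'a \<Rightarrow> real) \<Rightarrow> ('h::{real_inner, banach} \<Rightarrow> 'a \<Rightarrow> real) \<Rightarrow> bool" where
  "is_rkhs X k ev \<longleftrightarrow>
     (\<forall>g h. (\<forall>x\<in>X. ev g x = ev h x) \<longrightarrow> g = h) \<and>
     (\<forall>x\<in>X. \<exists>kx. (\<forall>y\<in>X. ev kx y = k x y) \<and> (\<forall>h. ev h x = inner h kx))"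

definition dense_in_C :: "'a::topological_space set \<Rightarrow> ('a \<Rightarrow> real) set \<Rightarrow> bool" where
  "dense_in_C X H \<longleftrightarrow> H \<subseteq> C_space X \<and>
     (\<forall>\<phi>\<in>C_space X. \<forall>\<delta>>0. \<exists>h\<in>H. C_norm X (\<lambda>x. h x - \<phi> x) < \<delta>)"

definition gibbs_kernel :: "real \<Rightarrow> ('a \<Rightarrow> 'a \<Rightarrow> real) \<Rightarrow> 'a \<Rightarrow> 'a \<Rightarrow> real" where
  "gibbs_kernel \<epsilon> c x y = exp (- c x y / \<epsilon>)"

text \<open>The properties of the cost besides its regularity; \<open>ev\<close> exhibits \<open>'h\<close> as the space \<open>H_c\<close>.\<close>

definition admissible_cost ::
  "real \<Rightarrow> 'a::topological_space set \<Rightarrow> ('a \<Rightarrow> 'a \<Rightarrow> real) \<Rightarrow> ('h::{real_inner, banach} \<Rightarrow> 'a \<Rightarrow> real) \<Rightarrow> bool" where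
  "admissible_cost \<epsilon> X c ev \<longleftrightarrow>
     (\<forall>x\<in>X. \<forall>y\<in>X. c x y = c y x \<and> 0 \<le> c x y) \<and>
     pos_def_kernel X (gibbs_kernel \<epsilon> c) \<and>
     is_rkhs X (gibbs_kernel \<epsilon> c) ev \<and>
     dense_in_C X (range ev)"


section \<open>Admissible paths\<close>

definition self_potential :: "real \<Rightarrow> 'a::topological_space set \<Rightarrow> ('a \<Rightarrow> 'a \<Rightarrow> real) \<Rightarrow> 'a measure \<Rightarrow> 'a \<Rightarrow> real" where
  "self_potential \<epsilon> X c M = (THE f. f \<in> extensional X \<and> continuous_on X f \<and>
     (\<forall>y\<in>X. (\<integral>x. exp (1 / \<epsilon> * (f x + f y - c x y)) \<partial>M) = 1))"

definition B_map :: "real \<Rightarrow> 'a::topological_space set \<Rightarrow> ('a \<Rightarrow> 'a \<Rightarrow> real) \<Rightarrow> 'a measure \<Rightarrow> 'a \<Rightarrow> real" where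
  "B_map \<epsilon> X c M x = exp (- self_potential \<epsilon> X c M x / \<epsilon>)"

definition admissible_path ::
  "real \<Rightarrow> 'a::topological_space set \<Rightarrow> ('a \<Rightarrow> 'a \<Rightarrow> real) \<Rightarrow>
   ('h::{real_inner, banach, second_countable_topology} \<Rightarrow> 'a \<Rightarrow> real) \<Rightarrow> (real \<Rightarrow> 'a measure) \<Rightarrow> bool" where
  "admissible_path \<epsilon> X c ev \<mu> \<longleftrightarrow>
     (\<exists>u :: real \<Rightarrow> 'h. (\<forall>t\<in>{0<..<1}. \<forall>x\<in>X. ev (u t) x = B_map \<epsilon> X c (\<mu> t) x) \<and> H1_on 0 1 u)"

end

theory Submission
  imports Defs "HOL-Library.Sublist"
begin

text \<open>
  By the uniform boundedness principle the derivatives are bounded in the dual norm, so the path is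
  Lipschitz in that norm. In the Hilbert space of the kernel, \<open>b = B(\<mu>)\<close> is the unique positive
  solution of \<open>b = \<integral> k(x,\<cdot>) / b(x) d\<mu>(x)\<close>, an equation given by a strongly monotone operator. For two
  solutions, monotonicity yields
  \<open>\<parallel>b\<^sub>1 - b\<^sub>2\<parallel>\<^sup>2 \<le> \<langle>\<mu>\<^sub>1 - \<mu>\<^sub>2, (b\<^sub>1 - b\<^sub>2) / b\<^sub>2\<rangle>\<close>, and since the Hilbert space embeds continuously into
  \<open>C\<^sup>m\<close>, the right-hand side is at most \<open>C \<bar>s - t\<bar> \<parallel>b\<^sub>1 - b\<^sub>2\<parallel>\<close>. Hence \<open>t \<mapsto> B(\<mu>\<^sub>t)\<close> is Lipschitz, and a
  Lipschitz curve in a separable Hilbert space belongs to \<open>H\<^sup>1\<close>.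
\<close>

section \<open>Lipschitz curves in a Hilbert space\<close>

text \<open>The equation for \<open>b\<close> is the definition of the self-potential read through
  \<open>b = exp (- f / \<epsilon>)\<close>. Two obstacles shape the proof. The C^m norm of the
  quotient \<open>(b1 - b2) / b2\<close> must be linear in the Hilbert norm of the difference, with
  one constant for the whole path. Hence the a priori bounds: every solution has Hilbert norm 1 and
  is at least \<open>\<kappa>\<close>, the minimum of the kernel. The embedding into C^m comes from
  differentiating the feature map \<open>K\<close> itself: inner products of its difference
  quotients are mixed second difference quotients of the kernel, so m derivatives of
  \<open>K\<close> cost m derivatives of the kernel in each variable, which is the class C^(m,m). A
  Lipschitz curve in a Banach space may have no derivative at all. In a Hilbert space the slopes
  over dyadic intervals form an L^2-bounded martingale, and its limit is the derivative.\<close>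

lemma has_bochner_integral_uniform_step:
  fixes F :: "nat \<Rightarrow> 'h::{banach, second_countable_topology}" and N :: real
  assumes N: "N > 0"
  shows "has_bochner_integral lborel (\<lambda>t. indicator {0..<real j / N} t *\<^sub>R F (nat \<lfloor>N * t\<rfloor>))
           (\<Sum>i<j. (1 / N) *\<^sub>R F i)"
proof -
  have ind: "indicator {0..<real j / N} t *\<^sub>R F (nat \<lfloor>N * t\<rfloor>)
      = (\<Sum>i<j. indicator {real i / N..<real (Suc i) / N} t *\<^sub>R F i)" for t :: real
  proof (cases "t \<in> {0..<real j / N}")
    case True
    define k where "k = nat \<lfloor>N * t\<rfloor>"
    have kN: "real k \<le> N * t" "N * t < real (Suc k)"
      using True N unfolding k_def by (auto, linarith)
    have kj: "k < j"
    proof -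
      have "N * t < real j" using True N by (simp add: pos_less_divide_eq mult.commute)
      with kN show ?thesis by linarith
    qed
    have "indicator {real i / N..<real (Suc i) / N} t = (if i = k then 1 else (0::real))" for i
    proof -
      have "t \<in> {real i / N..<real (Suc i) / N} \<longleftrightarrow> real i \<le> N * t \<and> N * t < real (Suc i)"
        using N by (simp add: pos_less_divide_eq pos_divide_le_eq mult.commute)
      also have "\<dots> \<longleftrightarrow> i = k" using kN by auto
      finally show ?thesis by (simp add: indicator_def)
    qed
    then have "(\<Sum>i<j. indicator {real i / N..<real (Suc i) / N} t *\<^sub>R F i)
        = (\<Sum>i<j. if i = k then F i else 0)" by (intro sum.cong) auto
    then show ?thesis using True kj by (simp add: k_def)
  next
    case False
    have "indicator {real i / N..<real (Suc i) / N} t = (0::real)" if "i < j" for i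
    proof -
      have "real (Suc i) / N \<le> real j / N" "0 \<le> real i / N"
        using that N by (auto simp: divide_right_mono)
      moreover have "t < 0 \<or> real j / N \<le> t" using False by auto
      ultimately have "t \<notin> {real i / N..<real (Suc i) / N}" by auto
      then show ?thesis by simp
    qed
    then have "(\<Sum>i<j. indicator {real i / N..<real (Suc i) / N} t *\<^sub>R F i) = 0" by simp
    then show ?thesis using False by simp
  qed
  have "has_bochner_integral lborel (\<lambda>t. \<Sum>i<j. indicator {real i / N..<real (Suc i) / N} t *\<^sub>R F i)
      (\<Sum>i<j. (1 / N) *\<^sub>R F i)"
  proof (rule has_bochner_integral_sum)
    fix i assume "i \<in> {..<j}"
    have "has_bochner_integral lborel (indicator {real i / N..<real (Suc i) / N} :: real \<Rightarrow> real)
        (measure lborel {real i / N..<real (Suc i) / N})"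
      using N by (intro has_bochner_integral_real_indicator) (auto simp: divide_right_mono)
    moreover have "measure lborel {real i / N..<real (Suc i) / N} = 1 / N"
      using N by (simp add: divide_right_mono field_simps)
    ultimately show "has_bochner_integral lborel
        (\<lambda>t. indicator {real i / N..<real (Suc i) / N} t *\<^sub>R F i) ((1 / N) *\<^sub>R F i)"
      by (intro has_bochner_integral_scaleR_left) simp
  qed
  then show ?thesis unfolding ind .
qed

text \<open>The hypothesis says that \<open>d\<close> is the mean of \<open>f\<close> over
  \<open>A\<close>, so this is the variance identity. With \<open>A\<close> a block of fine dyadic
  intervals inside a coarse one, it is the orthogonality of martingale increments.\<close>

lemma sum_norm_sq_deviation:
  fixes f :: "nat \<Rightarrow> 'h::real_inner"
  assumes "(\<Sum>i\<in>A. f i) = real (card A) *\<^sub>R d"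
  shows "(\<Sum>i\<in>A. (norm (f i - d))\<^sup>2) = (\<Sum>i\<in>A. (norm (f i))\<^sup>2) - real (card A) * (norm d)\<^sup>2"
proof -
  have "(\<Sum>i\<in>A. (norm (f i - d))\<^sup>2)
      = (\<Sum>i\<in>A. (norm (f i))\<^sup>2) - 2 * inner (\<Sum>i\<in>A. f i) d + real (card A) * (norm d)\<^sup>2"
    by (simp add: power2_norm_eq_inner inner_diff inner_commute inner_sum_right inner_sum_left sum.distrib
        sum_subtractf sum_distrib_left algebra_simps)
  also have "inner (\<Sum>i\<in>A. f i) d = real (card A) * (norm d)\<^sup>2"
    unfolding assms by (simp add: power2_norm_eq_inner)
  finally show ?thesis by simp
qed

section \<open>Dyadic slopes and their energy\<close>

definition dyadic_quotient :: "(real \<Rightarrow> 'h::real_normed_vector) \<Rightarrow> nat \<Rightarrow> nat \<Rightarrow> 'h" where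
  "dyadic_quotient u n i = (2 ^ n :: real) *\<^sub>R (u (real (Suc i) / 2 ^ n) - u (real i / 2 ^ n))"

lemma sum_dyadic_quotient:
  "(\<Sum>i<j. dyadic_quotient u n i) = (2 ^ n :: real) *\<^sub>R (u (real j / 2 ^ n) - u 0)"
  unfolding dyadic_quotient_def scaleR_right.sum[symmetric]
  by (subst sum_lessThan_telescope[where f = "\<lambda>i. u (real i / 2 ^ n)"]) simp

text \<open>The martingale property: by telescoping, the mean of the fine slopes over a coarse
  interval is the coarse slope.\<close>

lemma sum_dyadic_quotient_block:
  "(\<Sum>i\<in>{j * 2 ^ k..<j * 2 ^ k + 2 ^ k}. dyadic_quotient u (n + k) i)
     = (2 ^ k :: real) *\<^sub>R dyadic_quotient u n j"
proof -
  have "(\<Sum>i\<in>{j * 2 ^ k..<j * 2 ^ k + 2 ^ k}. dyadic_quotient u (n + k) i)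
     = (2 ^ (n + k) :: real) *\<^sub>R (u (real (j * 2 ^ k + 2 ^ k) / 2 ^ (n + k)) - u (real (j * 2 ^ k) / 2 ^ (n + k)))"
    unfolding dyadic_quotient_def scaleR_right.sum[symmetric]
    by (subst sum_Suc_diff'[where f = "\<lambda>i. u (real i / 2 ^ (n + k))"]) auto
  also have "real (j * 2 ^ k) / 2 ^ (n + k) = real j / 2 ^ n"
    by (simp add: power_add)
  also have "real (j * 2 ^ k + 2 ^ k) / 2 ^ (n + k) = real (Suc j) / 2 ^ n"
    by (simp add: power_add field_simps)
  finally show ?thesis by (simp add: dyadic_quotient_def power_add mult.commute)
qed

text \<open>The squared L^2 norm of the step function whose value on each dyadic interval is the
  slope there.\<close>

definition dyadic_energy :: "(real \<Rightarrow> 'h::real_normed_vector) \<Rightarrow> nat \<Rightarrow> real" where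
  "dyadic_energy u n = (\<Sum>i<2 ^ n. (norm (dyadic_quotient u n i))\<^sup>2) / 2 ^ n"

text \<open>The difference quotients form a martingale for the dyadic filtration, so increments are orthogonal.\<close>

lemma dyadic_energy_diff:
  fixes u :: "real \<Rightarrow> 'h::real_inner"
  shows "(\<Sum>i<2 ^ (n + k). (norm (dyadic_quotient u (n + k) i - dyadic_quotient u n (i div 2 ^ k)))\<^sup>2) / 2 ^ (n + k)
     = dyadic_energy u (n + k) - dyadic_energy u n"
proof -
  have block: "(\<Sum>i\<in>{j * 2 ^ k..<j * 2 ^ k + 2 ^ k}.
        (norm (dyadic_quotient u (n + k) i - dyadic_quotient u n (i div 2 ^ k)))\<^sup>2)
      = (\<Sum>i\<in>{j * 2 ^ k..<j * 2 ^ k + 2 ^ k}. (norm (dyadic_quotient u (n + k) i))\<^sup>2)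
        - 2 ^ k * (norm (dyadic_quotient u n j))\<^sup>2" for j
  proof -
    have "i div 2 ^ k = j" if "i \<in> {j * 2 ^ k..<j * 2 ^ k + 2 ^ k}" for i
      using that by (intro div_nat_eqI) (auto simp: algebra_simps)
    then have "(\<Sum>i\<in>{j * 2 ^ k..<j * 2 ^ k + 2 ^ k}.
        (norm (dyadic_quotient u (n + k) i - dyadic_quotient u n (i div 2 ^ k)))\<^sup>2)
      = (\<Sum>i\<in>{j * 2 ^ k..<j * 2 ^ k + 2 ^ k}.
        (norm (dyadic_quotient u (n + k) i - dyadic_quotient u n j))\<^sup>2)"
      by (intro sum.cong) auto
    also have "\<dots> = (\<Sum>i\<in>{j * 2 ^ k..<j * 2 ^ k + 2 ^ k}. (norm (dyadic_quotient u (n + k) i))\<^sup>2)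
        - real (card {j * 2 ^ k..<j * 2 ^ k + 2 ^ k}) * (norm (dyadic_quotient u n j))\<^sup>2"
      by (rule sum_norm_sq_deviation) (simp only: sum_dyadic_quotient_block, simp)
    finally show ?thesis by simp
  qed
  \<comment> \<open>The fine indices fall into \<open>2 ^ n\<close> blocks of length
    \<open>2 ^ k\<close>, one for each coarse interval.\<close>
  have pw: "(2::nat) ^ (n + k) = 2 ^ n * 2 ^ k" by (simp add: power_add)
  have "(\<Sum>i<2 ^ (n + k). (norm (dyadic_quotient u (n + k) i - dyadic_quotient u n (i div 2 ^ k)))\<^sup>2)
     = (\<Sum>i<2 ^ (n + k). (norm (dyadic_quotient u (n + k) i))\<^sup>2)
        - 2 ^ k * (\<Sum>j<2 ^ n. (norm (dyadic_quotient u n j))\<^sup>2)"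
    unfolding pw sum.nat_group[symmetric] block sum_subtractf sum_distrib_left ..
  then show ?thesis
    by (simp add: dyadic_energy_def diff_divide_distrib power_add)
qed


lemma norm_dyadic_quotient_le:
  assumes "L-lipschitz_on {0..1} u" "i < 2 ^ n"
  shows "norm (dyadic_quotient u n i) \<le> L"
proof -
  have "Suc i \<le> 2 ^ n" using assms(2) by simp
  then have le: "real (Suc i) \<le> 2 ^ n"
    by (metis of_nat_le_iff of_nat_numeral of_nat_power)
  have in1: "real (Suc i) / 2 ^ n \<in> {0..1}" "real i / 2 ^ n \<in> {0..1}"
    using le order_trans[OF _ le, of "real i"] by (simp_all add: pos_divide_le_eq)
  have "norm (u (real (Suc i) / 2 ^ n) - u (real i / 2 ^ n)) \<le> L * \<bar>real (Suc i) / 2 ^ n - real i / 2 ^ n\<bar>"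
    using lipschitz_onD[OF assms(1) in1] by (simp add: dist_norm)
  also have "\<dots> = L / 2 ^ n" by (simp add: field_simps)
  finally show ?thesis by (simp add: dyadic_quotient_def pos_le_divide_eq mult.commute)
qed

lemma dyadic_energy_le:
  assumes "L-lipschitz_on {0..1} u"
  shows "dyadic_energy u n \<le> L\<^sup>2"
proof -
  have "(\<Sum>i<2 ^ n. (norm (dyadic_quotient u n i))\<^sup>2) \<le> (\<Sum>i<(2::nat) ^ n. L\<^sup>2)"
    using norm_dyadic_quotient_le[OF assms] by (intro sum_mono power_mono) auto
  then show ?thesis by (simp add: dyadic_energy_def field_simps)
qed

text \<open>Refining the grid adds a sum of squares, so the energy increases, and the Lipschitz
  constant bounds it. This is the L^2 boundedness that makes the martingale converge.\<close>

lemma Cauchy_dyadic_energy: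
  fixes u :: "real \<Rightarrow> 'h::real_inner"
  assumes "L-lipschitz_on {0..1} u"
  shows "Cauchy (dyadic_energy u)" "n \<le> m \<Longrightarrow> dyadic_energy u n \<le> dyadic_energy u m"
proof -
  have mono: "dyadic_energy u n \<le> dyadic_energy u m" if "n \<le> m" for n m
  proof -
    have "0 \<le> dyadic_energy u (n + (m - n)) - dyadic_energy u n"
      unfolding dyadic_energy_diff[symmetric] by (intro divide_nonneg_nonneg sum_nonneg) auto
    then show ?thesis using that by simp
  qed
  then show "n \<le> m \<Longrightarrow> dyadic_energy u n \<le> dyadic_energy u m" .
  have "incseq (dyadic_energy u)" using mono by (simp add: incseq_def)
  then show "Cauchy (dyadic_energy u)"
    using incseq_convergent[of "dyadic_energy u" "L\<^sup>2"] dyadic_energy_le[OF assms]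
    by (metis LIMSEQ_imp_Cauchy)
qed

section \<open>Almost everywhere convergence of the dyadic step functions\<close>

definition dyadic_step :: "(real \<Rightarrow> 'h::real_normed_vector) \<Rightarrow> nat \<Rightarrow> real \<Rightarrow> 'h" where
  "dyadic_step u n t = indicator {0..<1} t *\<^sub>R dyadic_quotient u n (nat \<lfloor>2 ^ n * t\<rfloor>)"

lemma nat_floor_dyadic_less: "t \<in> {0..<1} \<Longrightarrow> nat \<lfloor>2 ^ n * t\<rfloor> < 2 ^ n" for t :: real
proof -
  assume "t \<in> {0..<1}"
  then have "2 ^ n * t < 2 ^ n" "0 \<le> 2 ^ n * t" by auto
  then have "real (nat \<lfloor>2 ^ n * t\<rfloor>) < real (2 ^ n)"
    by (simp add: floor_less_iff)
  then show ?thesis by (simp only: of_nat_less_iff)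
qed

lemma norm_dyadic_step_le:
  assumes "L-lipschitz_on {0..1} u"
  shows "norm (dyadic_step u n t) \<le> L"
  using norm_dyadic_quotient_le[OF assms nat_floor_dyadic_less, of t n] lipschitz_on_nonneg[OF assms]
  by (cases "t \<in> {0..<1}") (auto simp: dyadic_step_def)

lemma borel_measurable_dyadic_step [measurable]:
  fixes u :: "real \<Rightarrow> 'h::{banach, second_countable_topology}"
  shows "dyadic_step u n \<in> borel_measurable borel"
proof -
  have "has_bochner_integral lborel (dyadic_step u n) (\<Sum>i<2 ^ n. (1 / 2 ^ n) *\<^sub>R dyadic_quotient u n i)"
    using has_bochner_integral_uniform_step[of "2 ^ n" "2 ^ n" "dyadic_quotient u n"]
    unfolding dyadic_step_def by simp
  then show ?thesis by (auto simp: has_bochner_integral_iff)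
qed

text \<open>Nesting of the grids: the index of the coarse interval around \<open>t\<close> is
  determined by that of the fine one, so two levels can be compared on the fine grid alone.\<close>

lemma nat_floor_dyadic_div: "nat \<lfloor>2 ^ n * t\<rfloor> = nat \<lfloor>2 ^ (n + k) * t\<rfloor> div 2 ^ k" for t :: real
proof -
  have "\<lfloor>2 ^ (n + k) * t / real_of_int (2 ^ k)\<rfloor> = \<lfloor>2 ^ (n + k) * t\<rfloor> div 2 ^ k"
    by (rule floor_divide_real_eq_div) simp
  moreover have "2 ^ (n + k) * t / real_of_int (2 ^ k) = 2 ^ n * t" by (simp add: power_add)
  ultimately have *: "\<lfloor>2 ^ n * t\<rfloor> = \<lfloor>2 ^ (n + k) * t\<rfloor> div 2 ^ k" by simp
  have "nat (z div 2 ^ k) = nat z div 2 ^ k" for z :: int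
    by (cases "0 \<le> z") (simp_all add: nat_div_distrib nat_power_eq div_neg_pos_less0 less_imp_le)
  then show ?thesis unfolding * .
qed

lemma has_bochner_integral_dyadic_step_diff:
  fixes u :: "real \<Rightarrow> 'h::{real_inner, banach, second_countable_topology}"
  shows "has_bochner_integral lborel (\<lambda>t. (norm (dyadic_step u (n + k) t - dyadic_step u n t))\<^sup>2)
     (dyadic_energy u (n + k) - dyadic_energy u n)"
proof -
  let ?F = "\<lambda>i. (norm (dyadic_quotient u (n + k) i - dyadic_quotient u n (i div 2 ^ k)))\<^sup>2"
  have "(norm (dyadic_step u (n + k) t - dyadic_step u n t))\<^sup>2
      = indicator {0..<1} t *\<^sub>R ?F (nat \<lfloor>2 ^ (n + k) * t\<rfloor>)" for t :: real
    unfolding dyadic_step_def nat_floor_dyadic_div[of n t k] by (simp add: indicator_def)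
  moreover have "has_bochner_integral lborel (\<lambda>t::real. indicator {0..<1} t *\<^sub>R ?F (nat \<lfloor>2 ^ (n + k) * t\<rfloor>))
      (\<Sum>i<2 ^ (n + k). (1 / 2 ^ (n + k)) *\<^sub>R ?F i)"
    using has_bochner_integral_uniform_step[of "2 ^ (n + k)" "2 ^ (n + k)" ?F] by simp
  moreover have "(\<Sum>i<2 ^ (n + k). (1 / 2 ^ (n + k)) *\<^sub>R ?F i) = dyadic_energy u (n + k) - dyadic_energy u n"
    unfolding dyadic_energy_diff[symmetric] by (simp add: sum_divide_distrib)
  ultimately show ?thesis by simp
qed

text \<open>Passage from L^2 to L^1 on an interval of length 1, by the pointwise inequality
  \<open>a \<le> d / 2 + a^2 / (2 * d)\<close>, whose two terms integrate to at most
  \<open>d / 2\<close> each.\<close>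

lemma nn_integral_norm_dyadic_step_diff_le:
  fixes u :: "real \<Rightarrow> 'h::{real_inner, banach, second_countable_topology}"
  assumes d: "d > 0" and le: "dyadic_energy u (n + k) - dyadic_energy u n \<le> d\<^sup>2"
  shows "(\<integral>\<^sup>+t. ennreal (norm (dyadic_step u (n + k) t - dyadic_step u n t)) \<partial>lborel) \<le> ennreal d"
proof -
  let ?g = "\<lambda>t. norm (dyadic_step u (n + k) t - dyadic_step u n t)"
  let ?h = "\<lambda>t. (d / 2) * indicator {0..<1} t + (1 / (2 * d)) * (?g t)\<^sup>2"
  have "has_bochner_integral lborel ?h ((d / 2) * measure lborel {0..<1::real} +
      (1 / (2 * d)) * (dyadic_energy u (n + k) - dyadic_energy u n))"
    by (intro has_bochner_integral_add has_bochner_integral_mult_right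
        has_bochner_integral_dyadic_step_diff has_bochner_integral_real_indicator) auto
  then have h: "integrable lborel ?h" "integral\<^sup>L lborel ?h = d / 2 +
      (1 / (2 * d)) * (dyadic_energy u (n + k) - dyadic_energy u n)"
    by (auto simp: has_bochner_integral_iff)
  have gh: "?g t \<le> ?h t" for t
  proof (cases "t \<in> {0..<1}")
    case True
    have "2 * d * ?g t \<le> d\<^sup>2 + (?g t)\<^sup>2" using sum_squares_bound[of d "?g t"] by simp
    then have "?g t \<le> (d\<^sup>2 + (?g t)\<^sup>2) / (2 * d)" using d by (simp add: pos_le_divide_eq mult.commute)
    also have "\<dots> = d / 2 + (1 / (2 * d)) * (?g t)\<^sup>2" using d by (simp add: add_divide_distrib power2_eq_square)
    finally show ?thesis using True by simp
  next
    case False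
    then have "?g t = 0" by (simp add: dyadic_step_def)
    then show ?thesis using d by simp
  qed
  have "(\<integral>\<^sup>+t. ennreal (?g t) \<partial>lborel) \<le> (\<integral>\<^sup>+t. ennreal (?h t) \<partial>lborel)"
    using gh by (intro nn_integral_mono ennreal_leI)
  also have "\<dots> = ennreal (integral\<^sup>L lborel ?h)"
    using h(1) d by (intro nn_integral_eq_integral) auto
  also have "\<dots> \<le> ennreal d"
  proof (rule ennreal_leI)
    have "(1 / (2 * d)) * (dyadic_energy u (n + k) - dyadic_energy u n) \<le> (1 / (2 * d)) * d\<^sup>2"
      using d le by (intro mult_left_mono) auto
    also have "\<dots> = d / 2" using d by (simp add: power2_eq_square)
    finally show "integral\<^sup>L lborel ?h \<le> d"
      unfolding h(2) using field_sum_of_halves[of d] by (metis add_left_mono)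
  qed
  finally show ?thesis .
qed

text \<open>Along a subsequence the successive L^1 distances are at most \<open>(1/2) ^ k\<close>.
  The series of increments is then integrable, hence absolutely convergent at almost every
  point.\<close>

lemma dyadic_step_subsequence_AE_convergent:
  fixes u :: "real \<Rightarrow> 'h::{real_inner, banach, second_countable_topology}"
  assumes lip: "L-lipschitz_on {0..1} u"
  shows "\<exists>r. (\<forall>k. k \<le> r k) \<and> (AE t in lborel. convergent (\<lambda>k. dyadic_step u (r k) t))"
proof -
  have "\<exists>N. \<forall>m\<ge>N. \<forall>n\<ge>N. dist (dyadic_energy u m) (dyadic_energy u n) < ((1/2) ^ k)\<^sup>2" for k
    using Cauchy_dyadic_energy(1)[OF lip] unfolding Cauchy_def by simp
  then obtain N where N: "\<And>k m n. m \<ge> N k \<Longrightarrow> n \<ge> N k \<Longrightarrow>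
      dist (dyadic_energy u m) (dyadic_energy u n) < ((1/2) ^ k)\<^sup>2"
    by metis
  \<comment> \<open>The sum makes \<open>r\<close> increasing and at least \<open>N k\<close>; the
    summand \<open>k\<close> makes it tend to infinity.\<close>
  define r where "r k = k + (\<Sum>i\<le>k. N i)" for k
  have rk: "k \<le> r k" for k by (simp add: r_def)
  have rN: "N k \<le> r k" for k
    using member_le_sum[of k "{..k}" N] by (simp add: r_def)
  have rmono: "r k \<le> r (Suc k)" for k by (simp add: r_def)
  let ?g = "\<lambda>k t. norm (dyadic_step u (r (Suc k)) t - dyadic_step u (r k) t)"
  have g_le: "(\<integral>\<^sup>+t. ennreal (?g k t) \<partial>lborel) \<le> ennreal ((1/2) ^ k)" for k
  proof -
    have eq: "r k + (r (Suc k) - r k) = r (Suc k)" using rmono[of k] by simp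
    have "dyadic_energy u (r k + (r (Suc k) - r k)) - dyadic_energy u (r k) \<le> ((1/2) ^ k)\<^sup>2"
      unfolding eq using N[of k "r (Suc k)" "r k"] rN[of k] rmono[of k] by (simp add: dist_real_def)
    from nn_integral_norm_dyadic_step_diff_le[OF _ this] show ?thesis unfolding eq by simp
  qed
  have "(\<integral>\<^sup>+t. (\<Sum>k. ennreal (?g k t)) \<partial>lborel) = (\<Sum>k. \<integral>\<^sup>+t. ennreal (?g k t) \<partial>lborel)"
    by (intro nn_integral_suminf) measurable
  also have "\<dots> \<le> (\<Sum>k. ennreal ((1/2) ^ k))"
    using g_le by (intro suminf_le) auto
  also have "\<dots> = ennreal (\<Sum>k. (1/2) ^ k)"
    by (intro suminf_ennreal2) (auto intro: summable_geometric)
  also have "\<dots> < \<infinity>" by simp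
  finally have "(\<integral>\<^sup>+t. (\<Sum>k. ennreal (?g k t)) \<partial>lborel) \<noteq> \<infinity>" by simp
  then have "AE t in lborel. (\<Sum>k. ennreal (?g k t)) \<noteq> \<infinity>"
    by (intro nn_integral_PInf_AE) measurable
  then have "AE t in lborel. convergent (\<lambda>k. dyadic_step u (r k) t)"
  proof (rule AE_mp, intro AE_I2 impI)
    fix t assume "(\<Sum>k. ennreal (?g k t)) \<noteq> \<infinity>"
    then have "summable (\<lambda>k. ?g k t)" by (intro summable_suminf_not_top) auto
    then have "summable (\<lambda>k. dyadic_step u (r (Suc k)) t - dyadic_step u (r k) t)"
      by (rule summable_norm_cancel)
    then have "convergent (\<lambda>n. \<Sum>k<n. (dyadic_step u (r (Suc k)) t - dyadic_step u (r k) t))"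
      by (simp add: summable_iff_convergent)
    then have "convergent (\<lambda>n. dyadic_step u (r n) t - dyadic_step u (r 0) t)"
      by (simp add: sum_lessThan_telescope[where f = "\<lambda>k. dyadic_step u (r k) t"])
    then show "convergent (\<lambda>k. dyadic_step u (r k) t)"
      by (subst (asm) convergent_diff_const_right_iff)
  qed
  then show ?thesis using rk by blast
qed

text \<open>The Radon-Nikodym property of Hilbert spaces for Lipschitz curves. The slopes stay
  bounded by \<open>L\<close>, so dominated convergence carries the telescoping identity to the
  limit at dyadic points, and continuity carries it to all others.\<close>

proposition lipschitz_on_imp_primitive:
  fixes u :: "real \<Rightarrow> 'h::{real_inner, banach, second_countable_topology}"
  assumes lip: "L-lipschitz_on {0..1} u"
  obtains v where "v \<in> borel_measurable borel" "\<And>t. norm (v t) \<le> L"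
    "\<And>t. t \<in> {0..<1} \<Longrightarrow> (\<integral>s. indicator {0..<t} s *\<^sub>R v s \<partial>lborel) = u t - u 0"
proof -
  obtain r where r: "\<And>k. k \<le> r k" and conv: "AE t in lborel. convergent (\<lambda>k. dyadic_step u (r k) t)"
    using dyadic_step_subsequence_AE_convergent[OF lip] by blast
  define w where "w t = lim (\<lambda>k. dyadic_step u (r k) t)" for t
  have [measurable]: "w \<in> borel_measurable borel"
    unfolding w_def by (intro borel_measurable_lim_metric) measurable
  \<comment> \<open>The cut-off changes \<open>w\<close> only on a null set and makes the bound by
    \<open>L\<close> hold at every point.\<close>
  define v where "v t = (if norm (w t) \<le> L then w t else 0)" for t
  have vm [measurable]: "v \<in> borel_measurable borel" unfolding v_def by measurable
  have vL: "norm (v t) \<le> L" for t using lipschitz_on_nonneg[OF lip] by (simp add: v_def)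
  have lim: "AE t in lborel. (\<lambda>k. dyadic_step u (r k) t) \<longlonglongrightarrow> v t"
    using conv
  proof (rule AE_mp, intro AE_I2 impI)
    fix t assume "convergent (\<lambda>k. dyadic_step u (r k) t)"
    then have *: "(\<lambda>k. dyadic_step u (r k) t) \<longlonglongrightarrow> w t"
      unfolding w_def by (rule convergent_LIMSEQ_iff[THEN iffD1])
    have "norm (w t) \<le> L"
      by (rule Lim_bounded[OF tendsto_norm[OF *], of 0]) (simp add: norm_dyadic_step_le[OF lip])
    then show "(\<lambda>k. dyadic_step u (r k) t) \<longlonglongrightarrow> v t" using * by (simp add: v_def)
  qed
  have dyadic: "(\<integral>s. indicator {0..<real j / 2 ^ n} s *\<^sub>R v s \<partial>lborel) = u (real j / 2 ^ n) - u 0"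
    if j: "j \<le> 2 ^ n" for j n
  proof -
    have j1: "real j / 2 ^ n \<le> 1" using j by (simp add: pos_divide_le_eq)
    \<comment> \<open>From level \<open>n\<close> on, \<open>j / 2 ^ n\<close> is a point of the
      finer grid \<open>r k\<close>, so the integral telescopes exactly and the sequence of
      integrals is eventually constant.\<close>
    have eq: "(\<integral>s. indicator {0..<real j / 2 ^ n} s *\<^sub>R dyadic_step u (r k) s \<partial>lborel) = u (real j / 2 ^ n) - u 0"
      if "n \<le> k" for k
    proof -
      define m where "m = r k - n"
      have rk: "r k = n + m" using r[of k] that by (simp add: m_def)
      have jj: "real (j * 2 ^ m) / 2 ^ r k = real j / 2 ^ n" by (simp add: rk power_add)
      have "has_bochner_integral lborel
          (\<lambda>s. indicator {0..<real j / 2 ^ n} s *\<^sub>R dyadic_quotient u (r k) (nat \<lfloor>2 ^ r k * s\<rfloor>))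
          (\<Sum>i<j * 2 ^ m. (1 / 2 ^ r k) *\<^sub>R dyadic_quotient u (r k) i)"
        using has_bochner_integral_uniform_step[of "2 ^ r k" "j * 2 ^ m" "dyadic_quotient u (r k)"]
        unfolding jj by simp
      moreover have "indicator {0..<real j / 2 ^ n} s *\<^sub>R dyadic_quotient u (r k) (nat \<lfloor>2 ^ r k * s\<rfloor>)
          = indicator {0..<real j / 2 ^ n} s *\<^sub>R dyadic_step u (r k) s" for s
        using order_less_le_trans[OF _ j1, of s] by (auto simp: indicator_def dyadic_step_def)
      moreover have "(\<Sum>i<j * 2 ^ m. (1 / 2 ^ r k) *\<^sub>R dyadic_quotient u (r k) i) = u (real j / 2 ^ n) - u 0"
        unfolding scaleR_right.sum[symmetric] sum_dyadic_quotient jj by simp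
      ultimately show ?thesis by (simp add: has_bochner_integral_iff)
    qed
    have "(\<lambda>k. \<integral>s. indicator {0..<real j / 2 ^ n} s *\<^sub>R dyadic_step u (r k) s \<partial>lborel)
        \<longlonglongrightarrow> (\<integral>s. indicator {0..<real j / 2 ^ n} s *\<^sub>R v s \<partial>lborel)"
    proof (rule integral_dominated_convergence[where w = "\<lambda>s. L * indicator {0..<real j / 2 ^ n} s"])
      show "AE s in lborel. (\<lambda>k. indicator {0..<real j / 2 ^ n} s *\<^sub>R dyadic_step u (r k) s)
          \<longlonglongrightarrow> indicator {0..<real j / 2 ^ n} s *\<^sub>R v s"
        using lim by (rule AE_mp, intro AE_I2 impI) (intro tendsto_intros)
      show "AE s in lborel. norm (indicator {0..<real j / 2 ^ n} s *\<^sub>R dyadic_step u (r k) s)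
          \<le> L * indicator {0..<real j / 2 ^ n} s" for k
        by (intro AE_I2) (simp add: indicator_def norm_dyadic_step_le[OF lip])
    qed (auto intro!: integrable_mult_right integrable_real_indicator)
    moreover have "(\<lambda>k. \<integral>s. indicator {0..<real j / 2 ^ n} s *\<^sub>R dyadic_step u (r k) s \<partial>lborel)
        \<longlonglongrightarrow> u (real j / 2 ^ n) - u 0"
      by (rule tendsto_eventually, rule eventually_mono[OF eventually_ge_at_top[of n]]) (rule eq)
    ultimately show ?thesis by (rule LIMSEQ_unique)
  qed
  have "(\<integral>s. indicator {0..<t} s *\<^sub>R v s \<partial>lborel) = u t - u 0" if t: "t \<in> {0..<1}" for t
  proof -
    \<comment> \<open>\<open>q n\<close> is the dyadic point just below \<open>t\<close>.
      Approximation from below keeps \<open>{0..<q n}\<close> inside \<open>{0..<t}\<close>, which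
      gives the dominating function.\<close>
    define j where "j n = nat \<lfloor>2 ^ n * t\<rfloor>" for n
    define q where "q n = real (j n) / 2 ^ n" for n
    have qt: "q n \<le> t" "t - 1 / 2 ^ n < q n" for n
    proof -
      have "0 \<le> 2 ^ n * t" using t by simp
      then have "real (j n) \<le> 2 ^ n * t" "2 ^ n * t < real (j n) + 1"
        unfolding j_def by (simp, linarith)
      then have "q n \<le> t" "t < (real (j n) + 1) / 2 ^ n"
        by (simp_all add: q_def pos_divide_le_eq pos_less_divide_eq mult.commute)
      then show "q n \<le> t" "t - 1 / 2 ^ n < q n" by (simp_all add: q_def add_divide_distrib)
    qed
    have "(\<lambda>n. 1 / 2 ^ n :: real) \<longlonglongrightarrow> 0"
      using LIMSEQ_divide_realpow_zero[of 2 1] by simp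
    then have low: "(\<lambda>n. t - 1 / 2 ^ n) \<longlonglongrightarrow> t" using tendsto_diff[OF tendsto_const[of t]] by fastforce
    have q: "q \<longlonglongrightarrow> t"
      by (rule tendsto_sandwich[OF _ _ low tendsto_const]) (auto intro: always_eventually less_imp_le qt)
    have eqn: "(\<integral>s. indicator {0..<q n} s *\<^sub>R v s \<partial>lborel) = u (q n) - u 0" for n
      unfolding q_def by (rule dyadic) (use nat_floor_dyadic_less[OF t, of n] in \<open>simp add: j_def\<close>)
    have q01: "q n \<in> {0..1}" for n using order_trans[OF qt(1)[of n], of 1] t by (simp add: q_def)
    have "continuous_on {0..1} u" using lip by (rule lipschitz_on_continuous_on)
    then have "(\<lambda>n. u (q n)) \<longlonglongrightarrow> u t"
      using q q01 t by (intro continuous_on_tendsto_compose[of "{0..1}" u]) auto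
    then have "(\<lambda>n. u (q n) - u 0) \<longlonglongrightarrow> u t - u 0" by (intro tendsto_intros)
    moreover have "(\<lambda>n. \<integral>s. indicator {0..<q n} s *\<^sub>R v s \<partial>lborel) \<longlonglongrightarrow> (\<integral>s. indicator {0..<t} s *\<^sub>R v s \<partial>lborel)"
    proof (rule integral_dominated_convergence[where w = "\<lambda>s. L * indicator {0..<t} s"])
      show "AE s in lborel. (\<lambda>n. indicator {0..<q n} s *\<^sub>R v s) \<longlonglongrightarrow> indicator {0..<t} s *\<^sub>R v s"
      proof (intro AE_I2)
        fix s
        have "\<forall>\<^sub>F n in sequentially. indicator {0..<q n} s = (indicator {0..<t} s :: real)"
        proof (cases "s < t")
          case True
          with q have "\<forall>\<^sub>F n in sequentially. s < q n" by (rule order_tendstoD)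
          then show ?thesis by eventually_elim (use True in \<open>simp add: indicator_def\<close>)
        next
          case False
          then have "\<not> s < q n" for n using qt(1)[of n] by linarith
          then show ?thesis using False by (simp add: indicator_def)
        qed
        then have "\<forall>\<^sub>F n in sequentially. indicator {0..<q n} s *\<^sub>R v s = indicator {0..<t} s *\<^sub>R v s"
          by eventually_elim simp
        then show "(\<lambda>n. indicator {0..<q n} s *\<^sub>R v s) \<longlonglongrightarrow> indicator {0..<t} s *\<^sub>R v s"
          by (rule tendsto_eventually)
      qed
      show "AE s in lborel. norm (indicator {0..<q n} s *\<^sub>R v s) \<le> L * indicator {0..<t} s" for n
        using qt(1)[of n] vL lipschitz_on_nonneg[OF lip]
        by (intro AE_I2) (auto simp: indicator_def)
    qed (use t in \<open>auto intro!: integrable_mult_right integrable_real_indicator\<close>)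
    ultimately show ?thesis using LIMSEQ_unique by (simp only: eqn) blast
  qed
  with vm vL show thesis by (intro that)
qed

section \<open>Weak derivatives of Lipschitz curves\<close>

lemma L2_on_bounded:
  fixes u :: "real \<Rightarrow> 'h::{real_normed_vector, second_countable_topology}"
  assumes u: "set_borel_measurable lborel {a<..<b} u" and bd: "\<And>t. t \<in> {a<..<b} \<Longrightarrow> norm (u t) \<le> C"
  shows "L2_on a b u"
proof -
  define w where "w t = indicator {a<..<b} t *\<^sub>R u t" for t
  have w[measurable]: "w \<in> borel_measurable borel"
    using u unfolding set_borel_measurable_def w_def by simp
  have "(norm (u t))\<^sup>2 \<le> C\<^sup>2" if "t \<in> {a<..<b}" for t using bd[OF that] by (intro power_mono) auto
  then have le: "norm ((norm (w t))\<^sup>2) \<le> norm (C\<^sup>2 * indicator {a<..<b} t)" for t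
    by (simp add: w_def indicator_def)
  have "integrable lborel (\<lambda>t. C\<^sup>2 * indicator {a<..<b} t)"
    by (intro integrable_mult_right integrable_real_indicator emeasure_bounded_finite) simp_all
  then have "integrable lborel (\<lambda>t. (norm (w t))\<^sup>2)"
  proof (rule Bochner_Integration.integrable_bound)
    show "AE t in lborel. norm ((norm (w t))\<^sup>2) \<le> norm (C\<^sup>2 * indicator {a<..<b} t)"
      using le by (rule AE_I2)
  qed measurable
  moreover have "(norm (w t))\<^sup>2 = indicator {a<..<b} t *\<^sub>R (norm (u t))\<^sup>2" for t
    by (simp add: w_def indicator_def)
  ultimately show ?thesis using u by (simp add: L2_on_def set_integrable_def)
qed

text \<open>By Fubini's theorem, a primitive of a bounded function \<open>v\<close> has weak derivative \<open>v\<close>.\<close>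

proposition lipschitz_on_imp_H1_on:
  fixes u :: "real \<Rightarrow> 'h::{real_inner, banach, second_countable_topology}"
  assumes lip: "L-lipschitz_on {0<..<1} u"
  shows "H1_on 0 1 u"
proof -
  \<comment> \<open>The extension to the closed interval supplies the value \<open>g 0\<close> from
    which the primitive starts.\<close>
  have "closure {0<..<1::real} = {0..1}" by (rule closure_greaterThanLessThan) simp
  then obtain g where g: "L-lipschitz_on {0..1} g" and gu: "\<And>t. t \<in> {0<..<1} \<Longrightarrow> g t = u t"
    using lipschitz_extend_closure[OF lip] by auto
  obtain v where v [measurable]: "v \<in> borel_measurable borel" and vL: "\<And>t. norm (v t) \<le> L"
    and prim: "\<And>t. t \<in> {0..<1} \<Longrightarrow> (\<integral>s. indicator {0..<t} s *\<^sub>R v s \<partial>lborel) = g t - g 0"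
    using lipschitz_on_imp_primitive[OF g] by blast
  have L0: "L \<ge> 0" using lip by (rule lipschitz_on_nonneg)
  have gcont: "continuous_on {0..1} g" using g by (rule lipschitz_on_continuous_on)
  have "set_borel_measurable lborel {0<..<1} u"
    unfolding set_borel_measurable_def using lipschitz_on_continuous_on[OF lip]
    by (simp add: borel_measurable_continuous_on_indicator)
  moreover have "norm (u t) \<le> L + norm (g 0)" if t: "t \<in> {0<..<1}" for t
  proof -
    have "dist (g t) (g 0) \<le> L * dist t 0" using lipschitz_onD[OF g, of t 0] t by simp
    also have "\<dots> \<le> L * 1" using L0 t by (intro mult_left_mono) auto
    finally have "dist (g t) (g 0) \<le> L" by simp
    then show ?thesis using gu[OF t] norm_triangle_ineq[of "g t - g 0" "g 0"] by (simp add: dist_norm)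
  qed
  ultimately have u2: "L2_on 0 1 u" by (rule L2_on_bounded)
  have v2: "L2_on 0 1 v"
    by (rule L2_on_bounded[of _ _ _ L]) (auto simp: set_borel_measurable_def vL)
  have "(LBINT t:{0<..<1}. deriv \<eta> t *\<^sub>R u t) = - (LBINT t:{0<..<1}. \<eta> t *\<^sub>R v t)"
    if test: "test_function 0 1 \<eta>" for \<eta>
  proof -
    from test have smooth: "\<And>n t. (deriv ^^ n) \<eta> field_differentiable (at t)"
      by (simp add: test_function_def)
    from test obtain a' b' where ab: "0 < a'" "b' < 1" "\<And>t. t \<notin> {a'..b'} \<Longrightarrow> \<eta> t = 0"
      by (auto simp: test_function_def)
    have \<eta>0: "\<eta> t = 0" if "t \<notin> {0<..<1}" for t using ab that by auto
    have d: "(\<eta> has_real_derivative deriv \<eta> t) (at t)" for t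
      using smooth[of 0 t] by (simp add: DERIV_deriv_iff_field_differentiable)
    have dc: "continuous_on A (deriv \<eta>)" for A
      using smooth[of 1] by (intro continuous_at_imp_continuous_on)
        (auto intro!: field_differentiable_imp_continuous_at)
    have [measurable]: "deriv \<eta> \<in> borel_measurable borel"
      using dc by (rule borel_measurable_continuous_onI)
    have FTC: "has_bochner_integral lborel (\<lambda>t. indicator {s..1} t *\<^sub>R deriv \<eta> t) (- \<eta> s)" if "s \<le> 1" for s
    proof -
      have "has_bochner_integral lborel (\<lambda>t. indicator {s..1} t *\<^sub>R deriv \<eta> t) (\<eta> 1 - \<eta> s)"
        using that d dc by (intro has_bochner_integral_FTC_Icc)
          (auto intro: has_vector_derivative_at_within simp: has_real_derivative_iff_has_vector_derivative)
      then show ?thesis using \<eta>0[of 1] by simp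
    qed
    \<comment> \<open>The integrand on the triangle \<open>s < t\<close>. Integrating first in
      \<open>s\<close> gives \<open>deriv \<eta> t *\<^sub>R (g t - g 0)\<close>; integrating first
      in \<open>t\<close> gives \<open>- \<eta> s *\<^sub>R v s\<close>, because
      \<open>\<eta> 1 = 0\<close>.\<close>
    define f where "f s t = (if 0 \<le> s \<and> s < t \<and> 0 < t \<and> t < 1 then deriv \<eta> t *\<^sub>R v s else 0)" for s t
    have "bounded (deriv \<eta> ` {0..1})"
      by (intro compact_imp_bounded compact_continuous_image dc compact_Icc)
    then obtain C where C: "\<And>t. t \<in> {0..1} \<Longrightarrow> norm (deriv \<eta> t) \<le> C"
      unfolding bounded_iff by blast
    have C0: "C \<ge> 0" using order_trans[OF norm_ge_zero C[of 0]] by simp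
    have fint: "integrable (lborel \<Otimes>\<^sub>M lborel) (case_prod f)"
    proof (rule Bochner_Integration.integrable_bound)
      have "({0..1} \<times> {0..1} :: (real \<times> real) set) \<in> sets (lborel \<Otimes>\<^sub>M lborel)"
        by (rule pair_measureI) auto
      moreover have "emeasure (lborel \<Otimes>\<^sub>M lborel) ({0..1} \<times> {0..1} :: (real \<times> real) set) < \<infinity>"
        by (subst lborel.emeasure_pair_measure_Times) auto
      ultimately show "integrable (lborel \<Otimes>\<^sub>M lborel) (\<lambda>z :: real \<times> real. C * L * indicator ({0..1} \<times> {0..1}) z :: real)"
        by (intro integrable_mult_right integrable_real_indicator)
      show "case_prod f \<in> borel_measurable (lborel \<Otimes>\<^sub>M lborel)"
        unfolding f_def by measurable
      show "AE z in lborel \<Otimes>\<^sub>M lborel. norm (case_prod f z) \<le> norm (C * L * indicator ({0..1} \<times> {0..1}) z)"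
      proof (intro AE_I2)
        fix z :: "real \<times> real"
        obtain s t where z: "z = (s, t)" by (cases z)
        have "norm (deriv \<eta> t *\<^sub>R v s) \<le> C * L" if "t \<in> {0..1}"
          unfolding norm_scaleR using C[OF that] vL[of s] C0 by (intro mult_mono) auto
        then show "norm (case_prod f z) \<le> norm (C * L * indicator ({0..1} \<times> {0..1}) z)"
          using C0 L0 by (simp add: z f_def indicator_def)
      qed
    qed
    have inner_s: "(\<integral>s. f s t \<partial>lborel) = indicator {0<..<1} t *\<^sub>R deriv \<eta> t *\<^sub>R (g t - g 0)" for t
    proof (cases "t \<in> {0<..<1}")
      case True
      then have eq: "f s t = deriv \<eta> t *\<^sub>R (indicator {0..<t} s *\<^sub>R v s)" for s
        by (simp add: f_def indicator_def)
      have "(\<integral>s. f s t \<partial>lborel) = deriv \<eta> t *\<^sub>R (\<integral>s. indicator {0..<t} s *\<^sub>R v s \<partial>lborel)"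
        unfolding eq by (rule integral_scaleR_right)
      then show ?thesis using True prim[of t] by simp
    next
      case False
      then have "f s t = 0" for s by (auto simp: f_def)
      then show ?thesis using False by simp
    qed
    have inner_t: "(\<integral>t. f s t \<partial>lborel) = - (indicator {0<..<1} s *\<^sub>R \<eta> s *\<^sub>R v s)" for s
    proof (cases "s \<in> {0..1}")
      case True
      have "(\<integral>t. f s t \<partial>lborel) = (\<integral>t. (indicator {s..1} t *\<^sub>R deriv \<eta> t) *\<^sub>R v s \<partial>lborel)"
      proof (rule integral_cong_AE)
        show "AE t in lborel. f s t = (indicator {s..1} t *\<^sub>R deriv \<eta> t) *\<^sub>R v s"
          using AE_lborel_singleton[of s] AE_lborel_singleton[of 1]
          by eventually_elim (use True in \<open>auto simp: f_def indicator_def\<close>)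
      qed (auto simp: f_def)
      also have "\<dots> = - \<eta> s *\<^sub>R v s"
        using FTC[of s] True by (subst integral_scaleR_left) (auto simp: has_bochner_integral_iff)
      also have "\<dots> = - (indicator {0<..<1} s *\<^sub>R \<eta> s *\<^sub>R v s)"
        using \<eta>0[of s] by (cases "s \<in> {0<..<1}") auto
      finally show ?thesis .
    next
      case False
      then have "f s t = 0" for t by (auto simp: f_def)
      moreover have "s \<notin> {0<..<1}" using False by auto
      ultimately show ?thesis by simp
    qed
    \<comment> \<open>The constant \<open>g 0\<close> drops out: \<open>\<eta>\<close> vanishes at
      both end points, so its derivative has integral zero.\<close>
    have i1: "integrable lborel (\<lambda>t. indicator {0<..<1} t *\<^sub>R deriv \<eta> t)"
      and z1: "(\<integral>t. indicator {0<..<1} t *\<^sub>R deriv \<eta> t \<partial>lborel) = 0"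
    proof -
      have *: "AE t in lborel. indicator {0..1} t *\<^sub>R deriv \<eta> t = indicator {0<..<1} t *\<^sub>R deriv \<eta> t"
        using AE_lborel_singleton[of 0] AE_lborel_singleton[of 1]
        by eventually_elim (auto simp: indicator_def)
      have A: "has_bochner_integral lborel (\<lambda>t. indicator {0..1} t *\<^sub>R deriv \<eta> t) 0"
        using FTC[of 0] \<eta>0[of 0] by simp
      show "integrable lborel (\<lambda>t. indicator {0<..<1} t *\<^sub>R deriv \<eta> t)"
        by (rule integrable_cong_AE_imp[OF integrable.intros[OF A] _ *]) measurable
      have "(\<integral>t. indicator {0..1} t *\<^sub>R deriv \<eta> t \<partial>lborel) = (\<integral>t. indicator {0<..<1} t *\<^sub>R deriv \<eta> t \<partial>lborel)"
        by (rule integral_cong_AE[OF _ _ *]) measurable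
      then show "(\<integral>t. indicator {0<..<1} t *\<^sub>R deriv \<eta> t \<partial>lborel) = 0"
        using has_bochner_integral_integral_eq[OF A] by simp
    qed
    have i2: "integrable lborel (\<lambda>t. indicator {0<..<1} t *\<^sub>R deriv \<eta> t *\<^sub>R (g t - g 0))"
      using lborel_pair.integrable_snd[OF fint] unfolding inner_s .
    have "(LBINT t:{0<..<1}. deriv \<eta> t *\<^sub>R u t)
        = (\<integral>t. (indicator {0<..<1} t *\<^sub>R deriv \<eta> t) *\<^sub>R g 0
            + indicator {0<..<1} t *\<^sub>R deriv \<eta> t *\<^sub>R (g t - g 0) \<partial>lborel)"
      unfolding set_lebesgue_integral_def
      by (intro Bochner_Integration.integral_cong) (auto simp: indicator_def gu scaleR_diff_right)
    also have "\<dots> = (\<integral>t. indicator {0<..<1} t *\<^sub>R deriv \<eta> t *\<^sub>R (g t - g 0) \<partial>lborel)"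
      using i1 i2 z1 by (subst Bochner_Integration.integral_add) (auto simp del: real_scaleR_def)
    also have "\<dots> = (\<integral>t. \<integral>s. f s t \<partial>lborel \<partial>lborel)" unfolding inner_s ..
    also have "\<dots> = (\<integral>s. \<integral>t. f s t \<partial>lborel \<partial>lborel)"
      by (rule lborel_pair.Fubini_integral[OF fint])
    also have "\<dots> = - (LBINT t:{0<..<1}. \<eta> t *\<^sub>R v t)"
      unfolding inner_t set_lebesgue_integral_def by simp
    finally show ?thesis .
  qed
  with u2 v2 show ?thesis unfolding H1_on_def by blast
qed

section \<open>Uniform boundedness\<close>

text \<open>What C(X) and C^m(X) have in common, so that both cases of the theorem run through a
  single argument.\<close>

locale seminormed_functions =
  fixes D :: "('a \<Rightarrow> real) set" and N :: "('a \<Rightarrow> real) \<Rightarrow> real"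
  assumes zero_mem: "(\<lambda>x. 0) \<in> D"
    and add_mem: "\<lbrakk>\<phi> \<in> D; \<psi> \<in> D\<rbrakk> \<Longrightarrow> (\<lambda>x. \<phi> x + \<psi> x) \<in> D"
    and scale_mem: "\<phi> \<in> D \<Longrightarrow> (\<lambda>x. r * \<phi> x) \<in> D"
    and N_nonneg: "\<phi> \<in> D \<Longrightarrow> 0 \<le> N \<phi>"
    and N_add: "\<lbrakk>\<phi> \<in> D; \<psi> \<in> D\<rbrakk> \<Longrightarrow> N (\<lambda>x. \<phi> x + \<psi> x) \<le> N \<phi> + N \<psi>"
    and N_scale: "\<phi> \<in> D \<Longrightarrow> N (\<lambda>x. r * \<phi> x) = \<bar>r\<bar> * N \<phi>"
begin

lemma diff_mem: "\<lbrakk>\<phi> \<in> D; \<psi> \<in> D\<rbrakk> \<Longrightarrow> (\<lambda>x. \<phi> x - \<psi> x) \<in> D"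
  using add_mem[of \<phi> "\<lambda>x. (-1) * \<psi> x"] scale_mem[of \<psi> "-1"] by simp

lemma N_zero: "N (\<lambda>x. 0) = 0"
  using N_scale[OF zero_mem, of 0] by simp

lemma dual_add: "\<lbrakk>L \<in> dual_space D N; \<phi> \<in> D; \<psi> \<in> D\<rbrakk> \<Longrightarrow> L (\<lambda>x. \<phi> x + \<psi> x) = L \<phi> + L \<psi>"
  by (simp add: dual_space_def)

lemma dual_scale: "\<lbrakk>L \<in> dual_space D N; \<phi> \<in> D\<rbrakk> \<Longrightarrow> L (\<lambda>x. r * \<phi> x) = r * L \<phi>"
  by (simp add: dual_space_def)

lemma dual_diff: "\<lbrakk>L \<in> dual_space D N; \<phi> \<in> D; \<psi> \<in> D\<rbrakk> \<Longrightarrow> L (\<lambda>x. \<phi> x - \<psi> x) = L \<phi> - L \<psi>"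
  using dual_add[of L \<phi> "\<lambda>x. (-1) * \<psi> x"] dual_scale[of L \<psi> "-1"] scale_mem[of \<psi> "-1"] by simp

lemma dual_boundE:
  assumes "L \<in> dual_space D N"
  obtains K where "\<And>\<phi>. \<phi> \<in> D \<Longrightarrow> \<bar>L \<phi>\<bar> \<le> K * N \<phi>"
proof -
  from assms have "\<exists>K. \<forall>\<phi>\<in>D. \<bar>L \<phi>\<bar> \<le> K * N \<phi>" by (simp add: dual_space_def)
  then show thesis using that by blast
qed

lemma dual_bdd:
  assumes "L \<in> dual_space D N"
  shows "bdd_above ((\<lambda>\<phi>. \<bar>L \<phi>\<bar>) ` {\<phi> \<in> D. N \<phi> \<le> 1})"
proof -
  obtain K where K: "\<And>\<phi>. \<phi> \<in> D \<Longrightarrow> \<bar>L \<phi>\<bar> \<le> K * N \<phi>" using dual_boundE[OF assms] by blast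
  have "\<bar>L \<phi>\<bar> \<le> \<bar>K\<bar>" if "\<phi> \<in> D" "N \<phi> \<le> 1" for \<phi>
  proof -
    have "\<bar>L \<phi>\<bar> \<le> \<bar>K\<bar> * N \<phi>" using K[OF that(1)] N_nonneg[OF that(1)] mult_right_mono[of K "\<bar>K\<bar>" "N \<phi>"] by linarith
    also have "\<dots> \<le> \<bar>K\<bar> * 1" using that by (intro mult_left_mono) auto
    finally show ?thesis by simp
  qed
  then show ?thesis by (intro bdd_aboveI2) auto
qed

lemma dual_norm_le:
  assumes "\<And>\<phi>. \<phi> \<in> D \<Longrightarrow> N \<phi> \<le> 1 \<Longrightarrow> \<bar>L \<phi>\<bar> \<le> K"
  shows "dual_norm D N L \<le> K"
  unfolding dual_norm_def using zero_mem N_zero by (intro cSUP_least) (auto simp: assms)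

lemma dual_norm_nonneg:
  assumes "L \<in> dual_space D N"
  shows "0 \<le> dual_norm D N L"
proof -
  have "\<bar>L (\<lambda>x. 0)\<bar> \<le> dual_norm D N L"
    unfolding dual_norm_def using zero_mem N_zero by (intro cSUP_upper dual_bdd[OF assms]) auto
  then show ?thesis by linarith
qed

lemma abs_le_dual_norm:
  assumes L: "L \<in> dual_space D N" and \<phi>: "\<phi> \<in> D"
  shows "\<bar>L \<phi>\<bar> \<le> dual_norm D N L * N \<phi>"
proof (cases "N \<phi> = 0")
  \<comment> \<open>Such a function cannot be rescaled to the unit sphere; boundedness of the
    functional forces its value to be 0.\<close>
  case True
  obtain K where "\<And>\<phi>. \<phi> \<in> D \<Longrightarrow> \<bar>L \<phi>\<bar> \<le> K * N \<phi>" using dual_boundE[OF L] by blast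
  from this[OF \<phi>] True show ?thesis by simp
next
  case False
  then have pos: "N \<phi> > 0" using N_nonneg[OF \<phi>] by simp
  let ?\<psi> = "\<lambda>x. (1 / N \<phi>) * \<phi> x"
  have "?\<psi> \<in> D" "N ?\<psi> \<le> 1" 
    using pos N_scale[OF \<phi>, of "1 / N \<phi>"] scale_mem[OF \<phi>, of "1 / N \<phi>"] by simp_all
  then have "\<bar>L ?\<psi>\<bar> \<le> dual_norm D N L"
    unfolding dual_norm_def by (intro cSUP_upper dual_bdd[OF L]) auto
  then show ?thesis using pos by (simp add: dual_scale[OF L \<phi>, of "1 / N \<phi>", simplified] abs_mult pos_divide_le_eq)
qed

lemma dual_norm_almost_attained:
  assumes L: "L \<in> dual_space D N" and c: "c < dual_norm D N L"
  obtains \<phi> where "\<phi> \<in> D" "N \<phi> \<le> 1" "c < \<bar>L \<phi>\<bar>"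
proof -
  have "\<exists>\<phi>\<in>{\<phi> \<in> D. N \<phi> \<le> 1}. c < \<bar>L \<phi>\<bar>"
    using c zero_mem N_zero unfolding dual_norm_def
    by (subst (asm) less_cSUP_iff) (auto intro: dual_bdd[OF L])
  then show thesis using that by blast
qed

end

text \<open>Completeness as convergence of absolutely convergent series, together with the tail
  estimate that the gliding hump needs.\<close>

locale complete_seminormed_functions = seminormed_functions D N
  for D :: "('a::topological_space \<Rightarrow> real) set" and N +
  assumes complete: "\<lbrakk>\<And>n. f n \<in> D; summable (\<lambda>n. N (f n))\<rbrakk> \<Longrightarrow>
    \<exists>F\<in>D. \<forall>n. N (\<lambda>x. F x - (\<Sum>i<n. f i x)) \<le> (\<Sum>i. N (f (i + n)))"
begin

text \<open>Sokal's proof of the uniform boundedness principle by the gliding hump method, which avoids the Baire category theorem.\<close>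

lemma hump_step:
  assumes L: "L \<in> dual_space D N" and \<phi>: "\<phi> \<in> D" and r: "r > 0"
  obtains \<psi> where "\<psi> \<in> D" "N \<psi> \<le> r" "(2/3) * r * dual_norm D N L \<le> \<bar>L (\<lambda>x. \<phi> x + \<psi> x)\<bar>"
proof (cases "dual_norm D N L > 0")
  case True
  \<comment> \<open>The supremum need not be attained; any factor below 1 would produce a near
    maximiser, and 2/3 is what the bookkeeping below needs.\<close>
  then have "(2/3) * dual_norm D N L < dual_norm D N L" by simp
  from dual_norm_almost_attained[OF L this] obtain \<eta>
    where \<eta>: "\<eta> \<in> D" "N \<eta> \<le> 1" "(2/3) * dual_norm D N L < \<bar>L \<eta>\<bar>" by blast
  define \<psi> where "\<psi> s x = (s * r) * \<eta> x" for s x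
  have mem: "\<psi> s \<in> D" for s unfolding \<psi>_def by (intro scale_mem \<eta>)
  have N: "N (\<psi> s) \<le> r" if "\<bar>s\<bar> = 1" for s
    unfolding \<psi>_def N_scale[OF \<eta>(1)] using that r \<eta>(2) mult_left_mono[of "N \<eta>" 1 r] by (simp add: abs_mult)
  have Lv: "L (\<lambda>x. \<phi> x + \<psi> s x) = L \<phi> + s * r * L \<eta>" for s

  proof -
    have "L (\<psi> s) = s * r * L \<eta>" unfolding \<psi>_def by (rule dual_scale[OF L \<eta>(1)])
    then show ?thesis by (simp add: dual_add[OF L \<phi> mem])
  qed
  have "r * ((2/3) * dual_norm D N L) \<le> r * \<bar>L \<eta>\<bar>" using \<eta>(3) r by (intro mult_left_mono) auto
  then have big: "(2/3) * r * dual_norm D N L \<le> \<bar>r * L \<eta>\<bar>" using r by (simp add: abs_mult mult.commute)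
  \<comment> \<open>Of the two values \<open>L \<phi> + r * L \<eta>\<close> and
    \<open>L \<phi> - r * L \<eta>\<close>, one is at least as large in modulus as half their
    difference.\<close>
  have "\<bar>r * L \<eta>\<bar> \<le> \<bar>L (\<lambda>x. \<phi> x + \<psi> 1 x)\<bar> \<or> \<bar>r * L \<eta>\<bar> \<le> \<bar>L (\<lambda>x. \<phi> x + \<psi> (-1) x)\<bar>"
    unfolding Lv by (simp, linarith)
  then show thesis
    using that[OF mem[of 1]] that[OF mem[of "-1"]] N[of 1] N[of "-1"] big by fastforce
next
  case False
  then have "dual_norm D N L = 0" using dual_norm_nonneg[OF L] by simp
  then show thesis using that[OF zero_mem] r N_zero by simp
qed

text \<open>Why 4 and 3: at stage n the functional has norm above \<open>4 ^ n\<close> and the hump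
  has size at most \<open>(1/3) ^ n\<close>. The functional sends the partial sum including this
  hump to modulus at least 2/3 of the norm times \<open>(1/3) ^ n\<close>, while all later humps
  together have size at most half of \<open>(1/3) ^ n\<close>. The margin 2/3 - 1/2 = 1/6 leaves
  \<open>(1/6) * (4/3) ^ n\<close>, which is unbounded.\<close>

theorem uniform_boundedness:
  assumes L: "\<And>t. t \<in> T \<Longrightarrow> L t \<in> dual_space D N"
    and pointwise: "\<And>\<phi>. \<phi> \<in> D \<Longrightarrow> bdd_above ((\<lambda>t. \<bar>L t \<phi>\<bar>) ` T)"
  shows "bdd_above ((\<lambda>t. dual_norm D N (L t)) ` T)"
proof (rule ccontr)
  assume "\<not> ?thesis"
  then have "\<exists>t\<in>T. 4 ^ n < dual_norm D N (L t)" for n :: nat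
    unfolding bdd_above_def by (auto simp: not_le)
  then obtain t where t: "\<And>n. t n \<in> T" "\<And>n. 4 ^ n < dual_norm D N (L (t n))" by metis
  let ?r = "\<lambda>n. (1/3) ^ n :: real"
  let ?P = "\<lambda>n \<phi> \<psi>. \<psi> \<in> D \<and> N \<psi> \<le> ?r n \<and>
      (2/3) * ?r n * dual_norm D N (L (t n)) \<le> \<bar>L (t n) (\<lambda>x. \<phi> x + \<psi> x)\<bar>"
  have "\<exists>\<psi>. ?P n \<phi> \<psi>" if "\<phi> \<in> D" for n \<phi>
    using hump_step[OF L[OF t(1)[of n]] that, of "?r n"] by (metis zero_less_power zero_less_divide_1_iff zero_less_numeral)
  moreover define G where "G n \<phi> = (SOME \<psi>. ?P n \<phi> \<psi>)" for n \<phi>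
  ultimately have G: "?P n \<phi> (G n \<phi>)" if "\<phi> \<in> D" for n \<phi>
    using that unfolding G_def by (intro someI_ex[of "?P n \<phi>"])
  define S where "S = rec_nat (\<lambda>x. 0) (\<lambda>n \<phi>. \<lambda>x. \<phi> x + G n \<phi> x)"
  have S0: "S 0 = (\<lambda>x. 0)" and S1: "S (Suc n) = (\<lambda>x. S n x + G n (S n) x)" for n
    by (simp_all add: S_def)
  have SD: "S n \<in> D" for n
    by (induction n) (auto simp: S0 S1 zero_mem intro!: add_mem G[THEN conjunct1])
  let ?f = "\<lambda>n. G n (S n)"
  have f: "?f n \<in> D" "N (?f n) \<le> ?r n"
    "(2/3) * ?r n * dual_norm D N (L (t n)) \<le> \<bar>L (t n) (S (Suc n))\<bar>" for n
    using G[OF SD[of n], of n] by (simp_all add: S1)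
  have geo: "summable ?r" by (intro summable_geometric) simp
  have sumN: "summable (\<lambda>n. N (?f n))"
    using f(2) N_nonneg[OF f(1)] by (intro summable_comparison_test'[OF geo, of 0]) auto
  obtain F where F: "F \<in> D" "\<And>n. N (\<lambda>x. F x - (\<Sum>i<n. ?f i x)) \<le> (\<Sum>i. N (?f (i + n)))"
    using complete[OF f(1) sumN] by blast
  have S_sum: "S n = (\<lambda>x. \<Sum>i<n. ?f i x)" for n
    by (induction n) (simp_all add: S0 S1)
  have tail: "N (\<lambda>x. F x - S (Suc n) x) \<le> (1/2) * ?r n" for n
  proof -
    have "(\<Sum>i. N (?f (i + Suc n))) \<le> (\<Sum>i. ?r (i + Suc n))"
      using summable_ignore_initial_segment[OF sumN, of "Suc n"] summable_ignore_initial_segment[OF geo, of "Suc n"]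
      by (intro suminf_le f(2))
    also have "\<dots> = (\<Sum>i. ?r (Suc n) * ?r i)" by (simp add: power_add mult.commute)
    also have "\<dots> = ?r (Suc n) * (\<Sum>i. ?r i)" using geo by (rule suminf_mult)
    also have "(\<Sum>i. ?r i) = 3/2" by (subst suminf_geometric) auto
    finally have "(\<Sum>i. N (?f (i + Suc n))) \<le> (1/2) * ?r n" by simp
    then show ?thesis using F(2)[of "Suc n"] unfolding S_sum[of "Suc n"] by (rule order_trans[rotated])
  qed
  have big: "(1/6) * (4/3) ^ n \<le> \<bar>L (t n) F\<bar>" for n
  proof -
    let ?L = "L (t n)" let ?d = "dual_norm D N ?L"
    have Ln: "?L \<in> dual_space D N" using L t by blast
    have "\<bar>?L F - ?L (S (Suc n))\<bar> \<le> ?d * N (\<lambda>x. F x - S (Suc n) x)"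
      using abs_le_dual_norm[OF Ln diff_mem[OF F(1) SD]] dual_diff[OF Ln F(1) SD] by simp
    also have "\<dots> \<le> ?d * ((1/2) * ?r n)"
      using tail dual_norm_nonneg[OF Ln] by (intro mult_left_mono)
    finally have "\<bar>?L F - ?L (S (Suc n))\<bar> \<le> (1/2) * (?d * ?r n)" by simp
    moreover have "(2/3) * (?d * ?r n) \<le> \<bar>?L (S (Suc n))\<bar>" using f(3)[of n] by (simp add: mult.commute)
    ultimately have "(1/6) * (?d * ?r n) \<le> \<bar>?L F\<bar>"
      using abs_triangle_ineq2_sym[of "?L (S (Suc n))" "?L F"] by linarith
    moreover have "4 ^ n * ?r n \<le> ?d * ?r n" using t(2)[of n] by (intro mult_right_mono) auto
    moreover have "4 ^ n * ?r n = (4/3) ^ n" by (simp add: power_divide)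
    ultimately show ?thesis by linarith
  qed
  obtain M where M: "\<And>s. s \<in> T \<Longrightarrow> \<bar>L s F\<bar> \<le> M"
    using pointwise[OF F(1)] unfolding bdd_above_def by blast
  obtain n where "6 * M < (4/3) ^ n" using real_arch_pow[of "4/3" "6 * M"] by auto
  then show False using big[of n] M[OF t(1)[of n]] by linarith
qed

section \<open>Weak-* differentiable paths are Lipschitz in the dual norm\<close>

lemma weakstar_C1_path_derivative_bounded:
  assumes "weakstar_C1_path D N X \<mu> \<mu>'"
  shows "bdd_above ((\<lambda>t. dual_norm D N (\<mu>' t)) ` {0..1})"
proof (rule uniform_boundedness)
  show "\<mu>' t \<in> dual_space D N" if "t \<in> {0..1}" for t
    using assms that by (simp add: weakstar_C1_path_def)
  show "bdd_above ((\<lambda>t. \<bar>\<mu>' t \<phi>\<bar>) ` {0..1})" if "\<phi> \<in> D" for \<phi>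
  proof -
    \<comment> \<open>The extension of the derivative to the end points enters here: each scalar
      derivative is continuous on a compact interval, hence bounded.\<close>
    have "continuous_on {0..1} (\<lambda>t. \<bar>\<mu>' t \<phi>\<bar>)"
      using assms that by (intro continuous_on_rabs) (simp add: weakstar_C1_path_def)
    then show ?thesis
      by (intro bounded_imp_bdd_above compact_imp_bounded compact_continuous_image compact_Icc)
  qed
qed

text \<open>The mean value inequality is applied to one test function at a time. The resulting
  constant is linear in \<open>N \<phi>\<close>, so the estimates combine into one for the dual
  norm.\<close>

lemma weakstar_C1_path_lipschitz:
  assumes path: "weakstar_C1_path D N X \<mu> \<mu>'"
  obtains K where "K \<ge> 0" "\<And>s t \<phi>. \<lbrakk>s \<in> {0<..<1}; t \<in> {0<..<1}; \<phi> \<in> D\<rbrakk> \<Longrightarrow>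
    \<bar>pairing (\<mu> s) \<phi> - pairing (\<mu> t) \<phi>\<bar> \<le> K * \<bar>s - t\<bar> * N \<phi>"
proof -
  obtain K where K: "\<And>t. t \<in> {0..1} \<Longrightarrow> dual_norm D N (\<mu>' t) \<le> K"
    using weakstar_C1_path_derivative_bounded[OF path] unfolding bdd_above_def by blast
  have dual: "\<mu>' t \<in> dual_space D N" if "t \<in> {0..1}" for t
    using path that by (simp add: weakstar_C1_path_def)
  have "\<bar>pairing (\<mu> s) \<phi> - pairing (\<mu> t) \<phi>\<bar> \<le> K * \<bar>s - t\<bar> * N \<phi>"
    if st: "s \<in> {0<..<1}" "t \<in> {0<..<1}" and \<phi>: "\<phi> \<in> D" for s t \<phi>
  proof -
    have "norm (pairing (\<mu> s) \<phi> - pairing (\<mu> t) \<phi>) \<le> (K * N \<phi>) * norm (s - t)"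
    proof (rule field_differentiable_bound[where S = "{0<..<1::real}"])
      fix z :: real assume z: "z \<in> {0<..<1}"
      show "((\<lambda>s. pairing (\<mu> s) \<phi>) has_field_derivative \<mu>' z \<phi>) (at z within {0<..<1})"
        using path z \<phi> by (auto simp: weakstar_C1_path_def intro: has_field_derivative_at_within)
      have "\<bar>\<mu>' z \<phi>\<bar> \<le> dual_norm D N (\<mu>' z) * N \<phi>" using dual z by (intro abs_le_dual_norm \<phi>) auto
      also have "\<dots> \<le> K * N \<phi>" using K[of z] z N_nonneg[OF \<phi>] by (intro mult_right_mono) auto
      finally show "norm (\<mu>' z \<phi>) \<le> K * N \<phi>" by simp
    qed (use st in auto)
    then show ?thesis by (simp add: mult.assoc mult.commute[of "N \<phi>"])
  qed
  moreover have "K \<ge> 0" using order_trans[OF dual_norm_nonneg[OF dual] K, of 0] by simp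
  ultimately show thesis by (rule that[rotated])
qed

lemma weakstar_C1_path_AC2_on:
  assumes path: "weakstar_C1_path D N X \<mu> \<mu>'"
    and dual: "\<And>t. t \<in> {0<..<1} \<Longrightarrow> pairing (\<mu> t) \<in> dual_space D N"
  shows "AC2_on (dual_space D N) (dual_dist D N) 0 1 (\<lambda>t. pairing (\<mu> t))"
proof -
  obtain K where K: "K \<ge> 0" "\<And>s t \<phi>. \<lbrakk>s \<in> {0<..<1}; t \<in> {0<..<1}; \<phi> \<in> D\<rbrakk> \<Longrightarrow>
    \<bar>pairing (\<mu> s) \<phi> - pairing (\<mu> t) \<phi>\<bar> \<le> K * \<bar>s - t\<bar> * N \<phi>"
    using weakstar_C1_path_lipschitz[OF path] by blast
  have "L2_on 0 1 (\<lambda>_. K)"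
    by (simp add: L2_on_def set_borel_measurable_def set_integrable_def)
  moreover have "dual_dist D N (pairing (\<mu> s)) (pairing (\<mu> t)) \<le> (LBINT \<tau>:{s..t}. K)"
    if st: "0 < s" "s \<le> t" "t < 1" for s t
  proof -
    have "dual_dist D N (pairing (\<mu> s)) (pairing (\<mu> t)) \<le> K * \<bar>s - t\<bar>"
      unfolding dual_dist_def
    proof (rule dual_norm_le)
      fix \<phi> assume \<phi>: "\<phi> \<in> D" "N \<phi> \<le> 1"
      have "\<bar>pairing (\<mu> s) \<phi> - pairing (\<mu> t) \<phi>\<bar> \<le> K * \<bar>s - t\<bar> * N \<phi>"
        using st by (intro K \<phi>) auto
      also have "\<dots> \<le> K * \<bar>s - t\<bar> * 1" using K(1) \<phi>(2) by (intro mult_left_mono) auto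
      finally show "\<bar>pairing (\<mu> s) \<phi> - pairing (\<mu> t) \<phi>\<bar> \<le> K * \<bar>s - t\<bar>" by simp
    qed
    also have "\<dots> = (LBINT \<tau>:{s..t}. K)" using st by (simp add: set_integral_const mult.commute)
    finally show ?thesis .
  qed
  ultimately show ?thesis unfolding AC2_on_def using dual by blast
qed

end

section \<open>The self-potential as an equation in the Hilbert space\<close>

lemma radon_prob_facts:
  assumes "M \<in> radon_prob X"
  shows "sets M = sets (restrict_space borel X)" "space M = X" "finite_measure M" "measure M X = 1" "X \<noteq> {}"
proof -
  show s: "sets M = sets (restrict_space borel X)" using assms by (simp add: radon_prob_def)
  show sp: "space M = X" using sets_eq_imp_space_eq[OF s] by (simp add: space_restrict_space)
  have 1: "emeasure M X = 1" using assms sp by (simp add: radon_prob_def)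
  then show "finite_measure M" by (intro finite_measureI) (simp add: sp)
  show "measure M X = 1" using 1 by (simp add: measure_def)
  show "X \<noteq> {}" using 1 by auto
qed

lemma integrable_continuous_radon_prob:
  fixes f :: "'a::topological_space \<Rightarrow> 'b::{banach, second_countable_topology}"
  assumes M: "M \<in> radon_prob X" and X: "compact X" and f: "continuous_on X f"
  shows "integrable M f"
proof -
  interpret finite_measure M by (rule radon_prob_facts[OF M])
  have "bounded (f ` X)" by (intro compact_imp_bounded compact_continuous_image f X)
  then obtain C where C: "\<And>x. x \<in> X \<Longrightarrow> norm (f x) \<le> C" unfolding bounded_iff by blast
  have "f \<in> borel_measurable M"
    using borel_measurable_continuous_on_restrict[OF f]
    by (simp add: measurable_cong_sets[OF radon_prob_facts(1)[OF M] refl])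
  then show ?thesis using C by (intro integrable_const_bound[of _ C] AE_I2) (simp_all add: radon_prob_facts(2)[OF M])
qed

lemma integral_eq_on_radon_prob:
  fixes f :: "'a::topological_space \<Rightarrow> 'b::{banach, second_countable_topology}"
  assumes M: "M \<in> radon_prob X" and eq: "\<And>x. x \<in> X \<Longrightarrow> f x = g x"
  shows "integral\<^sup>L M f = integral\<^sup>L M g"
  by (intro Bochner_Integration.integral_cong) (simp_all add: eq radon_prob_facts(2)[OF M])

lemma integral_mono_radon_prob:
  fixes f :: "'a::topological_space \<Rightarrow> real"
  assumes M: "M \<in> radon_prob X" and X: "compact X" and f: "continuous_on X f" and g: "continuous_on X g"
    and le: "\<And>x. x \<in> X \<Longrightarrow> f x \<le> g x"
  shows "integral\<^sup>L M f \<le> integral\<^sup>L M g"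
  by (intro integral_mono integrable_continuous_radon_prob[OF M X] f g)
    (simp add: le radon_prob_facts(2)[OF M])

text \<open>Zarantonello's theorem: for small \<open>\<tau>\<close> the map \<open>b - \<tau> G b\<close> is a contraction.\<close>

lemma strongly_monotone_lipschitz_zero:
  fixes G :: "'h::{real_inner, banach} \<Rightarrow> 'h"
  assumes mono: "\<And>x y. (norm (x - y))\<^sup>2 \<le> inner (x - y) (G x - G y)"
    and lip: "\<And>x y. norm (G x - G y) \<le> L * norm (x - y)" and L: "L \<ge> 1"
  obtains x where "G x = 0"
proof -
  \<comment> \<open>This choice minimises the contraction bound
    \<open>1 - 2 * \<tau> + \<tau>^2 * L^2\<close>, with minimum \<open>1 - \<tau>\<close>.\<close>
  define \<tau> where "\<tau> = 1 / L\<^sup>2"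
  have L2: "L\<^sup>2 \<ge> 1" using L by (simp add: one_le_power)
  have \<tau>: "0 < \<tau>" "\<tau> \<le> 1" "\<tau> * L\<^sup>2 = 1" using L2 L by (simp_all add: \<tau>_def)
  define F where "F x = x - \<tau> *\<^sub>R G x" for x
  have "dist (F x) (F y) \<le> sqrt (1 - \<tau>) * dist x y" for x y
  proof (rule power2_le_imp_le)
    let ?d = "x - y" and ?g = "G x - G y"
    have *: "(norm (p - \<tau> *\<^sub>R q))\<^sup>2 = (norm p)\<^sup>2 - 2 * \<tau> * inner p q + \<tau>\<^sup>2 * (norm q)\<^sup>2" for p q :: 'h
      unfolding power2_norm_eq_inner
      by (simp add: inner_diff_left inner_diff_right inner_commute power2_eq_square algebra_simps)
    have "F x - F y = ?d - \<tau> *\<^sub>R ?g" by (simp add: F_def algebra_simps)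
    then have "(dist (F x) (F y))\<^sup>2 = (norm ?d)\<^sup>2 - 2 * \<tau> * inner ?d ?g + \<tau>\<^sup>2 * (norm ?g)\<^sup>2"
      by (simp only: dist_norm *)
    also have "\<dots> \<le> (norm ?d)\<^sup>2 - 2 * \<tau> * (norm ?d)\<^sup>2 + \<tau>\<^sup>2 * (L * norm ?d)\<^sup>2"
      using \<tau> mono[of x y] lip[of x y]
      by (intro add_mono diff_mono mult_left_mono power_mono) auto
    also have "\<tau>\<^sup>2 * (L * norm ?d)\<^sup>2 = \<tau> * (\<tau> * L\<^sup>2) * (norm ?d)\<^sup>2"
      by (simp add: power2_eq_square algebra_simps)
    also have "(norm ?d)\<^sup>2 - 2 * \<tau> * (norm ?d)\<^sup>2 + \<tau> * (\<tau> * L\<^sup>2) * (norm ?d)\<^sup>2 = (1 - \<tau>) * (norm ?d)\<^sup>2"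
      unfolding \<tau>(3) by (simp add: algebra_simps)
    also have "\<dots> = (sqrt (1 - \<tau>) * dist x y)\<^sup>2"
      using \<tau> by (simp add: power_mult_distrib dist_norm)
    finally show "(dist (F x) (F y))\<^sup>2 \<le> (sqrt (1 - \<tau>) * dist x y)\<^sup>2" .
  qed (use \<tau> in simp)
  then have "\<exists>!x. F x = x"
    using \<tau> by (intro banach_fix_type[of "sqrt (1 - \<tau>)"]) auto
  then obtain x where "F x = x" by blast
  then have "G x = 0" using \<tau>(1) by (simp add: F_def)
  then show thesis by (rule that)
qed

text \<open>\<open>K x\<close> is the kernel section at \<open>x\<close> as an element of the
  Hilbert space, and \<open>inner h (K x)\<close> is the value at \<open>x\<close> of the function
  that \<open>h\<close> represents.\<close>

locale gibbs_feature_map =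
  fixes \<epsilon> :: real and X :: "'a::topological_space set" and c :: "'a \<Rightarrow> 'a \<Rightarrow> real"
    and K :: "'a \<Rightarrow> 'h::{real_inner, banach, second_countable_topology}" and \<kappa> :: real
  assumes eps: "\<epsilon> > 0"
    and compact_X: "compact X"
    and continuous_K: "continuous_on X K"
    and inner_K: "\<lbrakk>x \<in> X; y \<in> X\<rbrakk> \<Longrightarrow> inner (K x) (K y) = exp (- c x y / \<epsilon>)"
    and kappa_pos: "\<kappa> > 0"
    and kappa_le: "\<lbrakk>x \<in> X; y \<in> X\<rbrakk> \<Longrightarrow> \<kappa> \<le> exp (- c x y / \<epsilon>)"
    and c_nonneg: "\<lbrakk>x \<in> X; y \<in> X\<rbrakk> \<Longrightarrow> 0 \<le> c x y"
begin

lemma norm_K_le: "x \<in> X \<Longrightarrow> norm (K x) \<le> 1"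
  using c_nonneg[of x x] eps by (simp add: norm_eq_sqrt_inner inner_K real_sqrt_le_1_iff)

lemma abs_inner_K_le: "x \<in> X \<Longrightarrow> \<bar>inner h (K x)\<bar> \<le> norm h"
  using Cauchy_Schwarz_ineq2[of h "K x"] mult_left_le[OF norm_K_le[of x], of "norm h"] by simp

text \<open>The element \<open>b\<close> stands for the function \<open>B(M)\<close>.\<close>

definition gibbs_solution :: "'a measure \<Rightarrow> 'h \<Rightarrow> bool" where
  "gibbs_solution M b \<longleftrightarrow> (\<forall>x\<in>X. 0 < inner b (K x)) \<and> b = (\<integral>x. (1 / inner b (K x)) *\<^sub>R K x \<partial>M)"

text \<open>The equation in weak form. It is tested below with \<open>h = b\<close>, with
  \<open>h = K y\<close> and with the difference of two solutions.\<close>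

lemma gibbs_solution_inner:
  assumes M: "M \<in> radon_prob X" and b: "gibbs_solution M b"
  shows "inner h b = (\<integral>x. inner h (K x) / inner b (K x) \<partial>M)"
    "continuous_on X (\<lambda>x. inner h (K x) / inner b (K x))"
proof -
  have pos: "\<And>x. x \<in> X \<Longrightarrow> inner b (K x) \<noteq> 0" using b by (force simp: gibbs_solution_def)
  have "integrable M (\<lambda>x. (1 / inner b (K x)) *\<^sub>R K x)"
    by (rule integrable_continuous_radon_prob[OF M compact_X]) (intro continuous_intros continuous_K, use pos in auto)
  then have "inner h (\<integral>x. (1 / inner b (K x)) *\<^sub>R K x \<partial>M) = (\<integral>x. inner h ((1 / inner b (K x)) *\<^sub>R K x) \<partial>M)"
    by (intro integral_inner_right[symmetric])
  then show "inner h b = (\<integral>x. inner h (K x) / inner b (K x) \<partial>M)"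
    using b by (simp add: gibbs_solution_def)
  show "continuous_on X (\<lambda>x. inner h (K x) / inner b (K x))"
    by (intro continuous_intros continuous_K) (use pos in auto)
qed

text \<open>Testing with \<open>h = b\<close> makes the integrand equal to 1, whatever the
  measure.\<close>

lemma gibbs_solution_norm:
  assumes M: "M \<in> radon_prob X" and b: "gibbs_solution M b"
  shows "norm b = 1"
proof -
  have [simp]: "measure M (space M) = 1" using radon_prob_facts(2,4)[OF M] by simp
  have "inner b b = (\<integral>x. 1 \<partial>M)"
    unfolding gibbs_solution_inner(1)[OF M b] using b
    by (intro integral_eq_on_radon_prob[OF M]) (force simp: gibbs_solution_def)
  then show ?thesis by (simp add: norm_eq_sqrt_inner)
qed

text \<open>Testing with \<open>h = K y\<close>: the numerator is a kernel value, at least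
  \<open>\<kappa>\<close>, and the denominator is at most \<open>norm b * norm (K x)\<close>, hence
  at most 1.\<close>

lemma gibbs_solution_ge:
  assumes M: "M \<in> radon_prob X" and b: "gibbs_solution M b" and y: "y \<in> X"
  shows "\<kappa> \<le> inner b (K y)"
proof -
  have [simp]: "measure M (space M) = 1" using radon_prob_facts(2,4)[OF M] by simp
  have "\<kappa> = (\<integral>x. \<kappa> \<partial>M)" by simp
  also have "\<dots> \<le> (\<integral>x. inner (K y) (K x) / inner b (K x) \<partial>M)"
  proof (rule integral_mono_radon_prob[OF M compact_X _ gibbs_solution_inner(2)[OF M b]])
    fix x assume x: "x \<in> X"
    have pos: "0 < inner b (K x)" using b x by (simp add: gibbs_solution_def)
    have "inner b (K x) \<le> 1" using abs_inner_K_le[OF x, of b] gibbs_solution_norm[OF M b] by simp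
    then have "\<kappa> * inner b (K x) \<le> \<kappa> * 1" using kappa_pos by (intro mult_left_mono) auto
    also have "\<kappa> * 1 \<le> inner (K y) (K x)" using kappa_le[OF y x] inner_K[OF y x] by simp
    finally show "\<kappa> \<le> inner (K y) (K x) / inner b (K x)" using pos by (simp add: pos_le_divide_eq)
  qed simp
  also have "\<dots> = inner (K y) b" by (rule gibbs_solution_inner(1)[OF M b, symmetric])
  finally show ?thesis by (simp add: inner_commute)
qed

text \<open>Both weak forms are tested with \<open>b1 - b2\<close>. This difference is positive
  exactly where \<open>b1\<close> exceeds \<open>b2\<close>, so replacing the denominator
  \<open>b1\<close> by \<open>b2\<close> can only increase the first integrand. Afterwards the same
  function is integrated against both measures.\<close>

lemma gibbs_solution_stability:
  assumes M1: "M1 \<in> radon_prob X" and b1: "gibbs_solution M1 b1"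
    and M2: "M2 \<in> radon_prob X" and b2: "gibbs_solution M2 b2"
  defines "g \<equiv> \<lambda>x. inner (b1 - b2) (K x) / inner b2 (K x)"
  shows "(norm (b1 - b2))\<^sup>2 \<le> pairing M1 g - pairing M2 g"
proof -
  let ?d = "b1 - b2"
  have i1: "inner ?d b1 = (\<integral>x. inner ?d (K x) / inner b1 (K x) \<partial>M1)" by (rule gibbs_solution_inner[OF M1 b1])
  have i2: "inner ?d b2 = pairing M2 g" unfolding pairing_def g_def by (rule gibbs_solution_inner[OF M2 b2])
  have "(\<integral>x. inner ?d (K x) / inner b1 (K x) \<partial>M1) \<le> pairing M1 g"
    unfolding pairing_def g_def
  proof (rule integral_mono_radon_prob[OF M1 compact_X gibbs_solution_inner(2)[OF M1 b1] gibbs_solution_inner(2)[OF M2 b2]])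
    fix x assume x: "x \<in> X"
    have p: "0 < inner b1 (K x)" "0 < inner b2 (K x)" using b1 b2 x by (simp_all add: gibbs_solution_def)
    show "inner ?d (K x) / inner b1 (K x) \<le> inner ?d (K x) / inner b2 (K x)"
    proof (cases "inner b1 (K x) \<le> inner b2 (K x)")
      case True
      then show ?thesis using p by (intro divide_left_mono_neg) (auto simp: inner_diff_left)
    next
      case False
      then show ?thesis using p by (intro divide_left_mono) (auto simp: inner_diff_left)
    qed
  qed
  then show ?thesis using i1 i2 by (simp add: power2_norm_eq_inner inner_diff_right)
qed

lemma gibbs_solution_unique:
  assumes "M \<in> radon_prob X" "gibbs_solution M b1" "gibbs_solution M b2"
  shows "b1 = b2"
  using gibbs_solution_stability[OF assms(1,2) assms(1,3)] by simp

text \<open>The reciprocal is singular at 0, so the denominator is first cut off below at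
  \<open>\<kappa>\<close>. The modified operator is Lipschitz on the whole space and still strongly
  monotone, because \<open>w b z\<close> decreases as \<open>inner b (K z)\<close> grows. The a
  priori bounds then show that the cut-off is inactive at its zero.\<close>

lemma gibbs_solution_exists:
  assumes M: "M \<in> radon_prob X"
  obtains b where "gibbs_solution M b"
proof -
  have [simp]: "measure M (space M) = 1" using radon_prob_facts(2,4)[OF M] by simp
  define w where "w b x = 1 / max (inner b (K x)) \<kappa>" for b x
  have w_pos: "0 < w b x" "w b x \<le> 1 / \<kappa>" for b x
    using kappa_pos by (auto simp: w_def intro!: divide_left_mono)
  have w_cont: "continuous_on X (w b)" for b
    unfolding w_def using kappa_pos by (intro continuous_intros continuous_K) (auto simp: max_def)
  have w_mono: "(w x z - w y z) * inner (x - y) (K z) \<le> 0" for x y z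
  proof (cases "inner x (K z) \<le> inner y (K z)")
    case True
    then have "w y z \<le> w x z" unfolding w_def using kappa_pos by (intro divide_left_mono) auto
    then show ?thesis using True by (intro mult_nonneg_nonpos) (auto simp: inner_diff_left)
  next
    case False
    then have "w x z \<le> w y z" unfolding w_def using kappa_pos by (intro divide_left_mono) auto
    then show ?thesis using False by (intro mult_nonpos_nonneg) (auto simp: inner_diff_left)
  qed
  have w_lip: "\<bar>w x z - w y z\<bar> \<le> norm (x - y) / \<kappa>\<^sup>2" if z: "z \<in> X" for x y z
  proof -
    let ?p = "max (inner x (K z)) \<kappa>" and ?q = "max (inner y (K z)) \<kappa>"
    have pq: "\<kappa> \<le> ?p" "\<kappa> \<le> ?q" "0 < ?p" "0 < ?q" using kappa_pos by auto
    have "w x z - w y z = (?q - ?p) / (?p * ?q)" using pq unfolding w_def by (subst diff_frac_eq) auto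
    then have "\<bar>w x z - w y z\<bar> = \<bar>?q - ?p\<bar> / (?p * ?q)" using pq by (simp add: abs_divide abs_mult)
    also have "\<dots> \<le> \<bar>?q - ?p\<bar> / (\<kappa> * \<kappa>)"
      using pq kappa_pos by (intro divide_left_mono mult_mono mult_pos_pos) auto
    also have "\<dots> \<le> norm (x - y) / (\<kappa> * \<kappa>)"
    proof (rule divide_right_mono)
      have "\<bar>?q - ?p\<bar> \<le> \<bar>inner (x - y) (K z)\<bar>" unfolding inner_diff_left by (auto simp: max_def)
      then show "\<bar>?q - ?p\<bar> \<le> norm (x - y)" using abs_inner_K_le[OF z, of "x - y"] by linarith
    qed simp
    finally show ?thesis by (simp add: power2_eq_square)
  qed
  have K_int: "integrable M (\<lambda>z. w b z *\<^sub>R K z)" for b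
    by (rule integrable_continuous_radon_prob[OF M compact_X]) (intro continuous_intros w_cont continuous_K)
  define \<Phi> where "\<Phi> b = (\<integral>z. w b z *\<^sub>R K z \<partial>M)" for b
  have inner_\<Phi>: "inner h (\<Phi> b) = (\<integral>z. w b z * inner h (K z) \<partial>M)" for h b
    unfolding \<Phi>_def using K_int by (subst integral_inner_right[symmetric]) auto
  define G where "G b = b - \<Phi> b" for b
  have mono: "(norm (x - y))\<^sup>2 \<le> inner (x - y) (G x - G y)" for x y
  proof -
    have "inner (x - y) (\<Phi> x - \<Phi> y) = (\<integral>z. w x z * inner (x - y) (K z) \<partial>M) - (\<integral>z. w y z * inner (x - y) (K z) \<partial>M)"
      unfolding inner_diff_right[of _ "\<Phi> x"] inner_\<Phi> ..
    also have "\<dots> \<le> 0"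
      using w_mono[of x _ y] unfolding left_diff_distrib diff_le_0_iff_le
      by (intro integral_mono_radon_prob[OF M compact_X] continuous_intros w_cont continuous_K) auto
    finally show ?thesis by (simp add: G_def power2_norm_eq_inner inner_diff_right)
  qed
  have lip\<Phi>: "norm (\<Phi> x - \<Phi> y) \<le> norm (x - y) / \<kappa>\<^sup>2" for x y
  proof -
    have "\<Phi> x - \<Phi> y = (\<integral>z. (w x z - w y z) *\<^sub>R K z \<partial>M)"
      unfolding \<Phi>_def using K_int by (simp add: scaleR_diff_left)
    also have "norm \<dots> \<le> (\<integral>z. norm ((w x z - w y z) *\<^sub>R K z) \<partial>M)" by (rule integral_norm_bound)
    also have "\<dots> \<le> (\<integral>z. norm (x - y) / \<kappa>\<^sup>2 \<partial>M)"
    proof (rule integral_mono_radon_prob[OF M compact_X])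
      fix z assume z: "z \<in> X"
      have "\<bar>w x z - w y z\<bar> * norm (K z) \<le> (norm (x - y) / \<kappa>\<^sup>2) * 1"
        using w_lip[OF z] norm_K_le[OF z] by (intro mult_mono) auto
      then show "norm ((w x z - w y z) *\<^sub>R K z) \<le> norm (x - y) / \<kappa>\<^sup>2" by simp
    qed (intro continuous_intros w_cont continuous_K)+
    also have "\<dots> = norm (x - y) / \<kappa>\<^sup>2" by simp
    finally show ?thesis .
  qed
  have lip: "norm (G x - G y) \<le> (1 + 1 / \<kappa>\<^sup>2) * norm (x - y)" for x y
  proof -
    have "G x - G y = (x - y) - (\<Phi> x - \<Phi> y)" by (simp add: G_def)
    then have "norm (G x - G y) \<le> norm (x - y) + norm (\<Phi> x - \<Phi> y)" by (simp add: norm_triangle_ineq4)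
    then show ?thesis using lip\<Phi>[of x y] by (simp add: distrib_right)
  qed
  obtain b where "G b = 0" using strongly_monotone_lipschitz_zero[OF mono lip] by auto
  then have b: "b = \<Phi> b" by (simp add: G_def)
  \<comment> \<open>The cut-off leaves only the inequality
    \<open>w b z * inner b (K z) \<le> 1\<close>, hence \<open>norm b \<le> 1\<close> instead of
    equality; this is enough for the lower bound.\<close>
  have "inner b b = (\<integral>z. w b z * inner b (K z) \<partial>M)" using inner_\<Phi>[of b b] b by simp
  also have "\<dots> \<le> (\<integral>z. 1 \<partial>M)"
  proof (rule integral_mono_radon_prob[OF M compact_X])
    fix z
    show "w b z * inner b (K z) \<le> 1" using kappa_pos by (simp add: w_def pos_divide_le_eq less_max_iff_disj)
  qed (intro continuous_intros w_cont continuous_K)+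
  finally have "inner b b \<le> 1" by simp
  then have norm_b: "norm b \<le> 1" by (simp add: norm_eq_sqrt_inner)
  \<comment> \<open>With \<open>\<kappa> \<le> 1\<close> the cut-off denominator stays at most 1
    even where the cut-off is active.\<close>
  have \<kappa>1: "\<kappa> \<le> 1"
  proof -
    obtain x where "x \<in> X" using radon_prob_facts(5)[OF M] by blast
    then have "\<kappa> \<le> exp (- c x x / \<epsilon>)" "exp (- c x x / \<epsilon>) \<le> 1"
      using kappa_le c_nonneg[of x x] eps by simp_all
    then show ?thesis by linarith
  qed
  have ge: "\<kappa> \<le> inner b (K y)" if y: "y \<in> X" for y
  proof -
    have "\<kappa> = (\<integral>x. \<kappa> \<partial>M)" by simp
    also have "\<dots> \<le> (\<integral>z. w b z * inner (K y) (K z) \<partial>M)"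
    proof (rule integral_mono_radon_prob[OF M compact_X])
      fix z assume z: "z \<in> X"
      have "max (inner b (K z)) \<kappa> \<le> 1" using abs_inner_K_le[OF z, of b] norm_b \<kappa>1 by auto
      then have "1 \<le> w b z" using kappa_pos by (simp add: w_def less_max_iff_disj)
      then have "1 * \<kappa> \<le> w b z * inner (K y) (K z)"
        using kappa_le[OF y z] inner_K[OF y z] kappa_pos by (intro mult_mono) auto
      then show "\<kappa> \<le> w b z * inner (K y) (K z)" by simp
    qed (intro continuous_intros w_cont continuous_K)+
    also have "\<dots> = inner (K y) b" using inner_\<Phi>[of "K y" b] b by simp
    finally show ?thesis by (simp add: inner_commute)
  qed
  have "\<Phi> b = (\<integral>x. (1 / inner b (K x)) *\<^sub>R K x \<partial>M)"
    unfolding \<Phi>_def w_def by (intro integral_eq_on_radon_prob[OF M]) (simp add: ge max_absorb1)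
  then have "gibbs_solution M b"
    unfolding gibbs_solution_def using b ge kappa_pos by (metis order_less_le_trans)
  then show thesis by (rule that)
qed

text \<open>The defining equation of the potential, multiplied by
  \<open>exp (- f y / \<epsilon>)\<close>, is the equation for
  \<open>b = exp (- f / \<epsilon>)\<close> evaluated at \<open>y\<close>. The definite description
  needs both directions: the formula satisfies the equation, and every competitor comes from a
  solution in the Hilbert space.\<close>

lemma self_potential_gibbs_solution:
  assumes M: "M \<in> radon_prob X" and b: "gibbs_solution M b"
  shows "self_potential \<epsilon> X c M = restrict (\<lambda>x. - \<epsilon> * ln (inner b (K x))) X"
  unfolding self_potential_def
proof (rule the_equality)
  have pos: "\<And>x. x \<in> X \<Longrightarrow> 0 < inner b (K x)" using b by (simp add: gibbs_solution_def)
  let ?f = "restrict (\<lambda>x. - \<epsilon> * ln (inner b (K x))) X"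
  have "continuous_on X (\<lambda>x. - \<epsilon> * ln (inner b (K x)))"
    using pos by (intro continuous_intros continuous_K) force
  then have "continuous_on X ?f" by (rule continuous_on_eq) simp
  moreover have "(\<integral>x. exp (1 / \<epsilon> * (?f x + ?f y - c x y)) \<partial>M) = 1" if y: "y \<in> X" for y
  proof -
    have "exp (1 / \<epsilon> * (?f x + ?f y - c x y)) = (inner (K y) (K x) / inner b (K x)) * (1 / inner b (K y))"
      if x: "x \<in> X" for x
    proof -
      have "1 / \<epsilon> * (?f x + ?f y - c x y) = - ln (inner b (K x)) - ln (inner b (K y)) + (- c x y / \<epsilon>)"
        using x y eps by (simp add: field_simps)
      also have "exp \<dots> = (1 / inner b (K x)) * (1 / inner b (K y)) * inner (K x) (K y)"
        using pos[OF x] pos[OF y] by (simp add: exp_add exp_diff exp_minus inner_K[OF x y] field_simps)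
      finally show ?thesis by (simp add: inner_commute)
    qed
    then have "(\<integral>x. exp (1 / \<epsilon> * (?f x + ?f y - c x y)) \<partial>M)
        = (\<integral>x. (inner (K y) (K x) / inner b (K x)) * (1 / inner b (K y)) \<partial>M)"
      by (rule integral_eq_on_radon_prob[OF M])
    also have "\<dots> = (\<integral>x. inner (K y) (K x) / inner b (K x) \<partial>M) * (1 / inner b (K y))"
      by (rule integral_mult_left_zero)
    also have "(\<integral>x. inner (K y) (K x) / inner b (K x) \<partial>M) = inner b (K y)"
      using gibbs_solution_inner(1)[OF M b, of "K y"] by (simp add: inner_commute)
    finally show ?thesis using pos[OF y] by simp
  qed
  ultimately show "?f \<in> extensional X \<and> continuous_on X ?f \<and>
      (\<forall>y\<in>X. (\<integral>x. exp (1 / \<epsilon> * (?f x + ?f y - c x y)) \<partial>M) = 1)" by simp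
next
  fix f assume f: "f \<in> extensional X \<and> continuous_on X f \<and>
      (\<forall>y\<in>X. (\<integral>x. exp (1 / \<epsilon> * (f x + f y - c x y)) \<partial>M) = 1)"
  \<comment> \<open>A competitor \<open>f\<close> is only a continuous function. This integral turns
    it into an element of the Hilbert space whose values are
    \<open>exp (- f y / \<epsilon>)\<close>, so uniqueness there applies.\<close>
  define b' where "b' = (\<integral>x. exp (f x / \<epsilon>) *\<^sub>R K x \<partial>M)"
  have int: "integrable M (\<lambda>x. exp (f x / \<epsilon>) *\<^sub>R K x)"
    using f eps by (intro integrable_continuous_radon_prob[OF M compact_X] continuous_intros continuous_K) auto
  have b'f: "inner b' (K y) = exp (- f y / \<epsilon>)" if y: "y \<in> X" for y
  proof -
    have "1 = (\<integral>x. exp (1 / \<epsilon> * (f x + f y - c x y)) \<partial>M)" using f y by simp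
    also have "\<dots> = (\<integral>x. inner (exp (f x / \<epsilon>) *\<^sub>R K x) (K y) * exp (f y / \<epsilon>) \<partial>M)"
    proof (rule integral_eq_on_radon_prob[OF M])
      fix x assume x: "x \<in> X"
      have "1 / \<epsilon> * (f x + f y - c x y) = f x / \<epsilon> + (- c x y / \<epsilon>) + f y / \<epsilon>"
        by (simp add: add_divide_distrib diff_divide_distrib)
      then show "exp (1 / \<epsilon> * (f x + f y - c x y)) = inner (exp (f x / \<epsilon>) *\<^sub>R K x) (K y) * exp (f y / \<epsilon>)"
        by (simp only: exp_add inner_scaleR_left inner_K[OF x y])
    qed
    also have "\<dots> = inner b' (K y) * exp (f y / \<epsilon>)"
      unfolding b'_def using int
      by (simp only: integral_mult_left_zero integral_inner_left)
    finally have "inner b' (K y) = 1 / exp (f y / \<epsilon>)" by (simp add: eq_divide_eq)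
    then show ?thesis by (simp add: exp_minus inverse_eq_divide)
  qed
  have "(\<integral>x. (1 / inner b' (K x)) *\<^sub>R K x \<partial>M) = b'"
    unfolding b'_def[symmetric] by (subst (2) b'_def)
      (intro integral_eq_on_radon_prob[OF M], simp add: b'f exp_minus inverse_eq_divide)
  then have "gibbs_solution M b'" using b'f by (simp add: gibbs_solution_def)
  then have "b' = b" by (rule gibbs_solution_unique[OF M _ b])
  then have "f y = - \<epsilon> * ln (inner b (K y))" if "y \<in> X" for y
    using b'f[OF that] eps by simp
  then show "f = restrict (\<lambda>x. - \<epsilon> * ln (inner b (K x))) X"
    using f by (intro extensionalityI[of _ X]) auto
qed

lemma B_map_gibbs_solution:
  assumes "M \<in> radon_prob X" "gibbs_solution M b" "x \<in> X"
  shows "B_map \<epsilon> X c M x = inner b (K x)"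
  using assms eps by (simp add: B_map_def self_potential_gibbs_solution gibbs_solution_def)

end

section \<open>Continuous functions\<close>

text \<open>The interface between the Hilbert space and the test functions. The conditions on
  \<open>g\<close> in the quotient bound are the a priori bounds for solutions; it is used with
  \<open>g\<close> a solution and \<open>h\<close> the difference of two. The constant does not
  depend on \<open>g\<close>, hence not on time.\<close>

locale gibbs_function_space = gibbs_feature_map \<epsilon> X c K \<kappa> + complete_seminormed_functions D N
  for \<epsilon> X c and K :: "'a::topological_space \<Rightarrow> 'h::{real_inner, banach, second_countable_topology}" and \<kappa> D N +
  assumes D_continuous: "\<phi> \<in> D \<Longrightarrow> continuous_on X \<phi>"
    and abs_le_N: "\<lbrakk>\<phi> \<in> D; x \<in> X\<rbrakk> \<Longrightarrow> \<bar>\<phi> x\<bar> \<le> N \<phi>"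
    and quotient_bound: "\<exists>C\<ge>0. \<forall>g h. norm g = 1 \<and> (\<forall>x\<in>X. \<kappa> \<le> inner g (K x)) \<longrightarrow>
      (\<lambda>x. inner h (K x) / inner g (K x)) \<in> D \<and> N (\<lambda>x. inner h (K x) / inner g (K x)) \<le> C * norm h"
begin

lemma pairing_in_dual_space:
  assumes M: "M \<in> radon_prob X"
  shows "pairing M \<in> dual_space D N"
proof -
  have int: "integrable M \<phi>" if "\<phi> \<in> D" for \<phi>
    by (rule integrable_continuous_radon_prob[OF M compact_X D_continuous[OF that]])
  have "\<bar>pairing M \<phi>\<bar> \<le> 1 * N \<phi>" if \<phi>: "\<phi> \<in> D" for \<phi>
  proof -
    have "\<bar>pairing M \<phi>\<bar> \<le> (\<integral>x. \<bar>\<phi> x\<bar> \<partial>M)" unfolding pairing_def by (rule integral_abs_bound)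
    also have "\<dots> \<le> (\<integral>x. N \<phi> \<partial>M)"
      by (intro integral_mono_radon_prob[OF M compact_X] continuous_intros D_continuous \<phi> abs_le_N)
    also have "\<dots> = N \<phi>" using radon_prob_facts(2,4)[OF M] by simp
    finally show ?thesis by simp
  qed
  then show ?thesis using int unfolding dual_space_def pairing_def by (auto intro!: exI[of _ 1])
qed

theorem weakstar_C1_path_admissible:
  assumes path: "weakstar_C1_path D N X \<mu> \<mu>'" and ev: "\<And>h x. x \<in> X \<Longrightarrow> ev h x = inner h (K x)"
  shows "admissible_path \<epsilon> X c ev \<mu>"
proof -
  have M: "\<mu> t \<in> radon_prob X" if "t \<in> {0<..<1}" for t
    using path that by (simp add: weakstar_C1_path_def)
  have "\<forall>t\<in>{0<..<1}. \<exists>b. gibbs_solution (\<mu> t) b"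
    using gibbs_solution_exists[OF M] by metis
  then obtain u where u: "\<And>t. t \<in> {0<..<1} \<Longrightarrow> gibbs_solution (\<mu> t) (u t)" by metis
  obtain L where L: "L \<ge> 0" "\<And>s t \<phi>. \<lbrakk>s \<in> {0<..<1}; t \<in> {0<..<1}; \<phi> \<in> D\<rbrakk> \<Longrightarrow>
      \<bar>pairing (\<mu> s) \<phi> - pairing (\<mu> t) \<phi>\<bar> \<le> L * \<bar>s - t\<bar> * N \<phi>"
    using weakstar_C1_path_lipschitz[OF path] by blast
  obtain C where C: "C \<ge> 0" "\<And>g h. \<lbrakk>norm g = 1; \<And>x. x \<in> X \<Longrightarrow> \<kappa> \<le> inner g (K x)\<rbrakk> \<Longrightarrow>
      (\<lambda>x. inner h (K x) / inner g (K x)) \<in> D \<and> N (\<lambda>x. inner h (K x) / inner g (K x)) \<le> C * norm h"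
    using quotient_bound by blast
  have "(L * C)-lipschitz_on {0<..<1} u"
  proof (rule lipschitz_onI)
    fix s t :: real assume st: "s \<in> {0<..<1}" "t \<in> {0<..<1}"
    let ?d = "u s - u t" and ?g = "\<lambda>x. inner (u s - u t) (K x) / inner (u t) (K x)"
    have g: "?g \<in> D" "N ?g \<le> C * norm ?d"
      using C(2)[OF gibbs_solution_norm[OF M[OF st(2)] u[OF st(2)]]
          gibbs_solution_ge[OF M[OF st(2)] u[OF st(2)]], of ?d] by blast+
    have "(norm ?d)\<^sup>2 \<le> pairing (\<mu> s) ?g - pairing (\<mu> t) ?g"
      by (rule gibbs_solution_stability[OF M[OF st(1)] u[OF st(1)] M[OF st(2)] u[OF st(2)]])
    also have "\<dots> \<le> L * \<bar>s - t\<bar> * N ?g" using L(2)[OF st g(1)] by linarith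
    also have "\<dots> \<le> L * \<bar>s - t\<bar> * (C * norm ?d)" using L(1) g(2) by (intro mult_left_mono) auto
    \<comment> \<open>One factor \<open>norm ?d\<close> comes from the quotient bound. Cancelling it
      leaves a Lipschitz estimate, not merely a Hoelder one of exponent 1/2.\<close>
    finally have "norm ?d * norm ?d \<le> (L * C * \<bar>s - t\<bar>) * norm ?d"
      by (simp add: power2_eq_square mult.commute mult.left_commute)
    then have "norm ?d \<le> L * C * \<bar>s - t\<bar>"
      using L(1) C(1) by (cases "norm ?d = 0") (simp, simp only: mult_le_cancel_right, simp)
    then show "dist (u s) (u t) \<le> L * C * dist s t" by (simp add: dist_norm)
  qed (use L(1) C(1) in simp)
  then have "H1_on 0 1 u" by (rule lipschitz_on_imp_H1_on)
  moreover have "ev (u t) x = B_map \<epsilon> X c (\<mu> t) x" if "t \<in> {0<..<1}" "x \<in> X" for t x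
    using B_map_gibbs_solution[OF M u] ev that by simp
  ultimately show ?thesis unfolding admissible_path_def by blast
qed

theorem weakstar_C1_path_conclusions:
  assumes path: "weakstar_C1_path D N X \<mu> \<mu>'" and ev: "\<And>h x. x \<in> X \<Longrightarrow> ev h x = inner h (K x)"
  shows "bdd_above ((\<lambda>t. dual_norm D N (\<mu>' t)) ` {0..1}) \<and>
    AC2_on (dual_space D N) (dual_dist D N) 0 1 (\<lambda>t. pairing (\<mu> t)) \<and> admissible_path \<epsilon> X c ev \<mu>"
proof (intro conjI)
  show "AC2_on (dual_space D N) (dual_dist D N) 0 1 (\<lambda>t. pairing (\<mu> t))"
    using path by (intro weakstar_C1_path_AC2_on[OF path] pairing_in_dual_space) (simp add: weakstar_C1_path_def)
qed (rule weakstar_C1_path_derivative_bounded[OF path] weakstar_C1_path_admissible[OF path ev], assumption?)+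

end

text \<open>The feature map is continuous because \<open>(norm (K y - K x))^2\<close> equals
  \<open>k(y,y) - 2 k(y,x) + k(x,x)\<close>, which tends to 0 by continuity of the kernel.\<close>

lemma gibbs_feature_map_exists:
  fixes ev :: "'h::{real_inner, banach, second_countable_topology} \<Rightarrow> 'a::metric_space \<Rightarrow> real"
  assumes eps: "\<epsilon> > 0" and X: "compact X" "X \<noteq> {}"
    and c: "continuous_on (X \<times> X) (\<lambda>(x, y). c x y)" and adm: "admissible_cost \<epsilon> X c ev"
  obtains K :: "'a \<Rightarrow> 'h" and \<kappa> where "gibbs_feature_map \<epsilon> X c K \<kappa>" "\<And>h x. x \<in> X \<Longrightarrow> ev h x = inner h (K x)"
proof -
  let ?k = "\<lambda>z. exp (- (case z of (x, y) \<Rightarrow> c x y) / \<epsilon>)"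
  have k_cont: "continuous_on (X \<times> X) ?k" by (intro continuous_intros c) (use eps in auto)
  \<comment> \<open>The minimum of the kernel over the compact product, positive as a value of
    \<open>exp\<close>, serves as \<open>\<kappa>\<close>.\<close>
  have "\<exists>z\<in>X \<times> X. \<forall>w\<in>X \<times> X. ?k z \<le> ?k w"
    using X by (intro continuous_attains_inf k_cont compact_Times) auto
  then obtain z where z: "\<And>x y. x \<in> X \<Longrightarrow> y \<in> X \<Longrightarrow> ?k z \<le> exp (- c x y / \<epsilon>)" by force
  have "\<forall>x\<in>X. \<exists>kx. (\<forall>y\<in>X. ev kx y = gibbs_kernel \<epsilon> c x y) \<and> (\<forall>h. ev h x = inner h kx)"
    using adm by (simp add: admissible_cost_def is_rkhs_def)
  then obtain K where K: "\<And>x y. x \<in> X \<Longrightarrow> y \<in> X \<Longrightarrow> ev (K x) y = gibbs_kernel \<epsilon> c x y"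
    "\<And>h x. x \<in> X \<Longrightarrow> ev h x = inner h (K x)" by metis
  have ip: "inner (K x) (K y) = ?k (x, y)" if "x \<in> X" "y \<in> X" for x y
    using K(1)[OF that] K(2)[OF that(2), of "K x"] by (simp add: gibbs_kernel_def)
  have "continuous_on X K"
    unfolding continuous_on_def
  proof
    fix x assume x: "x \<in> X"
    have lim: "((\<lambda>y. ?k (p y, q y)) \<longlongrightarrow> ?k (x, x)) (at x within X)"
      if p: "(p \<longlongrightarrow> x) (at x within X)" "(q \<longlongrightarrow> x) (at x within X)" "\<And>y. y \<in> X \<Longrightarrow> p y \<in> X \<and> q y \<in> X" for p q
      using that x
      by (intro continuous_on_tendsto_compose[OF k_cont] tendsto_Pair) (auto simp: eventually_at_filter)
    have "((\<lambda>y. (norm (K y - K x))\<^sup>2) \<longlongrightarrow> ?k (x, x) - 2 * ?k (x, x) + ?k (x, x)) (at x within X)"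
    proof (rule Lim_transform_eventually)
      show "((\<lambda>y. ?k (y, y) - 2 * ?k (y, x) + ?k (x, x)) \<longlongrightarrow> ?k (x, x) - 2 * ?k (x, x) + ?k (x, x)) (at x within X)"
        by (rule tendsto_add[OF tendsto_diff[OF lim tendsto_mult[OF tendsto_const lim]] tendsto_const])
          (use x in \<open>auto intro!: tendsto_ident_at\<close>)
      show "\<forall>\<^sub>F y in at x within X. ?k (y, y) - 2 * ?k (y, x) + ?k (x, x) = (norm (K y - K x))\<^sup>2"
        unfolding eventually_at_filter
      proof (intro always_eventually allI impI)
        fix y assume y: "y \<in> X"
        have "(norm (K y - K x))\<^sup>2 = inner (K y) (K y) - 2 * inner (K y) (K x) + inner (K x) (K x)"
          by (simp add: power2_norm_eq_inner inner_diff inner_commute)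
        then show "?k (y, y) - 2 * ?k (y, x) + ?k (x, x) = (norm (K y - K x))\<^sup>2"
          by (simp only: ip[OF y y] ip[OF y x] ip[OF x x])
      qed
    qed
    then have "((\<lambda>y. norm (K y - K x)) \<longlongrightarrow> 0) (at x within X)"
      using tendsto_real_sqrt[of "\<lambda>y. (norm (K y - K x))\<^sup>2" 0] by simp
    then show "(K \<longlongrightarrow> K x) (at x within X)" by (simp add: LIM_zero_cancel tendsto_norm_zero_iff)
  qed
  then have "gibbs_feature_map \<epsilon> X c K (?k z)"
    using eps X z ip adm by unfold_locales (auto simp: admissible_cost_def)
  then show thesis using K(2) by (rule that)
qed

section \<open>The space C(X)\<close>

lemma abs_le_C_norm:
  assumes "compact X" "\<phi> \<in> C_space X" "x \<in> X"
  shows "\<bar>\<phi> x\<bar> \<le> C_norm X \<phi>"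
proof -
  have "continuous_on X (\<lambda>x. \<bar>\<phi> x\<bar>)"
    using assms(2) by (intro continuous_on_rabs) (simp add: C_space_def)
  then have "bdd_above ((\<lambda>x. \<bar>\<phi> x\<bar>) ` X)"
    using assms(1) by (intro bounded_imp_bdd_above compact_imp_bounded compact_continuous_image)
  then show ?thesis unfolding C_norm_def using assms(3) by (intro cSUP_upper)
qed

lemma C_norm_le: "\<lbrakk>X \<noteq> {}; \<And>x. x \<in> X \<Longrightarrow> \<bar>\<phi> x\<bar> \<le> B\<rbrakk> \<Longrightarrow> C_norm X \<phi> \<le> B"
  unfolding C_norm_def by (rule cSUP_least)

lemma seminormed_functions_C_space:
  fixes X :: "'a::topological_space set"
  assumes X: "compact X" "X \<noteq> {}"
  shows "seminormed_functions (C_space X) (C_norm X)"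
proof
  fix \<phi> \<psi> :: "'a \<Rightarrow> real" and r :: real
  assume \<phi>: "\<phi> \<in> C_space X"
  show "(\<lambda>x. r * \<phi> x) \<in> C_space X" using \<phi> by (auto simp: C_space_def intro!: continuous_intros)
  obtain z where z: "z \<in> X" using X by blast
  show "0 \<le> C_norm X \<phi>" using abs_le_C_norm[OF X(1) \<phi> z] by linarith
  show "C_norm X (\<lambda>x. r * \<phi> x) = \<bar>r\<bar> * C_norm X \<phi>"
  proof -
    have bdd: "bdd_above ((\<lambda>x. \<bar>\<phi> x\<bar>) ` X)" using abs_le_C_norm[OF X(1) \<phi>] by (intro bdd_aboveI2)
    \<comment> \<open>Multiplication by \<open>\<bar>r\<bar>\<close> is monotone and continuous, so
      it commutes with the supremum, also for \<open>r = 0\<close>.\<close>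
    have "(SUP x\<in>X. \<bar>r\<bar> * \<bar>\<phi> x\<bar>) = \<bar>r\<bar> * (SUP x\<in>X. \<bar>\<phi> x\<bar>)"
      using continuous_at_Sup_mono[of "\<lambda>y. \<bar>r\<bar> * y" "(\<lambda>x. \<bar>\<phi> x\<bar>) ` X"] bdd X(2)
      by (simp add: image_image mono_def mult_left_mono continuous_intros)
    then show ?thesis by (simp add: C_norm_def abs_mult)
  qed
  assume \<psi>: "\<psi> \<in> C_space X"
  show "(\<lambda>x. \<phi> x + \<psi> x) \<in> C_space X" using \<phi> \<psi> by (auto simp: C_space_def intro!: continuous_intros)
  show "C_norm X (\<lambda>x. \<phi> x + \<psi> x) \<le> C_norm X \<phi> + C_norm X \<psi>"
  proof (rule C_norm_le[OF X(2)])
    fix x assume "x \<in> X"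
    then show "\<bar>\<phi> x + \<psi> x\<bar> \<le> C_norm X \<phi> + C_norm X \<psi>"
      using abs_le_C_norm[OF X(1) \<phi>] abs_le_C_norm[OF X(1) \<psi>] by (intro order_trans[OF abs_triangle_ineq] add_mono)
  qed
qed (simp add: C_space_def)

lemma complete_seminormed_functions_C_space:
  fixes X :: "'a::topological_space set"
  assumes X: "compact X" "X \<noteq> {}"
  shows "complete_seminormed_functions (C_space X) (C_norm X)"
proof -
  interpret seminormed_functions "C_space X" "C_norm X" by (rule seminormed_functions_C_space[OF X])
  show ?thesis
  proof
    fix f :: "nat \<Rightarrow> 'a \<Rightarrow> real"
    assume f: "\<And>n. f n \<in> C_space X" and sm: "summable (\<lambda>n. C_norm X (f n))"
    have le: "x \<in> X \<Longrightarrow> norm (f n x) \<le> C_norm X (f n)" for n x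
      using abs_le_C_norm[OF X(1) f] by simp
    define F where "F x = (\<Sum>n. f n x)" for x
    have "uniform_limit X (\<lambda>n x. \<Sum>i<n. f i x) F sequentially"
      unfolding F_def using le sm by (intro Weierstrass_m_test)
    then have "continuous_on X F"
      by (rule uniform_limit_theorem[rotated])
        (use f in \<open>auto simp: C_space_def intro!: always_eventually continuous_intros\<close>)
    moreover have "C_norm X (\<lambda>x. F x - (\<Sum>i<n. f i x)) \<le> (\<Sum>i. C_norm X (f (i + n)))" for n
    proof (rule C_norm_le[OF X(2)])
      fix x assume x: "x \<in> X"
      have sx: "summable (\<lambda>n. f n x)" using le[OF x] by (intro summable_comparison_test'[OF sm, of 0])
      have sN: "summable (\<lambda>i. C_norm X (f (i + n)))" using sm by (rule summable_ignore_initial_segment)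
      have "F x - (\<Sum>i<n. f i x) = (\<Sum>i. f (i + n) x)"
        using suminf_minus_initial_segment[OF sx, of n] by (simp add: F_def)
      also have "norm \<dots> \<le> (\<Sum>i. C_norm X (f (i + n)))"
        using le[OF x] by (intro norm_suminf_le sN)
      finally show "\<bar>F x - (\<Sum>i<n. f i x)\<bar> \<le> (\<Sum>i. C_norm X (f (i + n)))" by simp
    qed
    ultimately show "\<exists>F\<in>C_space X. \<forall>n. C_norm X (\<lambda>x. F x - (\<Sum>i<n. f i x)) \<le> (\<Sum>i. C_norm X (f (i + n)))"
      by (intro bexI[of _ F]) (auto simp: C_space_def)
  qed
qed

lemma weakstar_C1_path_nonempty:
  assumes "weakstar_C1_path D N X \<mu> \<mu>'"
  shows "X \<noteq> {}"
proof -
  have "\<mu> (1/2) \<in> radon_prob X" using assms by (simp add: weakstar_C1_path_def)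
  then show ?thesis by (rule radon_prob_facts)
qed

proposition C_space_path_conclusions:
  fixes ev :: "'h::{real_inner, banach, second_countable_topology} \<Rightarrow> 'a::metric_space \<Rightarrow> real"
  assumes eps: "\<epsilon> > 0" and X: "compact X" and c: "(\<lambda>(x, y). c x y) \<in> C_space (X \<times> X)"
    and adm: "admissible_cost \<epsilon> X c ev" and path: "weakstar_C1_path (C_space X) (C_norm X) X \<mu> \<mu>'"
  shows "bdd_above ((\<lambda>t. dual_norm (C_space X) (C_norm X) (\<mu>' t)) ` {0..1}) \<and>
    AC2_on (dual_space (C_space X) (C_norm X)) (dual_dist (C_space X) (C_norm X)) 0 1 (\<lambda>t. pairing (\<mu> t)) \<and>
    admissible_path \<epsilon> X c ev \<mu>"
proof -
  \<comment> \<open>The supremum \<open>C_norm\<close> and the minimum of the kernel both need a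
    point of \<open>X\<close>; a probability measure on \<open>X\<close> supplies one.\<close>
  have ne: "X \<noteq> {}" using path by (rule weakstar_C1_path_nonempty)
  obtain K :: "'a \<Rightarrow> 'h" and \<kappa> where fm: "gibbs_feature_map \<epsilon> X c K \<kappa>"
    and ev: "\<And>h x. x \<in> X \<Longrightarrow> ev h x = inner h (K x)"
    using gibbs_feature_map_exists[OF eps X ne _ adm] c by (auto simp: C_space_def)
  interpret gibbs_feature_map \<epsilon> X c K \<kappa> by (rule fm)
  interpret complete_seminormed_functions "C_space X" "C_norm X"
    by (rule complete_seminormed_functions_C_space[OF X ne])
  interpret gibbs_function_space \<epsilon> X c K \<kappa> "C_space X" "C_norm X"
  proof
    show "\<phi> \<in> C_space X \<Longrightarrow> continuous_on X \<phi>" for \<phi> :: "'a \<Rightarrow> real" by (simp add: C_space_def)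
    show "\<lbrakk>\<phi> \<in> C_space X; x \<in> X\<rbrakk> \<Longrightarrow> \<bar>\<phi> x\<bar> \<le> C_norm X \<phi>" for \<phi> x by (rule abs_le_C_norm[OF X])
    have "(\<lambda>x. inner h (K x) / inner g (K x)) \<in> C_space X \<and>
        C_norm X (\<lambda>x. inner h (K x) / inner g (K x)) \<le> (1 / \<kappa>) * norm h"
      if g: "\<And>x. x \<in> X \<Longrightarrow> \<kappa> \<le> inner g (K x)" for g h
    proof
      show "(\<lambda>x. inner h (K x) / inner g (K x)) \<in> C_space X"
        unfolding C_space_def using g kappa_pos by (force intro!: continuous_intros continuous_K)
      show "C_norm X (\<lambda>x. inner h (K x) / inner g (K x)) \<le> (1 / \<kappa>) * norm h"
      proof (rule C_norm_le[OF ne])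
        fix x assume x: "x \<in> X"
        have "\<bar>inner h (K x)\<bar> / inner g (K x) \<le> norm h / \<kappa>"
          using g[OF x] kappa_pos abs_inner_K_le[OF x] by (intro frac_le) auto
        then show "\<bar>inner h (K x) / inner g (K x)\<bar> \<le> (1 / \<kappa>) * norm h"
          using g[OF x] kappa_pos by (simp add: abs_divide)
      qed
    qed
    then show "\<exists>C\<ge>0. \<forall>g h. norm g = 1 \<and> (\<forall>x\<in>X. \<kappa> \<le> inner g (K x)) \<longrightarrow>
      (\<lambda>x. inner h (K x) / inner g (K x)) \<in> C_space X \<and>
      C_norm X (\<lambda>x. inner h (K x) / inner g (K x)) \<le> C * norm h"
      using kappa_pos by (intro exI[of _ "1 / \<kappa>"]) auto
  qed
  show ?thesis using path ev by (rule weakstar_C1_path_conclusions)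
qed

section \<open>Differentiable functions\<close>

abbreviation has_dir_derivative :: "('a::euclidean_space \<Rightarrow> real) \<Rightarrow> 'a \<Rightarrow> real \<Rightarrow> 'a \<Rightarrow> bool" where
  "has_dir_derivative f b d x \<equiv> ((\<lambda>t. f (x + t *\<^sub>R b)) has_real_derivative d) (at 0)"

lemma eventually_line_in_open:
  fixes x b :: "'a::real_normed_vector"
  assumes "open S" "x \<in> S"
  shows "\<forall>\<^sub>F t in nhds 0. x + t *\<^sub>R b \<in> S"
proof -
  have "((\<lambda>t. x + t *\<^sub>R b) \<longlongrightarrow> x + 0 *\<^sub>R b) (nhds 0)" by (intro tendsto_intros filterlim_ident)
  then show ?thesis using assms by (intro topological_tendstoD) auto
qed

lemma has_dir_derivative_cong_open:
  assumes S: "open S" "x \<in> S" and eq: "\<And>y. y \<in> S \<Longrightarrow> f y = g y" and f: "has_dir_derivative f b d x"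
  shows "has_dir_derivative g b d x"
proof -
  have *: "\<forall>\<^sub>F t in nhds 0. f (x + t *\<^sub>R b) = g (x + t *\<^sub>R b)"
    using eventually_line_in_open[OF S, of b] by eventually_elim (rule eq)
  show ?thesis by (rule iffD1[OF DERIV_cong_ev[OF refl * refl] f])
qed

lemma has_dir_derivative_shift:
  assumes "has_dir_derivative f b d (x + t *\<^sub>R b)"
  shows "((\<lambda>s. f (x + s *\<^sub>R b)) has_real_derivative d) (at t)"
proof -
  have "((\<lambda>s. f (x + (s + t) *\<^sub>R b)) has_real_derivative d) (at 0)"
    using assms by (simp add: scaleR_add_left add.assoc add.commute[of "t *\<^sub>R b"])
  then show ?thesis using DERIV_shift[of "\<lambda>s. f (x + s *\<^sub>R b)" d 0 t] by simp
qed

text \<open>Iterated derivatives are local. Hence a derivative may be replaced by its continuous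
  extension to \<open>X\<close>, with which it agrees in the interior only.\<close>

lemma partials_cong_open:
  assumes "open S" "\<And>y. y \<in> S \<Longrightarrow> f y = g y" "x \<in> S"
  shows "partials bs f x = partials bs g x"
  using assms(3)
proof (induction bs arbitrary: x)
  case (Cons b bs)
  have "\<forall>\<^sub>F t in nhds 0. partials bs f (x + t *\<^sub>R b) = partials bs g (x + t *\<^sub>R b)"
    using eventually_line_in_open[OF assms(1) Cons.prems, of b] by eventually_elim (rule Cons.IH)
  then show ?case by (simp add: deriv_cong_ev)
qed (simp add: assms)

section \<open>Word classes and induction on the order of differentiation\<close>

lemma partials_append: "partials (xs @ ys) f = partials xs (partials ys f)"
  by (induction xs) simp_all

text \<open>A single predicate for C^m(X) and C^(m,m)(X x X) with a bound on all listed derivatives.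
  Since \<open>W\<close> is arbitrary, it passes to derivatives, whose word set is in general
  neither \<open>Cm_words\<close> nor \<open>Cmm_words\<close>.\<close>

definition cont_diff_bounded :: "'a::euclidean_space list set \<Rightarrow> 'a set \<Rightarrow> real \<Rightarrow> ('a \<Rightarrow> real) \<Rightarrow> bool" where
  "cont_diff_bounded W X B f \<longleftrightarrow> cont_diff_on W X f \<and> (\<forall>bs\<in>W. \<forall>x\<in>interior X. \<bar>partials bs f x\<bar> \<le> B)"

text \<open>Closure under subwords gives \<open>after W b \<subseteq> W\<close>. The product rule
  needs this: the undifferentiated factors of a derivative must themselves be of the smaller
  class.\<close>

definition word_class :: "'a list set \<Rightarrow> bool" where
  "word_class W \<longleftrightarrow> [] \<in> W \<and> (\<forall>w\<in>W. \<forall>v. subseq v w \<longrightarrow> v \<in> W)"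

text \<open>The last letter of a word is the first derivative taken, so \<open>after W b\<close> lists the derivatives of \<open>\<partial>\<^sub>b f\<close> for \<open>f\<close> of class \<open>W\<close>.\<close>

definition after :: "'a list set \<Rightarrow> 'a \<Rightarrow> 'a list set" where
  "after W b = {w. w @ [b] \<in> W}"

lemma word_class_Nil: "word_class W \<Longrightarrow> [] \<in> W"
  by (simp add: word_class_def)

lemma word_class_suffix: "word_class W \<Longrightarrow> u @ v \<in> W \<Longrightarrow> v \<in> W"
  unfolding word_class_def by (metis list_emb_append2 subseq_order.order_refl)

lemma word_class_after:
  assumes W: "word_class W" and b: "[b] \<in> W"
  shows "word_class (after W b)" "after W b \<subseteq> W"
proof -
  show "after W b \<subseteq> W"
  proof
    fix w assume "w \<in> after W b"
    then have "w @ [b] \<in> W" by (simp add: after_def)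
    moreover have "subseq w (w @ [b])" by (simp add: prefix_imp_subseq)
    ultimately show "w \<in> W" using W unfolding word_class_def by blast
  qed
  have "subseq v w \<Longrightarrow> subseq (v @ [b]) (w @ [b])" for v w by simp
  then show "word_class (after W b)"
    using W b unfolding word_class_def after_def by auto
qed

lemma after_length: "(\<And>w. w \<in> W \<Longrightarrow> length w \<le> Suc n) \<Longrightarrow> w \<in> after W b \<Longrightarrow> length w \<le> n"
  by (fastforce simp: after_def)

lemma cont_diff_bounded_continuous: "cont_diff_bounded W X B f \<Longrightarrow> continuous_on X f"
  by (simp add: cont_diff_bounded_def cont_diff_on_def)

lemma cont_diff_bounded_mono:
  assumes "cont_diff_bounded W X B f" "V \<subseteq> W" "B \<le> B'"
  shows "cont_diff_bounded V X B' f"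
proof -
  have "cont_diff_on V X f"
    using assms(1) subsetD[OF assms(2)] unfolding cont_diff_bounded_def cont_diff_on_def by blast
  moreover have "\<bar>partials bs f x\<bar> \<le> B'" if "bs \<in> V" "x \<in> interior X" for bs x
    using assms(1) subsetD[OF assms(2) that(1)] that(2) order_trans[OF _ assms(3)]
    unfolding cont_diff_bounded_def by blast
  ultimately show ?thesis unfolding cont_diff_bounded_def by blast
qed

lemma cont_diff_bounded_abs_le:
  assumes "cont_diff_bounded W X B f" "[] \<in> W" "x \<in> interior X"
  shows "\<bar>f x\<bar> \<le> B"
  using assms unfolding cont_diff_bounded_def by (metis partials.simps(1))

text \<open>The bound is imposed in the interior only; density of the interior and continuity carry
  it to \<open>X\<close>.\<close>

lemma cont_diff_bounded_abs_le_closure: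
  assumes f: "cont_diff_bounded W X B f" and W: "[] \<in> W" and X: "closure (interior X) = X" and x: "x \<in> X"
  shows "\<bar>f x\<bar> \<le> B"
proof (rule continuous_le_on_closure[where S = "interior X" and f = "\<lambda>x. \<bar>f x\<bar>"])
  show "continuous_on (closure (interior X)) (\<lambda>x. \<bar>f x\<bar>)"
    unfolding X by (intro continuous_on_rabs cont_diff_bounded_continuous[OF f])
qed (use X x cont_diff_bounded_abs_le[OF f W] in auto)

lemma cont_diff_bounded_cong:
  assumes f: "cont_diff_bounded W X B f" and eq: "\<And>x. x \<in> X \<Longrightarrow> f x = g x"
  shows "cont_diff_bounded W X B g"
proof -
  have "continuous_on X g"
    using cont_diff_bounded_continuous[OF f] by (rule continuous_on_eq) (rule eq)
  moreover have p: "partials bs f x = partials bs g x" if "x \<in> interior X" for bs x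
    using that eq interior_subset by (intro partials_cong_open[of "interior X"]) auto
  moreover have "(\<lambda>t. partials bs g (x + t *\<^sub>R b)) field_differentiable (at 0)"
    if "(\<lambda>t. partials bs f (x + t *\<^sub>R b)) field_differentiable (at 0)" "x \<in> interior X" for b bs x
    using that has_dir_derivative_cong_open[of "interior X" x "partials bs f" "partials bs g" b] p
    unfolding field_differentiable_def by blast
  ultimately show ?thesis using f unfolding cont_diff_bounded_def cont_diff_on_def by auto
qed

text \<open>\<open>g\<close> is the continuous extension of the first derivative, hence a function
  on all of \<open>X\<close> to which the predicate applies again.\<close>

lemma cont_diff_bounded_derivative:
  assumes f: "cont_diff_bounded W X B f" and b: "[b] \<in> W"
  obtains g where "\<And>x. x \<in> interior X \<Longrightarrow> has_dir_derivative f b (g x) x" "cont_diff_bounded (after W b) X B g"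
proof -
  obtain g where g: "continuous_on X g" "\<And>x. x \<in> interior X \<Longrightarrow> g x = partials [b] f x"
    using f b unfolding cont_diff_bounded_def cont_diff_on_def by meson
  have p: "partials (bs @ [b]) f x = partials bs g x" if "x \<in> interior X" for bs x
    unfolding partials_append using that g(2) by (intro partials_cong_open[of "interior X"]) auto
  have d: "has_dir_derivative f b (g x) x" if x: "x \<in> interior X" for x
  proof -
    have "(\<lambda>t. partials [] f (x + t *\<^sub>R b)) field_differentiable (at 0)"
      using f b x unfolding cont_diff_bounded_def cont_diff_on_def by blast
    then show ?thesis using g(2)[OF x] by (simp add: DERIV_deriv_iff_field_differentiable)
  qed
  have "(\<lambda>t. partials bs g (x + t *\<^sub>R a)) field_differentiable (at 0)"
    if "a # bs \<in> after W b" "x \<in> interior X" for a bs x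
  proof -
    have "(\<lambda>t. partials (bs @ [b]) f (x + t *\<^sub>R a)) field_differentiable (at 0)"
      using f that unfolding cont_diff_bounded_def cont_diff_on_def after_def by simp
    then show ?thesis
      using has_dir_derivative_cong_open[of "interior X" x "partials (bs @ [b]) f" "partials bs g" a] p that
      unfolding field_differentiable_def by blast
  qed
  moreover have "\<exists>h. continuous_on X h \<and> (\<forall>x\<in>interior X. h x = partials bs g x)" if "bs \<in> after W b" for bs
    using f that p unfolding cont_diff_bounded_def cont_diff_on_def after_def by (metis (no_types, lifting) mem_Collect_eq)
  moreover have "\<bar>partials bs g x\<bar> \<le> B" if "bs \<in> after W b" "x \<in> interior X" for bs x
    using f that p[symmetric] unfolding cont_diff_bounded_def after_def by simp
  ultimately have "cont_diff_bounded (after W b) X B g"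
    using g(1) unfolding cont_diff_bounded_def cont_diff_on_def by blast
  with d show thesis by (rule that)
qed

text \<open>The converse of the previous lemma. Together they allow induction on the maximal word
  length: the derivative taken first is stripped off and \<open>W\<close> shrinks to
  \<open>after W b\<close>. Words are therefore split at their right end.\<close>

lemma cont_diff_boundedI:
  assumes W: "word_class W" and cont: "continuous_on X f" and le: "\<And>x. x \<in> interior X \<Longrightarrow> \<bar>f x\<bar> \<le> B"
    and deriv: "\<And>b. [b] \<in> W \<Longrightarrow> \<exists>g. (\<forall>x\<in>interior X. has_dir_derivative f b (g x) x) \<and> cont_diff_bounded (after W b) X B g"
  shows "cont_diff_bounded W X B f"
proof -
  have last: "\<exists>g. (\<forall>x\<in>interior X. \<forall>w. partials (w @ [b]) f x = partials w g x) \<and> cont_diff_bounded (after W b) X B g"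
    if b: "[b] \<in> W" for b
  proof -
    obtain g where g: "\<And>x. x \<in> interior X \<Longrightarrow> has_dir_derivative f b (g x) x" "cont_diff_bounded (after W b) X B g"
      using deriv[OF b] by blast
    have "partials [b] f x = g x" if "x \<in> interior X" for x
      using DERIV_imp_deriv[OF g(1)[OF that]] by simp
    then have "\<forall>x\<in>interior X. \<forall>w. partials (w @ [b]) f x = partials w g x"
      unfolding partials_append by (intro ballI allI partials_cong_open[of "interior X"]) auto
    with g(2) show ?thesis by blast
  qed
  have diff: "(\<lambda>t. partials bs f (x + t *\<^sub>R a)) field_differentiable (at 0)"
    if w: "a # bs \<in> W" and x: "x \<in> interior X" for a bs x
  proof (cases bs rule: rev_cases)
    case Nil
    then show ?thesis using deriv[of a] w x by (auto simp: field_differentiable_def)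
  next
    case (snoc w b)
    have "[b] \<in> W" using word_class_suffix[OF W, of "a # w" "[b]"] that snoc by simp
    from last[OF this] obtain g where g: "\<And>x w. x \<in> interior X \<Longrightarrow> partials (w @ [b]) f x = partials w g x"
      "cont_diff_bounded (after W b) X B g" by blast
    have "(\<lambda>t. partials w g (x + t *\<^sub>R a)) field_differentiable (at 0)"
      using g(2) that snoc unfolding cont_diff_bounded_def cont_diff_on_def after_def by auto
    then show ?thesis
      using has_dir_derivative_cong_open[of "interior X" x "partials w g" "partials (w @ [b]) f" a] g(1) x
      unfolding field_differentiable_def snoc by (metis open_interior)
  qed
  have "(\<exists>h. continuous_on X h \<and> (\<forall>x\<in>interior X. h x = partials bs f x)) \<and> (\<forall>x\<in>interior X. \<bar>partials bs f x\<bar> \<le> B)"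
    if w: "bs \<in> W" for bs
  proof (cases bs rule: rev_cases)
    case Nil
    then show ?thesis using cont le by auto
  next
    case (snoc w b)
    have "[b] \<in> W" using word_class_suffix[OF W, of w "[b]"] that snoc by simp
    from last[OF this] obtain g where g: "\<And>x w. x \<in> interior X \<Longrightarrow> partials (w @ [b]) f x = partials w g x"
      "cont_diff_bounded (after W b) X B g" by blast
    have "w \<in> after W b" using w snoc by (simp add: after_def)
    then show ?thesis using g unfolding snoc cont_diff_bounded_def cont_diff_on_def by simp
  qed
  then show ?thesis using cont diff unfolding cont_diff_bounded_def cont_diff_on_def by blast
qed

section \<open>Sums, products, exponentials, reciprocals and series\<close>

lemma cont_diff_bounded_cmult:
  assumes "word_class W" "\<And>w. w \<in> W \<Longrightarrow> length w \<le> n" "cont_diff_bounded W X A f"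
  shows "cont_diff_bounded W X (\<bar>r\<bar> * A) (\<lambda>x. r * f x)"
  using assms
proof (induction n arbitrary: W f)
  case 0
  show ?case
  proof (rule cont_diff_boundedI[OF 0(1)])
    show "\<bar>r * f x\<bar> \<le> \<bar>r\<bar> * A" if "x \<in> interior X" for x
      using cont_diff_bounded_abs_le[OF 0(3) word_class_Nil[OF 0(1)] that] by (simp add: abs_mult mult_left_mono)
  qed (use cont_diff_bounded_continuous[OF 0(3)] 0(2) in \<open>force intro!: continuous_intros\<close>)+
next
  case (Suc n)
  show ?case
  proof (rule cont_diff_boundedI[OF Suc(2)])
    show "\<bar>r * f x\<bar> \<le> \<bar>r\<bar> * A" if "x \<in> interior X" for x
      using cont_diff_bounded_abs_le[OF Suc(4) word_class_Nil[OF Suc(2)] that] by (simp add: abs_mult mult_left_mono)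
    fix b assume b: "[b] \<in> W"
    obtain g where g: "\<And>x. x \<in> interior X \<Longrightarrow> has_dir_derivative f b (g x) x" "cont_diff_bounded (after W b) X A g"
      using cont_diff_bounded_derivative[OF Suc(4) b] by blast
    have c: "cont_diff_bounded (after W b) X (\<bar>r\<bar> * A) (\<lambda>x. r * g x)"
      by (rule Suc.IH[OF word_class_after(1)[OF Suc(2) b] after_length[OF Suc(3)] g(2)])
    have d: "has_dir_derivative (\<lambda>x. r * f x) b (r * g x) x" if "x \<in> interior X" for x
      by (rule DERIV_cmult[OF g(1)[OF that]])
    show "\<exists>g. (\<forall>x\<in>interior X. has_dir_derivative (\<lambda>x. r * f x) b (g x) x) \<and>
        cont_diff_bounded (after W b) X (\<bar>r\<bar> * A) g"
      by (intro exI[of _ "\<lambda>x. r * g x"] conjI ballI c d)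
  qed (intro continuous_intros cont_diff_bounded_continuous[OF Suc(4)])
qed

lemma cont_diff_bounded_add:
  assumes "word_class W" "\<And>w. w \<in> W \<Longrightarrow> length w \<le> n" "cont_diff_bounded W X A f" "cont_diff_bounded W X B g"
  shows "cont_diff_bounded W X (A + B) (\<lambda>x. f x + g x)"
  using assms
proof (induction n arbitrary: W f g)
  case 0
  show ?case
  proof (rule cont_diff_boundedI[OF 0(1)])
    show "\<bar>f x + g x\<bar> \<le> A + B" if "x \<in> interior X" for x
      using cont_diff_bounded_abs_le[OF 0(3) word_class_Nil[OF 0(1)] that]
        cont_diff_bounded_abs_le[OF 0(4) word_class_Nil[OF 0(1)] that] by linarith
  qed (use cont_diff_bounded_continuous[OF 0(3)] cont_diff_bounded_continuous[OF 0(4)] 0(2) in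
      \<open>force intro!: continuous_intros\<close>)+
next
  case (Suc n)
  show ?case
  proof (rule cont_diff_boundedI[OF Suc(2)])
    show "\<bar>f x + g x\<bar> \<le> A + B" if "x \<in> interior X" for x
      using cont_diff_bounded_abs_le[OF Suc(4) word_class_Nil[OF Suc(2)] that]
        cont_diff_bounded_abs_le[OF Suc(5) word_class_Nil[OF Suc(2)] that] by linarith
    fix b assume b: "[b] \<in> W"
    obtain f' where f': "\<And>x. x \<in> interior X \<Longrightarrow> has_dir_derivative f b (f' x) x" "cont_diff_bounded (after W b) X A f'"
      using cont_diff_bounded_derivative[OF Suc(4) b] by blast
    obtain g' where g': "\<And>x. x \<in> interior X \<Longrightarrow> has_dir_derivative g b (g' x) x" "cont_diff_bounded (after W b) X B g'"
      using cont_diff_bounded_derivative[OF Suc(5) b] by blast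
    have c: "cont_diff_bounded (after W b) X (A + B) (\<lambda>x. f' x + g' x)"
      by (rule Suc.IH[OF word_class_after(1)[OF Suc(2) b] after_length[OF Suc(3)] f'(2) g'(2)])
    have d: "has_dir_derivative (\<lambda>x. f x + g x) b (f' x + g' x) x" if "x \<in> interior X" for x
      by (rule DERIV_add[OF f'(1)[OF that] g'(1)[OF that]])
    show "\<exists>h. (\<forall>x\<in>interior X. has_dir_derivative (\<lambda>x. f x + g x) b (h x) x) \<and>
        cont_diff_bounded (after W b) X (A + B) h"
      by (intro exI[of _ "\<lambda>x. f' x + g' x"] conjI ballI c d)
  qed (intro continuous_intros cont_diff_bounded_continuous[OF Suc(4)] cont_diff_bounded_continuous[OF Suc(5)])
qed

text \<open>Each application of the product rule doubles the number of terms, whence the factor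
  \<open>2 ^ n\<close>.\<close>

lemma cont_diff_bounded_mult:
  assumes "word_class W" "\<And>w. w \<in> W \<Longrightarrow> length w \<le> n" "cont_diff_bounded W X A f" "cont_diff_bounded W X B g"
    "A \<ge> 0" "B \<ge> 0"
  shows "cont_diff_bounded W X (2 ^ n * A * B) (\<lambda>x. f x * g x)"
  using assms
proof (induction n arbitrary: W f g)
  case 0
  show ?case
  proof (rule cont_diff_boundedI[OF 0(1)])
    show "\<bar>f x * g x\<bar> \<le> 2 ^ 0 * A * B" if "x \<in> interior X" for x
      using cont_diff_bounded_abs_le[OF 0(3) word_class_Nil[OF 0(1)] that]
        cont_diff_bounded_abs_le[OF 0(4) word_class_Nil[OF 0(1)] that] by (simp add: abs_mult mult_mono)
  qed (use cont_diff_bounded_continuous[OF 0(3)] cont_diff_bounded_continuous[OF 0(4)] 0(2) in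
      \<open>force intro!: continuous_intros\<close>)+
next
  case (Suc n)
  show ?case
  proof (rule cont_diff_boundedI[OF Suc(2)])
    show "\<bar>f x * g x\<bar> \<le> 2 ^ Suc n * A * B" if "x \<in> interior X" for x
    proof -
      have "\<bar>f x * g x\<bar> \<le> 1 * (A * B)"
        using cont_diff_bounded_abs_le[OF Suc(4) word_class_Nil[OF Suc(2)] that]
          cont_diff_bounded_abs_le[OF Suc(5) word_class_Nil[OF Suc(2)] that] by (simp add: abs_mult mult_mono)
      also have "\<dots> \<le> 2 ^ Suc n * (A * B)" using Suc.prems(5,6) one_le_power[of "2::real" "Suc n"] by (intro mult_right_mono) auto
      finally show ?thesis by (simp only: mult.assoc)
    qed
    fix b assume b: "[b] \<in> W"
    note W' = word_class_after[OF Suc(2) b]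
    obtain f' where f': "\<And>x. x \<in> interior X \<Longrightarrow> has_dir_derivative f b (f' x) x" "cont_diff_bounded (after W b) X A f'"
      using cont_diff_bounded_derivative[OF Suc(4) b] by blast
    obtain g' where g': "\<And>x. x \<in> interior X \<Longrightarrow> has_dir_derivative g b (g' x) x" "cont_diff_bounded (after W b) X B g'"
      using cont_diff_bounded_derivative[OF Suc(5) b] by blast
    have len: "length w \<le> n" if "w \<in> after W b" for w using after_length[OF Suc(3) that] .
    have "cont_diff_bounded (after W b) X (2 ^ n * A * B) (\<lambda>x. f' x * g x)"
      by (rule Suc.IH[OF W'(1) len f'(2) cont_diff_bounded_mono[OF Suc(5) W'(2) order_refl] Suc(6,7)])
    moreover have "cont_diff_bounded (after W b) X (2 ^ n * A * B) (\<lambda>x. g' x * f x)"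
      using Suc.IH[OF W'(1) len cont_diff_bounded_mono[OF Suc(4) W'(2) order_refl] g'(2) Suc(6,7)]
      by (simp add: mult.commute)
    ultimately have "cont_diff_bounded (after W b) X (2 ^ n * A * B + 2 ^ n * A * B) (\<lambda>x. f' x * g x + g' x * f x)"
      by (rule cont_diff_bounded_add[OF W'(1) len, rotated])
    moreover have "2 ^ n * A * B + 2 ^ n * A * B = 2 ^ Suc n * A * B" by simp
    ultimately have c: "cont_diff_bounded (after W b) X (2 ^ Suc n * A * B) (\<lambda>x. f' x * g x + g' x * f x)"
      by (simp only:)
    have d: "has_dir_derivative (\<lambda>x. f x * g x) b (f' x * g x + g' x * f x) x" if "x \<in> interior X" for x
      using DERIV_mult[OF f'(1)[OF that] g'(1)[OF that]] by simp
    show "\<exists>h. (\<forall>x\<in>interior X. has_dir_derivative (\<lambda>x. f x * g x) b (h x) x) \<and>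
        cont_diff_bounded (after W b) X (2 ^ Suc n * A * B) h"
      by (intro exI[of _ "\<lambda>x. f' x * g x + g' x * f x"] conjI ballI c d)
  qed (intro continuous_intros cont_diff_bounded_continuous[OF Suc(4)] cont_diff_bounded_continuous[OF Suc(5)])
qed

text \<open>The derivative \<open>exp g * g'\<close> contains \<open>exp g\<close> again, but for
  shorter words, so the bound for \<open>Suc n\<close> comes from that for \<open>n\<close>.\<close>

lemma cont_diff_bounded_exp:
  assumes A: "A \<ge> 0"
  obtains B where "B \<ge> 0" "\<And>W g. \<lbrakk>word_class W; \<And>w. w \<in> W \<Longrightarrow> length w \<le> n; cont_diff_bounded W X A g\<rbrakk>
    \<Longrightarrow> cont_diff_bounded W X B (\<lambda>x. exp (g x))"
proof -
  have "\<exists>B\<ge>0. \<forall>W g. word_class W \<and> (\<forall>w\<in>W. length w \<le> n) \<and> cont_diff_bounded W X A g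
    \<longrightarrow> cont_diff_bounded W X B (\<lambda>x. exp (g x))"
  proof (induction n)
    case 0
    have "cont_diff_bounded W X (exp A) (\<lambda>x. exp (g x))"
      if W: "word_class W" "\<forall>w\<in>W. length w \<le> 0" and g: "cont_diff_bounded W X A g" for W g
    proof (rule cont_diff_boundedI[OF W(1)])
      show "\<bar>exp (g x)\<bar> \<le> exp A" if "x \<in> interior X" for x
        using cont_diff_bounded_abs_le[OF g word_class_Nil[OF W(1)] that] by simp
    qed (use cont_diff_bounded_continuous[OF g] W(2) in \<open>force intro!: continuous_intros\<close>)+
    then show ?case by (intro exI[of _ "exp A"]) auto
  next
    case (Suc n)
    then obtain C where C: "C \<ge> 0" "\<And>W g. \<lbrakk>word_class W; \<forall>w\<in>W. length w \<le> n; cont_diff_bounded W X A g\<rbrakk>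
      \<Longrightarrow> cont_diff_bounded W X C (\<lambda>x. exp (g x))" by blast
    \<comment> \<open>The first entry bounds \<open>exp g\<close> itself, the second the derivatives
      of order at least one, as derivatives of \<open>exp g * g'\<close>.\<close>
    define B where "B = max (exp A) (2 ^ n * C * A)"
    have "cont_diff_bounded W X B (\<lambda>x. exp (g x))"
      if W: "word_class W" "\<forall>w\<in>W. length w \<le> Suc n" and g: "cont_diff_bounded W X A g" for W g
    proof (rule cont_diff_boundedI[OF W(1)])
      show "\<bar>exp (g x)\<bar> \<le> B" if "x \<in> interior X" for x
        using abs_le_D1[OF cont_diff_bounded_abs_le[OF g word_class_Nil[OF W(1)] that]] by (simp add: B_def le_max_iff_disj)
      fix b assume b: "[b] \<in> W"
      note W' = word_class_after[OF W(1) b]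
      have len: "length w \<le> n" if "w \<in> after W b" for w using after_length[OF _ that] W(2) by blast
      obtain g' where g': "\<And>x. x \<in> interior X \<Longrightarrow> has_dir_derivative g b (g' x) x" "cont_diff_bounded (after W b) X A g'"
        using cont_diff_bounded_derivative[OF g b] by blast
      have "cont_diff_bounded (after W b) X C (\<lambda>x. exp (g x))"
        using len by (intro C(2) W'(1) cont_diff_bounded_mono[OF g W'(2) order_refl]) auto
      from cont_diff_bounded_mult[OF W'(1) len this g'(2) C(1) A]
      have "cont_diff_bounded (after W b) X (2 ^ n * C * A) (\<lambda>x. exp (g x) * g' x)" .
      then have c: "cont_diff_bounded (after W b) X B (\<lambda>x. exp (g x) * g' x)"
        by (rule cont_diff_bounded_mono) (simp_all add: B_def)
      have d: "has_dir_derivative (\<lambda>x. exp (g x)) b (exp (g x) * g' x) x" if "x \<in> interior X" for x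
        using DERIV_fun_exp[OF g'(1)[OF that]] by simp
      show "\<exists>h. (\<forall>x\<in>interior X. has_dir_derivative (\<lambda>x. exp (g x)) b (h x) x) \<and>
        cont_diff_bounded (after W b) X B h"
      by (intro exI[of _ "\<lambda>x. exp (g x) * g' x"] conjI ballI c d)
    qed (intro continuous_intros cont_diff_bounded_continuous[OF g])
    then show ?case by (intro exI[of _ B]) (auto simp: B_def le_max_iff_disj)
  qed
  then show thesis using that by blast
qed

text \<open>\<open>B\<close> depends on \<open>g\<close> only through \<open>A\<close> and
  \<open>\<kappa>\<close>. The denominators change along the path, and this uniformity is what
  yields one Lipschitz constant.\<close>

lemma cont_diff_bounded_inverse:
  fixes \<kappa> :: real
  assumes A: "A \<ge> 0" and \<kappa>: "\<kappa> > 0"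
  obtains B where "B \<ge> 0" "\<And>W g. \<lbrakk>word_class W; \<And>w. w \<in> W \<Longrightarrow> length w \<le> n; cont_diff_bounded W X A g;
    \<And>x. x \<in> X \<Longrightarrow> \<kappa> \<le> g x\<rbrakk> \<Longrightarrow> cont_diff_bounded W X B (\<lambda>x. 1 / g x)"
proof -
  have bd: "\<bar>1 / g x\<bar> \<le> 1 / \<kappa>" and nz: "g x \<noteq> 0" if "\<forall>x\<in>X. \<kappa> \<le> g x" "x \<in> X" for g :: "'a \<Rightarrow> real" and x
  proof -
    have "\<kappa> \<le> g x" using that by blast
    then show "\<bar>1 / g x\<bar> \<le> 1 / \<kappa>" "g x \<noteq> 0" using \<kappa> by (simp_all add: frac_le)
  qed
  have "\<exists>B\<ge>0. \<forall>W g. word_class W \<and> (\<forall>w\<in>W. length w \<le> n) \<and> cont_diff_bounded W X A g \<and> (\<forall>x\<in>X. \<kappa> \<le> g x)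
    \<longrightarrow> cont_diff_bounded W X B (\<lambda>x. 1 / g x)"
  proof (induction n)
    case 0
    have "cont_diff_bounded W X (1 / \<kappa>) (\<lambda>x. 1 / g x)"
      if W: "word_class W" "\<forall>w\<in>W. length w \<le> 0" and g: "cont_diff_bounded W X A g" and ge: "\<forall>x\<in>X. \<kappa> \<le> g x" for W g
    proof (rule cont_diff_boundedI[OF W(1)])
      show "\<bar>1 / g x\<bar> \<le> 1 / \<kappa>" if "x \<in> interior X" for x
        using bd[OF ge] that interior_subset by blast
      show "continuous_on X (\<lambda>x. 1 / g x)"
        using nz[OF ge] by (intro continuous_intros cont_diff_bounded_continuous[OF g]) auto
    qed (use W(2) in force)
    then show ?case using \<kappa> by (intro exI[of _ "1 / \<kappa>"]) auto
  next
    case (Suc n)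
    then obtain C where C: "C \<ge> 0" "\<And>W g. \<lbrakk>word_class W; \<forall>w\<in>W. length w \<le> n; cont_diff_bounded W X A g; \<forall>x\<in>X. \<kappa> \<le> g x\<rbrakk>
      \<Longrightarrow> cont_diff_bounded W X C (\<lambda>x. 1 / g x)" by blast
    \<comment> \<open>The derivative is \<open>- (1 / g) * (1 / g) * g'\<close>; its two products
      account for the two factors \<open>2 ^ n\<close>.\<close>
    define B where "B = max (1 / \<kappa>) (2 ^ n * (2 ^ n * C * C) * A)"
    have "cont_diff_bounded W X B (\<lambda>x. 1 / g x)"
      if W: "word_class W" "\<forall>w\<in>W. length w \<le> Suc n" and g: "cont_diff_bounded W X A g" and ge: "\<forall>x\<in>X. \<kappa> \<le> g x" for W g
    proof (rule cont_diff_boundedI[OF W(1)])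
      show "\<bar>1 / g x\<bar> \<le> B" if "x \<in> interior X" for x
      proof -
        have "x \<in> X" using that interior_subset by blast
        then have "\<bar>1 / g x\<bar> \<le> 1 / \<kappa>" by (rule bd[OF ge])
        then show ?thesis unfolding B_def by (rule order_trans[OF _ max.cobounded1])
      qed
      show "continuous_on X (\<lambda>x. 1 / g x)"
        using nz[OF ge] by (intro continuous_intros cont_diff_bounded_continuous[OF g]) auto
      fix b assume b: "[b] \<in> W"
      note W' = word_class_after[OF W(1) b]
      have len: "length w \<le> n" if "w \<in> after W b" for w using after_length[OF _ that] W(2) by blast
      obtain g' where g': "\<And>x. x \<in> interior X \<Longrightarrow> has_dir_derivative g b (g' x) x" "cont_diff_bounded (after W b) X A g'"
        using cont_diff_bounded_derivative[OF g b] by blast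
      have i: "cont_diff_bounded (after W b) X C (\<lambda>x. 1 / g x)"
        using len ge by (intro C(2) W'(1) cont_diff_bounded_mono[OF g W'(2) order_refl]) auto
      have CC: "0 \<le> 2 ^ n * C * C" using C(1) by simp
      from cont_diff_bounded_mult[OF W'(1) len cont_diff_bounded_mult[OF W'(1) len i i C(1) C(1)] g'(2) CC A]
      have "cont_diff_bounded (after W b) X (2 ^ n * (2 ^ n * C * C) * A) (\<lambda>x. 1 / g x * (1 / g x) * g' x)" .
      from cont_diff_bounded_cmult[OF W'(1) len this, where r = "-1"]
      have "cont_diff_bounded (after W b) X (2 ^ n * (2 ^ n * C * C) * A) (\<lambda>x. - (1 / g x * (1 / g x) * g' x))" by simp
      then have c: "cont_diff_bounded (after W b) X B (\<lambda>x. - (1 / g x * (1 / g x) * g' x))"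
        by (rule cont_diff_bounded_mono) (simp_all add: B_def)
      have d: "has_dir_derivative (\<lambda>x. 1 / g x) b (- (1 / g x * (1 / g x) * g' x)) x" if x: "x \<in> interior X" for x
      proof -
        have "g (x + 0 *\<^sub>R b) \<noteq> 0" using nz[OF ge, of x] x interior_subset[of X] by auto
        from DERIV_inverse_fun[OF g'(1)[OF x] this] show ?thesis
          by (simp add: inverse_eq_divide field_simps)
      qed
      show "\<exists>h. (\<forall>x\<in>interior X. has_dir_derivative (\<lambda>x. 1 / g x) b (h x) x) \<and>
        cont_diff_bounded (after W b) X B h"
      by (intro exI[of _ "\<lambda>x. - (1 / g x * (1 / g x) * g' x)"] conjI ballI c d)
    qed
    then show ?case using \<kappa> by (intro exI[of _ B]) (auto simp: B_def le_max_iff_disj)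
  qed
  then show thesis using that by blast
qed

text \<open>The series of derivatives has the same majorant \<open>a\<close> as the original one, so
  it converges uniformly and may be differentiated term by term along short segments in the
  interior.\<close>

lemma cont_diff_bounded_suminf:
  fixes f :: "nat \<Rightarrow> 'a::euclidean_space \<Rightarrow> real"
  assumes X: "closure (interior X) = X" and a: "summable a"
    and "word_class W" "\<And>w. w \<in> W \<Longrightarrow> length w \<le> n" "\<And>i. cont_diff_bounded W X (a i) (f i)"
  shows "cont_diff_bounded W X (\<Sum>i. a i) (\<lambda>x. \<Sum>i. f i x)"
  using assms(3-)
proof (induction n arbitrary: W f rule: less_induct)
  case (less n)
  note W = less.prems(1) and len = less.prems(2) and f = less.prems(3)
  have le: "norm (f i x) \<le> a i" if "x \<in> X" for i x
    using cont_diff_bounded_abs_le_closure[OF f word_class_Nil[OF W] X that] by simp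
  show ?case
  proof (rule cont_diff_boundedI[OF W])
    have "uniform_limit X (\<lambda>n x. \<Sum>i<n. f i x) (\<lambda>x. \<Sum>i. f i x) sequentially"
      using le a by (intro Weierstrass_m_test)
    then show "continuous_on X (\<lambda>x. \<Sum>i. f i x)"
      by (rule uniform_limit_theorem[rotated])
        (auto intro!: always_eventually continuous_intros cont_diff_bounded_continuous[OF f])
    show "\<bar>\<Sum>i. f i x\<bar> \<le> (\<Sum>i. a i)" if "x \<in> interior X" for x
      using norm_suminf_le[OF le a] that interior_subset by force
    fix b assume b: "[b] \<in> W"
    note W' = word_class_after[OF W b]
    have n: "n \<noteq> 0" using len[OF b] by auto
    then obtain k where k: "n = Suc k" by (cases n) auto
    have len': "length w \<le> k" if "w \<in> after W b" for w using after_length[OF _ that] len k by blast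
    have "\<forall>i. \<exists>g. (\<forall>x\<in>interior X. has_dir_derivative (f i) b (g x) x) \<and> cont_diff_bounded (after W b) X (a i) g"
      using cont_diff_bounded_derivative[OF f b] by metis
    then obtain g where g: "\<And>i x. x \<in> interior X \<Longrightarrow> has_dir_derivative (f i) b (g i x) x"
      "\<And>i. cont_diff_bounded (after W b) X (a i) (g i)" by metis
    have gle: "norm (g i x) \<le> a i" if "x \<in> interior X" for i x
      using cont_diff_bounded_abs_le[OF g(2) word_class_Nil[OF W'(1)] that] by simp
    have c: "cont_diff_bounded (after W b) X (\<Sum>i. a i) (\<lambda>x. \<Sum>i. g i x)"
      using k by (intro less.IH[of k] W'(1) len' g(2)) auto
    have d: "has_dir_derivative (\<lambda>x. \<Sum>i. f i x) b (\<Sum>i. g i x) x" if x: "x \<in> interior X" for x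
    proof -
      obtain e where e: "e > 0" "\<And>t. \<bar>t\<bar> < e \<Longrightarrow> x + t *\<^sub>R b \<in> interior X"
        using eventually_line_in_open[OF open_interior x, of b] unfolding eventually_nhds_metric
        by (auto simp: dist_real_def)
      have "((\<lambda>t. \<Sum>i. f i (x + t *\<^sub>R b)) has_real_derivative (\<Sum>i. g i (x + 0 *\<^sub>R b))) (at 0)"
      proof (rule has_field_derivative_series'(2)[of "ball 0 e" _ _ 0])
        fix i and t :: real assume "t \<in> ball 0 e"
        then have xt: "x + t *\<^sub>R b \<in> interior X" using e(2) by (simp add: dist_real_def)
        show "((\<lambda>t. f i (x + t *\<^sub>R b)) has_real_derivative g i (x + t *\<^sub>R b)) (at t within ball 0 e)"
          by (rule has_field_derivative_at_within[OF has_dir_derivative_shift[OF g(1)[OF xt]]])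
      next
        show "uniformly_convergent_on (ball 0 e) (\<lambda>n t. \<Sum>i<n. g i (x + t *\<^sub>R b))"
          using e(2) by (intro Weierstrass_m_test'[OF _ a] gle) (simp add: dist_real_def)
        show "summable (\<lambda>i. f i (x + 0 *\<^sub>R b))"
          using le[of x] x interior_subset by (intro summable_comparison_test'[OF a, of 0]) auto
      qed (use e(1) in \<open>auto simp: interior_open\<close>)
      then show ?thesis by simp
    qed
    show "\<exists>h. (\<forall>x\<in>interior X. has_dir_derivative (\<lambda>x. \<Sum>i. f i x) b (h x) x) \<and>
        cont_diff_bounded (after W b) X (\<Sum>i. a i) h"
      by (intro exI[of _ "\<lambda>x. \<Sum>i. g i x"] conjI ballI c d)
  qed
qed

section \<open>The classes C^m and C^(m,m), and completeness of C^m\<close>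

lemma set_subseq_mono: "subseq v w \<Longrightarrow> set v \<subseteq> set w"
  by (induction rule: list_emb.induct) auto

lemma word_class_Cm_words: "word_class (Cm_words m :: 'a::euclidean_space list set)"
  unfolding word_class_def Cm_words_def
  by (auto dest: list_emb_length intro: order_trans dest: set_subseq_mono)

lemma word_class_Cmm_words: "word_class (Cmm_words m :: ('a::euclidean_space \<times> 'a) list set)"
  unfolding word_class_def Cmm_words_def
proof (intro conjI ballI allI impI CollectI)
  fix v w :: "('a \<times> 'a) list"
  assume w: "w \<in> {bs. set bs \<subseteq> Basis \<and> length (filter (\<lambda>b. snd b = 0) bs) \<le> m \<and> length (filter (\<lambda>b. fst b = 0) bs) \<le> m}"
    and v: "subseq v w"
  show "set v \<subseteq> Basis" using set_subseq_mono[OF v] w by auto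
  have "length (filter P v) \<le> length (filter P w)" for P
    using list_emb_length[OF subseq_filter[OF v]] .
  then show "length (filter (\<lambda>b. snd b = 0) v) \<le> m" "length (filter (\<lambda>b. fst b = 0) v) \<le> m"
    using w by (auto intro: order_trans)
qed auto

lemma Cm_words_length: "w \<in> Cm_words m \<Longrightarrow> length w \<le> m"
  by (simp add: Cm_words_def)

text \<open>Every basis vector of the product has a zero component, so each letter is counted by one
  of the two filters.\<close>

lemma Cmm_words_length:
  fixes w :: "('a::euclidean_space \<times> 'a) list"
  assumes "w \<in> Cmm_words m"
  shows "length w \<le> 2 * m"
proof -
  have "length w \<le> length (filter (\<lambda>b. snd b = 0) w) + length (filter (\<lambda>b. fst b = 0) w)"
    if "set w \<subseteq> Basis" for w :: "('a \<times> 'a) list"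
    using that by (induction w) (auto simp: Basis_prod_def)
  then show ?thesis using assms unfolding Cmm_words_def by fastforce
qed

lemma finite_Cm_words: "finite (Cm_words m :: 'a::euclidean_space list set)"
  unfolding Cm_words_def by (rule finite_lists_length_le[OF finite_Basis])

lemma finite_Cmm_words: "finite (Cmm_words m :: ('a::euclidean_space \<times> 'a) list set)"
  by (rule finite_subset[OF _ finite_lists_length_le[OF finite_Basis, of "2 * m"]])
    (use Cmm_words_length in \<open>auto simp: Cmm_words_def\<close>)

text \<open>Each listed derivative extends continuously to the compact set \<open>X\<close> and is
  therefore bounded; finitely many bounds are added up.\<close>

lemma cont_diff_on_imp_bounded:
  assumes X: "compact X" and W: "finite W" and f: "cont_diff_on W X f"
  obtains A where "A \<ge> 0" "cont_diff_bounded W X A f"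
proof -
  have "\<exists>B. \<forall>x\<in>interior X. \<bar>partials bs f x\<bar> \<le> B" if w: "bs \<in> W" for bs
  proof -
    obtain g where g: "continuous_on X g" "\<And>x. x \<in> interior X \<Longrightarrow> g x = partials bs f x"
      using f w unfolding cont_diff_on_def by blast
    have "bounded (g ` X)" by (intro compact_imp_bounded compact_continuous_image g X)
    then obtain B where "\<And>x. x \<in> X \<Longrightarrow> norm (g x) \<le> B" unfolding bounded_iff by blast
    then have "\<bar>partials bs f x\<bar> \<le> B" if "x \<in> interior X" for x
      using g(2)[OF that] that interior_subset by fastforce
    then show ?thesis by blast
  qed
  then obtain B where B: "\<And>bs x. bs \<in> W \<Longrightarrow> x \<in> interior X \<Longrightarrow> \<bar>partials bs f x\<bar> \<le> B bs" by metis
  have "\<bar>partials bs f x\<bar> \<le> (\<Sum>bs\<in>W. \<bar>B bs\<bar>)" if "bs \<in> W" "x \<in> interior X" for bs x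
    using B[OF that] member_le_sum[OF that(1), of "\<lambda>bs. \<bar>B bs\<bar>"] W by fastforce
  then have "cont_diff_bounded W X (\<Sum>bs\<in>W. \<bar>B bs\<bar>) f" using f by (simp add: cont_diff_bounded_def)
  then show thesis by (rule that[rotated]) (simp add: sum_nonneg)
qed

lemma cont_diff_bounded_Cm_norm:
  assumes X: "compact X" and \<phi>: "\<phi> \<in> Cm_space m X"
  shows "cont_diff_bounded (Cm_words m) X (Cm_norm m X \<phi>) \<phi>"
proof -
  have c: "cont_diff_on (Cm_words m) X \<phi>" using \<phi> by (simp add: Cm_space_def)
  obtain A where A: "cont_diff_bounded (Cm_words m) X A \<phi>"
    using cont_diff_on_imp_bounded[OF X finite_Cm_words c] by blast
  \<comment> \<open>A supremum of reals is informative only for sets bounded above, so some bound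
    \<open>A\<close> comes before the norm.\<close>
  have "bdd_above ((\<lambda>(bs, x). \<bar>partials bs \<phi> x\<bar>) ` (Cm_words m \<times> interior X))"
    using A by (intro bdd_aboveI2[of _ _ A]) (auto simp: cont_diff_bounded_def)
  then have "\<bar>partials bs \<phi> x\<bar> \<le> Cm_norm m X \<phi>" if "bs \<in> Cm_words m" "x \<in> interior X" for bs x
    unfolding Cm_norm_def using cSUP_upper[of "(bs, x)" "Cm_words m \<times> interior X" "\<lambda>(bs, x). \<bar>partials bs \<phi> x\<bar>"] that by auto
  then show ?thesis using c by (simp add: cont_diff_bounded_def)
qed

lemma Cm_norm_le:
  assumes "interior X \<noteq> {}" "cont_diff_bounded (Cm_words m) X B \<phi>"
  shows "Cm_norm m X \<phi> \<le> B"
  unfolding Cm_norm_def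
proof (rule cSUP_least)
  show "Cm_words m \<times> interior X \<noteq> {}" using assms(1) word_class_Nil[OF word_class_Cm_words] by blast
qed (use assms(2) in \<open>auto simp: cont_diff_bounded_def\<close>)

lemma cont_diff_bounded_imp_Cm_space: "cont_diff_bounded (Cm_words m) X B \<phi> \<Longrightarrow> \<phi> \<in> Cm_space m X"
  by (simp add: cont_diff_bounded_def Cm_space_def)

lemma complete_seminormed_functions_Cm_space:
  fixes X :: "'a::euclidean_space set"
  assumes X: "compact X" "interior X \<noteq> {}" "closure (interior X) = X"
  shows "complete_seminormed_functions (Cm_space m X) (Cm_norm m X)"
proof -
  note W = word_class_Cm_words[of m] and len = Cm_words_length[of _ m]
  note bd = cont_diff_bounded_Cm_norm[OF X(1)] and le = Cm_norm_le[OF X(2)] and mem = cont_diff_bounded_imp_Cm_space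
  have scale: "(\<lambda>x. r * \<phi> x) \<in> Cm_space m X \<and> Cm_norm m X (\<lambda>x. r * \<phi> x) \<le> \<bar>r\<bar> * Cm_norm m X \<phi>"
    if "\<phi> \<in> Cm_space m X" for r \<phi>
    using cont_diff_bounded_cmult[OF W len bd[OF that], of r] le mem by blast
  have add: "(\<lambda>x. \<phi> x + \<psi> x) \<in> Cm_space m X \<and> Cm_norm m X (\<lambda>x. \<phi> x + \<psi> x) \<le> Cm_norm m X \<phi> + Cm_norm m X \<psi>"
    if "\<phi> \<in> Cm_space m X" "\<psi> \<in> Cm_space m X" for \<phi> \<psi>
    using cont_diff_bounded_add[OF W len bd[OF that(1)] bd[OF that(2)]] le mem by blast
  have nonneg: "0 \<le> Cm_norm m X \<phi>" if "\<phi> \<in> Cm_space m X" for \<phi>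
  proof -
    obtain x where "x \<in> interior X" using X(2) by blast
    from cont_diff_bounded_abs_le[OF bd[OF that] word_class_Nil[OF W] this] show ?thesis by linarith
  qed
  have zero: "cont_diff_bounded (Cm_words m) X 0 (\<lambda>x::'a. 0)"
  proof -
    have p: "partials bs (\<lambda>x::'a. 0) = (\<lambda>x. 0)" for bs by (induction bs) simp_all
    show ?thesis unfolding cont_diff_bounded_def cont_diff_on_def p by (auto intro!: exI[of _ "\<lambda>x. 0"])
  qed
  \<comment> \<open>\<open>scale\<close> gives one inequality; scaling back by \<open>1 / r\<close>
    gives the other.\<close>
  have eq: "Cm_norm m X (\<lambda>x. r * \<phi> x) = \<bar>r\<bar> * Cm_norm m X \<phi>" if \<phi>: "\<phi> \<in> Cm_space m X" for r \<phi>
  proof (cases "r = 0")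
    case True
    then show ?thesis using le[OF zero] nonneg[OF mem[OF zero]] by simp
  next
    case False
    have "Cm_norm m X (\<lambda>x. (1 / r) * (r * \<phi> x)) \<le> \<bar>1 / r\<bar> * Cm_norm m X (\<lambda>x. r * \<phi> x)"
      using scale[of "\<lambda>x. r * \<phi> x" "1 / r"] scale[OF \<phi>, of r] by blast
    then have "\<bar>r\<bar> * Cm_norm m X \<phi> \<le> Cm_norm m X (\<lambda>x. r * \<phi> x)"
      using False by (simp add: pos_le_divide_eq mult.commute)
    then show ?thesis using scale[OF \<phi>, of r] by linarith
  qed
  interpret seminormed_functions "Cm_space m X" "Cm_norm m X"
    by unfold_locales (use mem[OF zero] scale add nonneg eq in blast)+
  show ?thesis
  proof
    fix f :: "nat \<Rightarrow> 'a \<Rightarrow> real"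
    assume f: "\<And>n. f n \<in> Cm_space m X" and sm: "summable (\<lambda>n. Cm_norm m X (f n))"
    define F where "F x = (\<Sum>n. f n x)" for x
    have "cont_diff_bounded (Cm_words m) X (\<Sum>i. Cm_norm m X (f i)) F"
      unfolding F_def by (rule cont_diff_bounded_suminf[OF X(3) sm W len bd[OF f]])
    then have "F \<in> Cm_space m X" by (rule mem)
    moreover have "Cm_norm m X (\<lambda>x. F x - (\<Sum>i<n. f i x)) \<le> (\<Sum>i. Cm_norm m X (f (i + n)))" for n
    \<comment> \<open>The remainder equals the tail series only on \<open>X\<close>, since
      convergence is known only there; the predicate does not see other points.\<close>
    proof (rule le, rule cont_diff_bounded_cong)
      show "cont_diff_bounded (Cm_words m) X (\<Sum>i. Cm_norm m X (f (i + n))) (\<lambda>x. \<Sum>i. f (i + n) x)"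
        by (rule cont_diff_bounded_suminf[OF X(3) summable_ignore_initial_segment[OF sm] W len bd[OF f]])
      fix x assume x: "x \<in> X"
      have "norm (f i x) \<le> Cm_norm m X (f i)" for i
        using cont_diff_bounded_abs_le_closure[OF bd[OF f] word_class_Nil[OF W] X(3) x] by simp
      then have "summable (\<lambda>i. f i x)" by (intro summable_comparison_test'[OF sm, of 0])
      then show "(\<Sum>i. f (i + n) x) = F x - (\<Sum>i<n. f i x)"
        unfolding F_def by (rule suminf_minus_initial_segment)
    qed
    ultimately show "\<exists>F\<in>Cm_space m X. \<forall>n. Cm_norm m X (\<lambda>x. F x - (\<Sum>i<n. f i x)) \<le> (\<Sum>i. Cm_norm m X (f (i + n)))"
      by blast
  qed
qed

section \<open>Derivatives of the feature map\<close>

lemma MVT_signed: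
  fixes \<phi> :: "real \<Rightarrow> real"
  assumes "\<And>r. \<bar>r\<bar> \<le> \<bar>t\<bar> \<Longrightarrow> (\<phi> has_real_derivative \<phi>' r) (at r)"
  shows "\<exists>r. \<bar>r\<bar> \<le> \<bar>t\<bar> \<and> \<phi> t - \<phi> 0 = t * \<phi>' r"
proof (cases t "0 :: real" rule: linorder_cases)
  case less
  then have "\<exists>z>t. z < 0 \<and> \<phi> 0 - \<phi> t = (0 - t) * \<phi>' z" by (intro MVT2 assms) auto
  then obtain z where "t < z" "z < 0" "\<phi> 0 - \<phi> t = (0 - t) * \<phi>' z" by blast
  then show ?thesis by (intro exI[of _ z]) (auto simp: algebra_simps)
next
  case greater
  then have "\<exists>z>0. z < t \<and> \<phi> t - \<phi> 0 = (t - 0) * \<phi>' z" by (intro MVT2 assms) auto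
  then obtain z where "0 < z" "z < t" "\<phi> t - \<phi> 0 = (t - 0) * \<phi>' z" by blast
  then show ?thesis by (intro exI[of _ z]) auto
qed auto

text \<open>The mean value theorem in the second variable, applied to a difference in the first, and
  then in the first variable. This order matches the derivatives \<open>G1\<close> and
  \<open>G2\<close> that are available.\<close>

lemma mixed_difference:
  fixes G G1 G2 :: "'a::euclidean_space \<times> 'a \<Rightarrow> real"
  assumes d1: "\<And>z. z \<in> I \<times> I \<Longrightarrow> has_dir_derivative G (0, b) (G1 z) z"
    and d2: "\<And>z. z \<in> I \<times> I \<Longrightarrow> has_dir_derivative G1 (b, 0) (G2 z) z"
    and x: "\<And>q. \<bar>q\<bar> \<le> \<bar>s\<bar> \<Longrightarrow> x + q *\<^sub>R b \<in> I" and y: "\<And>r. \<bar>r\<bar> \<le> \<bar>t\<bar> \<Longrightarrow> y + r *\<^sub>R b \<in> I"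
  obtains q r where "\<bar>q\<bar> \<le> \<bar>s\<bar>" "\<bar>r\<bar> \<le> \<bar>t\<bar>"
    "G (x + s *\<^sub>R b, y + t *\<^sub>R b) - G (x, y + t *\<^sub>R b) - (G (x + s *\<^sub>R b, y) - G (x, y))
      = t * (s * G2 (x + q *\<^sub>R b, y + r *\<^sub>R b))"
proof -
  have e1: "((\<lambda>r. G (u, y + r *\<^sub>R b)) has_real_derivative G1 (u, y + r *\<^sub>R b)) (at r)"
    if "u \<in> I" "\<bar>r\<bar> \<le> \<bar>t\<bar>" for u r
    using has_dir_derivative_shift[where f = G and b = "(0, b)" and x = "(u, y)" and t = r] d1[of "(u, y + r *\<^sub>R b)"] that y by simp
  have e2: "((\<lambda>q. G1 (x + q *\<^sub>R b, v)) has_real_derivative G2 (x + q *\<^sub>R b, v)) (at q)"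
    if "v \<in> I" "\<bar>q\<bar> \<le> \<bar>s\<bar>" for v q
    using has_dir_derivative_shift[where f = G1 and b = "(b, 0)" and x = "(x, v)" and t = q] d2[of "(x + q *\<^sub>R b, v)"] that x by simp
  have x0: "x \<in> I" using x[of 0] by simp
  obtain r where r: "\<bar>r\<bar> \<le> \<bar>t\<bar>"
    "(G (x + s *\<^sub>R b, y + t *\<^sub>R b) - G (x, y + t *\<^sub>R b)) - (G (x + s *\<^sub>R b, y + 0 *\<^sub>R b) - G (x, y + 0 *\<^sub>R b))
      = t * (G1 (x + s *\<^sub>R b, y + r *\<^sub>R b) - G1 (x, y + r *\<^sub>R b))"
    using MVT_signed[of t "\<lambda>r. G (x + s *\<^sub>R b, y + r *\<^sub>R b) - G (x, y + r *\<^sub>R b)"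
        "\<lambda>r. G1 (x + s *\<^sub>R b, y + r *\<^sub>R b) - G1 (x, y + r *\<^sub>R b)", OF DERIV_diff[OF e1 e1]] x[of s] x0
    by blast
  obtain q where q: "\<bar>q\<bar> \<le> \<bar>s\<bar>" "G1 (x + s *\<^sub>R b, y + r *\<^sub>R b) - G1 (x + 0 *\<^sub>R b, y + r *\<^sub>R b)
      = s * G2 (x + q *\<^sub>R b, y + r *\<^sub>R b)"
    using MVT_signed[of s "\<lambda>q. G1 (x + q *\<^sub>R b, y + r *\<^sub>R b)", OF e2[OF y[OF r(1)]]] by blast
  show thesis by (rule that[OF q(1) r(1)]) (use q(2) r(2) in simp)
qed

text \<open>The difference quotients of \<open>F\<close> are Cauchy because their inner products are mixed second difference quotients of \<open>G\<close>.\<close>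

lemma feature_derivative:
  fixes F :: "'a::euclidean_space \<Rightarrow> 'h::{real_inner, banach}" and G G1 G2 :: "'a \<times> 'a \<Rightarrow> real"
  assumes I: "open I"
    and FG: "\<And>x y. x \<in> I \<Longrightarrow> y \<in> I \<Longrightarrow> inner (F x) (F y) = G (x, y)"
    and d1: "\<And>z. z \<in> I \<times> I \<Longrightarrow> has_dir_derivative G (0, b) (G1 z) z"
    and d2: "\<And>z. z \<in> I \<times> I \<Longrightarrow> has_dir_derivative G1 (b, 0) (G2 z) z"
    and cont: "continuous_on (I \<times> I) G2"
  obtains F' where "\<And>x. x \<in> I \<Longrightarrow> ((\<lambda>t. (1 / t) *\<^sub>R (F (x + t *\<^sub>R b) - F x)) \<longlongrightarrow> F' x) (at 0)"
    "\<And>x y. x \<in> I \<Longrightarrow> y \<in> I \<Longrightarrow> inner (F' x) (F' y) = G2 (x, y)"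
proof -
  define \<Delta> where "\<Delta> t x = (1 / t) *\<^sub>R (F (x + t *\<^sub>R b) - F x)" for t x
  \<comment> \<open>The two increments \<open>s\<close> and \<open>t\<close> vary independently: the
    Cauchy property at one point needs the mixed inner products with \<open>s\<close> and
    \<open>t\<close> different.\<close>
  have claim: "\<exists>\<delta>>0. \<forall>s t. s \<noteq> 0 \<and> t \<noteq> 0 \<and> \<bar>s\<bar> < \<delta> \<and> \<bar>t\<bar> < \<delta> \<longrightarrow> \<bar>inner (\<Delta> s x) (\<Delta> t y) - G2 (x, y)\<bar> < e"
    if x: "x \<in> I" and y: "y \<in> I" and e: "e > 0" for x y e
  proof -
    let ?p = "\<lambda>p :: real \<times> real. (x + fst p *\<^sub>R b, y + snd p *\<^sub>R b)"
    have xy: "(x, y) \<in> I \<times> I" "open (I \<times> I)" using x y I by (auto intro: open_Times)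
    have "(?p \<longlongrightarrow> (x + fst (0 :: real \<times> real) *\<^sub>R b, y + snd (0 :: real \<times> real) *\<^sub>R b)) (nhds 0)"
      by (intro tendsto_intros filterlim_ident)
    then have lim: "(?p \<longlongrightarrow> (x, y)) (nhds 0)" by simp
    have "isCont G2 (x, y)" using cont xy by (simp add: continuous_on_eq_continuous_at)
    from isCont_tendsto_compose[OF this lim] e
    have "\<forall>\<^sub>F p in nhds 0. dist (G2 (?p p)) (G2 (x, y)) < e" by (rule tendstoD)
    moreover have "\<forall>\<^sub>F p in nhds 0. ?p p \<in> I \<times> I" by (rule topological_tendstoD[OF lim xy(2,1)])
    ultimately have "\<forall>\<^sub>F p in nhds 0. dist (G2 (?p p)) (G2 (x, y)) < e \<and> ?p p \<in> I \<times> I" by (rule eventually_conj)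
    then obtain d where d: "d > 0" "\<And>p. dist p 0 < d \<Longrightarrow> dist (G2 (?p p)) (G2 (x, y)) < e \<and> ?p p \<in> I \<times> I"
      unfolding eventually_nhds_metric by blast
    have small: "dist (G2 (x + q *\<^sub>R b, y + r *\<^sub>R b)) (G2 (x, y)) < e \<and> x + q *\<^sub>R b \<in> I \<and> y + r *\<^sub>R b \<in> I"
      if "\<bar>q\<bar> < d / 2" "\<bar>r\<bar> < d / 2" for q r
    proof -
      have "norm (q, r) \<le> \<bar>q\<bar> + \<bar>r\<bar>" using norm_Pair_le[of q r] by simp
      then show ?thesis using d(2)[of "(q, r)"] that by simp
    qed
    have "\<bar>inner (\<Delta> s x) (\<Delta> t y) - G2 (x, y)\<bar> < e"
      if st: "s \<noteq> 0" "t \<noteq> 0" "\<bar>s\<bar> < d / 2" "\<bar>t\<bar> < d / 2" for s t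
    proof -
      have in1: "x + q *\<^sub>R b \<in> I" if "\<bar>q\<bar> \<le> \<bar>s\<bar>" for q using small[of q 0] that st d(1) by simp
      have in2: "y + r *\<^sub>R b \<in> I" if "\<bar>r\<bar> \<le> \<bar>t\<bar>" for r using small[of 0 r] that st d(1) by simp
      obtain q r where qr: "\<bar>q\<bar> \<le> \<bar>s\<bar>" "\<bar>r\<bar> \<le> \<bar>t\<bar>"
        "G (x + s *\<^sub>R b, y + t *\<^sub>R b) - G (x, y + t *\<^sub>R b) - (G (x + s *\<^sub>R b, y) - G (x, y))
          = t * (s * G2 (x + q *\<^sub>R b, y + r *\<^sub>R b))"
        by (rule mixed_difference[OF d1 d2 in1 in2])
      have "inner (\<Delta> s x) (\<Delta> t y) = (1 / (s * t)) *
          (inner (F (x + s *\<^sub>R b)) (F (y + t *\<^sub>R b)) - inner (F x) (F (y + t *\<^sub>R b))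
            - (inner (F (x + s *\<^sub>R b)) (F y) - inner (F x) (F y)))"
        by (simp add: \<Delta>_def inner_diff_left inner_diff_right diff_divide_distrib)
      also have "\<dots> = (1 / (s * t)) * (t * (s * G2 (x + q *\<^sub>R b, y + r *\<^sub>R b)))"
        using x y in1[of s] in2[of t] by (simp only: FG qr(3)[symmetric] order_refl)
      also have "\<dots> = G2 (x + q *\<^sub>R b, y + r *\<^sub>R b)" using st by simp
      finally show ?thesis using small[of q r] qr st by (simp add: dist_real_def)
    qed
    then show ?thesis using d(1) by (intro exI[of _ "d / 2"]) auto
  qed
  have cauchy: "\<exists>\<delta>>0. \<forall>s t. s \<noteq> 0 \<and> t \<noteq> 0 \<and> \<bar>s\<bar> < \<delta> \<and> \<bar>t\<bar> < \<delta> \<longrightarrow> dist (\<Delta> s x) (\<Delta> t x) < e"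
    if x: "x \<in> I" and e: "e > 0" for x e
  proof -
    have "e\<^sup>2 / 4 > 0" using e by simp
    from claim[OF x x this] obtain \<delta> where \<delta>: "\<delta> > 0"
      "\<And>s t. \<lbrakk>s \<noteq> 0; t \<noteq> 0; \<bar>s\<bar> < \<delta>; \<bar>t\<bar> < \<delta>\<rbrakk> \<Longrightarrow> \<bar>inner (\<Delta> s x) (\<Delta> t x) - G2 (x, x)\<bar> < e\<^sup>2 / 4"
      by blast
    have "dist (\<Delta> s x) (\<Delta> t x) < e" if st: "s \<noteq> 0" "t \<noteq> 0" "\<bar>s\<bar> < \<delta>" "\<bar>t\<bar> < \<delta>" for s t
    proof (rule power2_less_imp_less)
      \<comment> \<open>All three inner products are close to the same number
        \<open>G2 (x, x)\<close>, which cancels; the coefficients 1, 2, 1 add up to 4, whence the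
        tolerance of a quarter.\<close>
      have "(dist (\<Delta> s x) (\<Delta> t x))\<^sup>2 = inner (\<Delta> s x) (\<Delta> s x) - 2 * inner (\<Delta> s x) (\<Delta> t x) + inner (\<Delta> t x) (\<Delta> t x)"
        by (simp add: dist_norm power2_norm_eq_inner inner_diff inner_commute)
      then show "(dist (\<Delta> s x) (\<Delta> t x))\<^sup>2 < e\<^sup>2"
        using \<delta>(2)[OF st(1,1,3,3)] \<delta>(2)[OF st] \<delta>(2)[OF st(2,2,4,4)] by linarith
    qed (use e in simp)
    then show ?thesis using \<delta>(1) by blast
  qed
  \<comment> \<open>A fixed null sequence produces the limit by completeness; the Cauchy estimate
    then extends convergence to all \<open>t\<close> tending to 0.\<close>
  define \<tau> where "\<tau> n = 1 / real (Suc n)" for n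
  have \<tau>: "\<tau> \<longlonglongrightarrow> 0" "\<And>n. \<tau> n \<noteq> 0"
    using LIMSEQ_inverse_real_of_nat by (simp_all add: \<tau>_def[abs_def] inverse_eq_divide)
  have \<tau>_small: "\<exists>N. \<forall>n\<ge>N. \<bar>\<tau> n\<bar> < \<delta>" if "\<delta> > 0" for \<delta>
    using tendstoD[OF \<tau>(1) that] by (simp add: eventually_sequentially)
  define F' where "F' x = lim (\<lambda>n. \<Delta> (\<tau> n) x)" for x
  have lim: "((\<lambda>t. \<Delta> t x) \<longlongrightarrow> F' x) (at 0)" if x: "x \<in> I" for x
  proof -
    have "Cauchy (\<lambda>n. \<Delta> (\<tau> n) x)"
      unfolding Cauchy_def
    proof (intro allI impI)
      fix e :: real assume "e > 0"
      from cauchy[OF x this] obtain \<delta> where \<delta>: "\<delta> > 0"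
        "\<And>s t. \<lbrakk>s \<noteq> 0; t \<noteq> 0; \<bar>s\<bar> < \<delta>; \<bar>t\<bar> < \<delta>\<rbrakk> \<Longrightarrow> dist (\<Delta> s x) (\<Delta> t x) < e" by blast
      obtain N where "\<And>n. n \<ge> N \<Longrightarrow> \<bar>\<tau> n\<bar> < \<delta>" using \<tau>_small[OF \<delta>(1)] by blast
      then show "\<exists>M. \<forall>m\<ge>M. \<forall>n\<ge>M. dist (\<Delta> (\<tau> m) x) (\<Delta> (\<tau> n) x) < e"
        using \<delta>(2) \<tau>(2) by blast
    qed
    then have seq: "(\<lambda>n. \<Delta> (\<tau> n) x) \<longlonglongrightarrow> F' x"
      unfolding F'_def by (simp add: Cauchy_convergent_iff convergent_LIMSEQ_iff)
    show ?thesis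
    proof (rule tendstoI)
      fix e :: real assume "e > 0"
      then have e2: "e / 2 > 0" by simp
      from cauchy[OF x this] obtain \<delta> where \<delta>: "\<delta> > 0"
        "\<And>s t. \<lbrakk>s \<noteq> 0; t \<noteq> 0; \<bar>s\<bar> < \<delta>; \<bar>t\<bar> < \<delta>\<rbrakk> \<Longrightarrow> dist (\<Delta> s x) (\<Delta> t x) < e / 2" by blast
      obtain N where N: "\<And>n. n \<ge> N \<Longrightarrow> \<bar>\<tau> n\<bar> < \<delta>" using \<tau>_small[OF \<delta>(1)] by blast
      obtain M where M: "\<And>n. n \<ge> M \<Longrightarrow> dist (\<Delta> (\<tau> n) x) (F' x) < e / 2"
        using tendstoD[OF seq e2] by (auto simp: eventually_sequentially)
      have "dist (\<Delta> t x) (F' x) < e" if "t \<noteq> 0" "\<bar>t\<bar> < \<delta>" for t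
        using \<delta>(2)[OF that(1) \<tau>(2) that(2) N[of "max N M"]] M[of "max N M"]
          dist_triangle[of "\<Delta> t x" "F' x" "\<Delta> (\<tau> (max N M)) x"] by simp
      then show "\<forall>\<^sub>F t in at 0. dist (\<Delta> t x) (F' x) < e"
        using \<delta>(1) unfolding eventually_at by (intro exI[of _ \<delta>]) (simp add: dist_real_def)
    qed
  qed
  have "inner (F' x) (F' y) = G2 (x, y)" if x: "x \<in> I" and y: "y \<in> I" for x y
  proof (rule tendsto_unique[of "at (0 :: real)"])
    show "((\<lambda>t. inner (\<Delta> t x) (\<Delta> t y)) \<longlongrightarrow> inner (F' x) (F' y)) (at 0)"
      by (intro tendsto_inner lim x y)
    show "((\<lambda>t. inner (\<Delta> t x) (\<Delta> t y)) \<longlongrightarrow> G2 (x, y)) (at 0)"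
    proof (rule tendstoI)
      fix e :: real assume "e > 0"
      from claim[OF x y this] obtain \<delta> where "\<delta> > 0"
        "\<And>t. \<lbrakk>t \<noteq> 0; \<bar>t\<bar> < \<delta>\<rbrakk> \<Longrightarrow> \<bar>inner (\<Delta> t x) (\<Delta> t y) - G2 (x, y)\<bar> < e" by blast
      then show "\<forall>\<^sub>F t in at 0. dist (inner (\<Delta> t x) (\<Delta> t y)) (G2 (x, y)) < e"
        unfolding eventually_at by (intro exI[of _ \<delta>]) (simp add: dist_real_def)
    qed
  qed simp
  then show thesis using lim unfolding \<Delta>_def by (intro that)
qed

text \<open>The kernel of the derivative of \<open>K\<close> along \<open>p\<close> is the kernel
  \<open>k\<close> differentiated along \<open>p\<close> in both variables. Each letter is doubled
  on the spot, second variable first, so that one more derivative of \<open>K\<close> adds one pair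
  in the order of \<open>feature_derivative\<close>.\<close>

primrec double_word :: "'a::zero list \<Rightarrow> ('a \<times> 'a) list" where
  "double_word [] = []"
| "double_word (b # p) = (b, 0) # (0, b) # double_word p"

lemma double_word_in_Cmm_words:
  fixes p :: "'a::euclidean_space list"
  shows "p \<in> Cm_words m \<Longrightarrow> double_word p \<in> Cmm_words m"
    "b # p \<in> Cm_words m \<Longrightarrow> (0, b) # double_word p \<in> Cmm_words m"
proof -
  have *: "set (double_word p) \<subseteq> Basis \<and> length (filter (\<lambda>b. snd b = 0) (double_word p)) = length p \<and>
      length (filter (\<lambda>b. fst b = 0) (double_word p)) = length p" if "set p \<subseteq> Basis" for p :: "'a list"
    using that by (induction p) (auto simp: Basis_prod_def)
  show "p \<in> Cm_words m \<Longrightarrow> double_word p \<in> Cmm_words m"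
    using *[of p] by (simp add: Cm_words_def Cmm_words_def)
  show "b # p \<in> Cm_words m \<Longrightarrow> (0, b) # double_word p \<in> Cmm_words m"
    using *[of p] by (auto simp: Cm_words_def Cmm_words_def Basis_prod_def)
qed

text \<open>The derived feature map \<open>Kp\<close> has again a kernel with a continuous mixed
  derivative, so \<open>feature_derivative\<close> applies to it in place of \<open>K\<close>.
  Pairing its vector-valued limit with \<open>h\<close> gives the derivative for all
  \<open>h\<close> at once.\<close>

lemma feature_partials_step:
  fixes K :: "'a::euclidean_space \<Rightarrow> 'h::{real_inner, banach}"
  assumes k: "cont_diff_on (Cmm_words m) (X \<times> X) k" and bp: "b # p \<in> Cm_words m"
    and Kp: "\<And>x y. x \<in> interior X \<Longrightarrow> y \<in> interior X \<Longrightarrow> inner (Kp x) (Kp y) = partials (double_word p) k (x, y)"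
  shows "\<exists>Kb :: 'a \<Rightarrow> 'h.
    (\<forall>x\<in>interior X. \<forall>y\<in>interior X. inner (Kb x) (Kb y) = partials (double_word (b # p)) k (x, y)) \<and>
    (\<forall>h. \<forall>x\<in>interior X. has_dir_derivative (\<lambda>x. inner h (Kp x)) b (inner h (Kb x)) x)"
proof -
  let ?I = "interior X"
  note w2 = double_word_in_Cmm_words(1)[OF bp] and w1 = double_word_in_Cmm_words(2)[OF bp]
  have Int: "interior (X \<times> X) = ?I \<times> ?I" by (rule interior_Times)
  have dir: "has_dir_derivative (partials bs k) a (partials (a # bs) k z) z"
    if "a # bs \<in> Cmm_words m" "z \<in> ?I \<times> ?I" for a bs z
  proof -
    have "(\<lambda>t. partials bs k (z + t *\<^sub>R a)) field_differentiable (at 0)"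
      using k that unfolding cont_diff_on_def Int by blast
    then show ?thesis by (simp add: DERIV_deriv_iff_field_differentiable)
  qed
  obtain g where g: "continuous_on (X \<times> X) g" "\<And>z. z \<in> ?I \<times> ?I \<Longrightarrow> g z = partials (double_word (b # p)) k z"
    using k w2 unfolding cont_diff_on_def Int by blast
  have "continuous_on (?I \<times> ?I) g"
    using g(1) by (rule continuous_on_subset) (use interior_subset[of X] in blast)
  then have cont: "continuous_on (?I \<times> ?I) (partials (double_word (b # p)) k)"
    by (rule continuous_on_eq) (rule g(2))
  have d1: "has_dir_derivative (partials (double_word p) k) (0, b) (partials ((0, b) # double_word p) k z) z"
    if "z \<in> ?I \<times> ?I" for z using w1 that by (rule dir)
  have d2: "has_dir_derivative (partials ((0, b) # double_word p) k) (b, 0) (partials (double_word (b # p)) k z) z"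
    if "z \<in> ?I \<times> ?I" for z using dir[of "(b, 0)" "(0, b) # double_word p" z] w2 that by simp
  obtain Kb where Kb: "\<And>x. x \<in> ?I \<Longrightarrow> ((\<lambda>t. (1 / t) *\<^sub>R (Kp (x + t *\<^sub>R b) - Kp x)) \<longlongrightarrow> Kb x) (at 0)"
    "\<And>x y. x \<in> ?I \<Longrightarrow> y \<in> ?I \<Longrightarrow> inner (Kb x) (Kb y) = partials (double_word (b # p)) k (x, y)"
    using feature_derivative[OF open_interior Kp d1 d2 cont] by blast
  have "has_dir_derivative (\<lambda>x. inner h (Kp x)) b (inner h (Kb x)) x" if x: "x \<in> ?I" for h x
  proof -
    have "((\<lambda>t. inner h ((1 / t) *\<^sub>R (Kp (x + t *\<^sub>R b) - Kp x))) \<longlongrightarrow> inner h (Kb x)) (at 0)"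
      by (intro tendsto_inner tendsto_const Kb x)
    then show ?thesis by (simp add: DERIV_def inner_diff_right)
  qed
  with Kb(2) show ?thesis by (intro exI[of _ Kb]) simp
qed

text \<open>Here words grow on the left, by the derivative taken last: the next derivative acts on
  the feature map already obtained.\<close>

lemma feature_partials:
  fixes K :: "'a::euclidean_space \<Rightarrow> 'h::{real_inner, banach}"
  assumes k: "cont_diff_on (Cmm_words m) (X \<times> X) k"
    and K: "\<And>x y. x \<in> interior X \<Longrightarrow> y \<in> interior X \<Longrightarrow> inner (K x) (K y) = k (x, y)"
    and p: "p \<in> Cm_words m"
  shows "\<exists>Kp :: 'a \<Rightarrow> 'h.
    (\<forall>x\<in>interior X. \<forall>y\<in>interior X. inner (Kp x) (Kp y) = partials (double_word p) k (x, y)) \<and>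
    (\<forall>h. \<forall>x\<in>interior X. partials p (\<lambda>x. inner h (K x)) x = inner h (Kp x))"
  using p
proof (induction p)
  case Nil
  then show ?case using K by auto
next
  case (Cons b p)
  have "p \<in> Cm_words m" using Cons.prems by (simp add: Cm_words_def)
  then obtain Kp where Kp: "\<And>x y. x \<in> interior X \<Longrightarrow> y \<in> interior X \<Longrightarrow> inner (Kp x) (Kp y) = partials (double_word p) k (x, y)"
    "\<And>h x. x \<in> interior X \<Longrightarrow> partials p (\<lambda>x. inner h (K x)) x = inner h (Kp x)"
    using Cons.IH by blast
  from feature_partials_step[OF k Cons.prems Kp(1)] obtain Kb :: "'a \<Rightarrow> 'h"
    where Kb1: "\<forall>x\<in>interior X. \<forall>y\<in>interior X. inner (Kb x) (Kb y) = partials (double_word (b # p)) k (x, y)"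
      and "\<forall>h. \<forall>x\<in>interior X. has_dir_derivative (\<lambda>x. inner h (Kp x)) b (inner h (Kb x)) x" by auto
  then have Kb2: "has_dir_derivative (\<lambda>x. inner h (Kp x)) b (inner h (Kb x)) x" if "x \<in> interior X" for h x
    using that by simp
  have "partials (b # p) (\<lambda>x. inner h (K x)) x = inner h (Kb x)" if x: "x \<in> interior X" for h x
  proof -
    have "has_dir_derivative (partials p (\<lambda>x. inner h (K x))) b (inner h (Kb x)) x"
      by (rule has_dir_derivative_cong_open[OF open_interior x _ Kb2[OF x]]) (rule Kp(2)[symmetric])
    then show ?thesis by (simp add: DERIV_imp_deriv)
  qed
  with Kb1 show ?case by (intro exI[of _ Kb]) simp
qed

text \<open>The continuous embedding of the Hilbert space into C^m. A derivative is
  \<open>inner h (Kp x)\<close>, and \<open>(norm (Kp x))^2\<close> is a diagonal value of a kernel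
  derivative, at most \<open>A\<close>; Cauchy-Schwarz gives \<open>sqrt A * norm h\<close>.\<close>

proposition rkhs_cont_diff_bounded:
  fixes K :: "'a::euclidean_space \<Rightarrow> 'h::{real_inner, banach}"
  assumes X: "compact X" "closure (interior X) = X" and k: "cont_diff_bounded (Cmm_words m) (X \<times> X) A k"
    and K: "\<And>x y. x \<in> X \<Longrightarrow> y \<in> X \<Longrightarrow> inner (K x) (K y) = k (x, y)" and cont: "continuous_on X K"
  shows "cont_diff_bounded (Cm_words m) X (sqrt A * norm h) (\<lambda>x. inner h (K x))"
proof -
  let ?I = "interior X" and ?f = "\<lambda>x. inner h (K x)"
  have IX: "?I \<subseteq> X" by (rule interior_subset)
  have k': "cont_diff_on (Cmm_words m) (X \<times> X) k" using k by (simp add: cont_diff_bounded_def)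
  have K': "inner (K x) (K y) = k (x, y)" if "x \<in> ?I" "y \<in> ?I" for x y using K IX that by blast
  have Int: "interior (X \<times> X) = ?I \<times> ?I" by (rule interior_Times)
  have diff: "(\<lambda>t. partials p ?f (x + t *\<^sub>R b)) field_differentiable (at 0)"
    if bp: "b # p \<in> Cm_words m" and x: "x \<in> ?I" for b p x
  proof -
    have "p \<in> Cm_words m" using bp by (simp add: Cm_words_def)
    from feature_partials[OF k' K' this] obtain Kp :: "'a \<Rightarrow> 'h"
      where Kp: "\<And>x y. x \<in> ?I \<Longrightarrow> y \<in> ?I \<Longrightarrow> inner (Kp x) (Kp y) = partials (double_word p) k (x, y)"
        "\<And>h x. x \<in> ?I \<Longrightarrow> partials p (\<lambda>x. inner h (K x)) x = inner h (Kp x)" by blast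
    from feature_partials_step[OF k' bp Kp(1)] obtain Kb :: "'a \<Rightarrow> 'h"
      where "\<forall>h. \<forall>x\<in>?I. has_dir_derivative (\<lambda>x. inner h (Kp x)) b (inner h (Kb x)) x" by auto
    then have Kb: "has_dir_derivative (\<lambda>x. inner h (Kp x)) b (inner h (Kb x)) x" if "x \<in> ?I" for h x
      using that by simp
    have "has_dir_derivative (partials p ?f) b (inner h (Kb x)) x"
      by (rule has_dir_derivative_cong_open[OF open_interior x _ Kb[OF x]]) (rule Kp(2)[symmetric])
    then show ?thesis unfolding field_differentiable_def by blast
  qed
  have ext: "(\<exists>g. continuous_on X g \<and> (\<forall>x\<in>?I. g x = partials p ?f x)) \<and> (\<forall>x\<in>?I. \<bar>partials p ?f x\<bar> \<le> sqrt A * norm h)"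
    if p: "p \<in> Cm_words m" for p
  proof -
    from feature_partials[OF k' K' p] obtain Kp :: "'a \<Rightarrow> 'h"
      where Kp: "\<And>x y. x \<in> ?I \<Longrightarrow> y \<in> ?I \<Longrightarrow> inner (Kp x) (Kp y) = partials (double_word p) k (x, y)"
        "\<And>h x. x \<in> ?I \<Longrightarrow> partials p (\<lambda>x. inner h (K x)) x = inner h (Kp x)" by blast
    note w = double_word_in_Cmm_words(1)[OF p]
    have "\<bar>partials p ?f x\<bar> \<le> sqrt A * norm h" if x: "x \<in> ?I" for x
    proof -
      have "\<bar>partials (double_word p) k (x, x)\<bar> \<le> A"
        using k w x unfolding cont_diff_bounded_def Int by blast
      then have "norm (Kp x) \<le> sqrt A" using Kp(1)[OF x x] by (simp add: norm_eq_sqrt_inner)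
      then have "norm h * norm (Kp x) \<le> norm h * sqrt A" by (intro mult_left_mono) auto
      then show ?thesis using Cauchy_Schwarz_ineq2[of h "Kp x"] Kp(2)[OF x, of h] by (simp add: mult.commute)
    qed
    moreover have "\<exists>g. continuous_on X g \<and> (\<forall>x\<in>?I. g x = partials p ?f x)"
    proof -
      obtain G where G: "continuous_on (X \<times> X) G" "\<And>z. z \<in> ?I \<times> ?I \<Longrightarrow> G z = partials (double_word p) k z"
        using k' w unfolding cont_diff_on_def Int by blast
      have Guc: "uniformly_continuous_on (X \<times> X) G"
        by (intro compact_uniformly_continuous G compact_Times X)
      \<comment> \<open>The kernel derivative extends continuously to the compact product, so it is
        uniformly continuous there, and squared distances of \<open>Kp\<close> are differences of
        its values. Hence \<open>Kp\<close> extends to \<open>X\<close>, and with it the derivative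
        for every \<open>h\<close>.\<close>
      have "uniformly_continuous_on ?I Kp"
        unfolding uniformly_continuous_on_def
      proof (intro allI impI)
        fix e :: real assume e: "e > 0"
        then have "e\<^sup>2 / 2 > 0" by simp
        with Guc obtain d where d: "d > 0"
          "\<And>z z'. \<lbrakk>z \<in> X \<times> X; z' \<in> X \<times> X; dist z' z < d\<rbrakk> \<Longrightarrow> dist (G z') (G z) < e\<^sup>2 / 2"
          unfolding uniformly_continuous_on_def by meson
        have "dist (Kp y) (Kp x) < e" if xy: "x \<in> ?I" "y \<in> ?I" "dist y x < d" for x y
        proof (rule power2_less_imp_less)
          have XX: "x \<in> X" "y \<in> X" using xy IX by auto
          have ip: "inner (Kp u) (Kp v) = G (u, v)" if "u \<in> ?I" "v \<in> ?I" for u v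
            using Kp(1)[OF that] G(2)[of "(u, v)"] that by simp
          have "(dist (Kp y) (Kp x))\<^sup>2 = inner (Kp y) (Kp y) - 2 * inner (Kp x) (Kp y) + inner (Kp x) (Kp x)"
            by (simp add: dist_norm power2_norm_eq_inner inner_diff inner_commute)
          also have "\<dots> = (G (y, y) - G (x, y)) + (G (x, x) - G (x, y))"
            by (simp only: ip[OF xy(2,2)] ip[OF xy(1,2)] ip[OF xy(1,1)])
          also have "\<dots> < e\<^sup>2 / 2 + e\<^sup>2 / 2"
          proof (rule add_strict_mono)
            have "dist (G (y, y)) (G (x, y)) < e\<^sup>2 / 2"
              using XX xy(3) by (intro d(2)) (simp_all add: dist_Pair_Pair)
            then show "G (y, y) - G (x, y) < e\<^sup>2 / 2" unfolding dist_real_def by linarith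
            have "dist (G (x, x)) (G (x, y)) < e\<^sup>2 / 2"
              using XX xy(3) by (intro d(2)) (simp_all add: dist_Pair_Pair dist_commute)
            then show "G (x, x) - G (x, y) < e\<^sup>2 / 2" unfolding dist_real_def by linarith
          qed
          finally show "(dist (Kp y) (Kp x))\<^sup>2 < e\<^sup>2" by simp
        qed (use e in simp)
        then show "\<exists>d>0. \<forall>x\<in>?I. \<forall>y\<in>?I. dist y x < d \<longrightarrow> dist (Kp y) (Kp x) < e" using d(1) by blast
      qed
      then obtain Kp' where Kp': "uniformly_continuous_on X Kp'" "\<And>x. x \<in> ?I \<Longrightarrow> Kp x = Kp' x"
        using uniformly_continuous_on_extension_on_closure[of ?I Kp] unfolding X(2) by metis
      have "continuous_on X (\<lambda>x. inner h (Kp' x))"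
        by (intro continuous_intros uniformly_continuous_imp_continuous Kp')
      then show ?thesis using Kp(2) Kp'(2) by (intro exI[of _ "\<lambda>x. inner h (Kp' x)"]) auto
    qed
    ultimately show ?thesis by blast
  qed
  have "continuous_on X ?f" by (intro continuous_intros cont)
  then show ?thesis using diff ext unfolding cont_diff_bounded_def cont_diff_on_def by blast
qed

section \<open>The case of C^m and the theorem\<close>

proposition Cm_space_path_conclusions:
  fixes ev :: "'h::{real_inner, banach, second_countable_topology} \<Rightarrow> 'b::euclidean_space \<Rightarrow> real"
  assumes eps: "\<epsilon> > 0" and U: "open U" "bounded U" "X = closure U"
    and c: "(\<lambda>(x, y). c x y) \<in> Cmm_space m X"
    and adm: "admissible_cost \<epsilon> X c ev" and path: "weakstar_C1_path (Cm_space m X) (Cm_norm m X) X \<mu> \<mu>'"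
  shows "bdd_above ((\<lambda>t. dual_norm (Cm_space m X) (Cm_norm m X) (\<mu>' t)) ` {0..1}) \<and>
    AC2_on (dual_space (Cm_space m X) (Cm_norm m X)) (dual_dist (Cm_space m X) (Cm_norm m X)) 0 1 (\<lambda>t. pairing (\<mu> t)) \<and>
    admissible_path \<epsilon> X c ev \<mu>"
proof -
  have ne: "X \<noteq> {}" using path by (rule weakstar_C1_path_nonempty)
  have X: "compact X" unfolding U(3) using U(2) by (rule compact_closure[THEN iffD2])
  have UI: "U \<subseteq> interior X" unfolding U(3) using U(1) by (intro interior_maximal closure_subset)
  have I: "interior X \<noteq> {}" using UI ne U(3) by auto
  \<comment> \<open>The interior of \<open>X\<close> may be larger than \<open>U\<close>, but it
    lies between \<open>U\<close> and its closure.\<close>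
  have cl: "closure (interior X) = X"
  proof
    show "closure (interior X) \<subseteq> X" unfolding U(3) by (rule closure_minimal[OF interior_subset closed_closure])
    show "X \<subseteq> closure (interior X)" using closure_mono[OF UI] U(3) by simp
  qed
  let ?c = "\<lambda>(x, y). c x y" and ?k = "\<lambda>z. exp ((- 1 / \<epsilon>) * (case z of (x, y) \<Rightarrow> c x y))"
  have c': "cont_diff_on (Cmm_words m) (X \<times> X) ?c" using c by (simp add: Cmm_space_def)
  then have cc: "continuous_on (X \<times> X) ?c" by (simp add: cont_diff_on_def)
  obtain K :: "'b \<Rightarrow> 'h" and \<kappa> where fm: "gibbs_feature_map \<epsilon> X c K \<kappa>"
    and ev: "\<And>h x. x \<in> X \<Longrightarrow> ev h x = inner h (K x)"
    using gibbs_feature_map_exists[OF eps X ne cc adm] by blast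
  interpret gibbs_feature_map \<epsilon> X c K \<kappa> by (rule fm)
  interpret complete_seminormed_functions "Cm_space m X" "Cm_norm m X"
    by (rule complete_seminormed_functions_Cm_space[OF X I cl])
  note W2 = word_class_Cmm_words[of m] and len2 = Cmm_words_length[of _ m]
  note W = word_class_Cm_words[of m] and len = Cm_words_length[of _ m]
  obtain A0 where A0: "A0 \<ge> 0" "cont_diff_bounded (Cmm_words m) (X \<times> X) A0 ?c"
    using cont_diff_on_imp_bounded[OF compact_Times[OF X X] finite_Cmm_words c'] by blast
  from cont_diff_bounded_cmult[OF W2 len2 A0(2), of "- 1 / \<epsilon>"]
  have A1: "cont_diff_bounded (Cmm_words m) (X \<times> X) (\<bar>- 1 / \<epsilon>\<bar> * A0) (\<lambda>z. (- 1 / \<epsilon>) * (case z of (x, y) \<Rightarrow> c x y))" by simp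
  obtain A where A: "A \<ge> 0" "cont_diff_bounded (Cmm_words m) (X \<times> X) A ?k"
    using cont_diff_bounded_exp[of "\<bar>- 1 / \<epsilon>\<bar> * A0" "2 * m" "X \<times> X"] A0(1) W2 len2 A1 by (metis abs_ge_zero mult_nonneg_nonneg)
  have emb: "cont_diff_bounded (Cm_words m) X (sqrt A * norm h) (\<lambda>x. inner h (K x))" for h
    by (rule rkhs_cont_diff_bounded[OF X cl A(2) _ continuous_K]) (simp add: inner_K)
  have sA: "sqrt A \<ge> 0" using A(1) by simp
  obtain B where B: "B \<ge> 0" "\<And>g. \<lbrakk>cont_diff_bounded (Cm_words m) X (sqrt A) g; \<And>x. x \<in> X \<Longrightarrow> \<kappa> \<le> g x\<rbrakk>
      \<Longrightarrow> cont_diff_bounded (Cm_words m) X B (\<lambda>x. 1 / g x)"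
    using cont_diff_bounded_inverse[OF sA kappa_pos, of m X] W len by metis
  interpret gibbs_function_space \<epsilon> X c K \<kappa> "Cm_space m X" "Cm_norm m X"
  proof
    show "\<phi> \<in> Cm_space m X \<Longrightarrow> continuous_on X \<phi>" for \<phi> :: "'b \<Rightarrow> real"
      by (simp add: Cm_space_def cont_diff_on_def)
    show "\<lbrakk>\<phi> \<in> Cm_space m X; x \<in> X\<rbrakk> \<Longrightarrow> \<bar>\<phi> x\<bar> \<le> Cm_norm m X \<phi>" for \<phi> x
      by (rule cont_diff_bounded_abs_le_closure[OF cont_diff_bounded_Cm_norm[OF X] word_class_Nil[OF W] cl])
    \<comment> \<open>The product rule contributes \<open>2 ^ m\<close>, the embedding of the
      numerator \<open>sqrt A\<close>, and the reciprocal of the denominator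
      \<open>B\<close>.\<close>
    let ?C = "2 ^ m * sqrt A * B"
    have "(\<lambda>x. inner h (K x) / inner g (K x)) \<in> Cm_space m X \<and>
        Cm_norm m X (\<lambda>x. inner h (K x) / inner g (K x)) \<le> ?C * norm h"
      if g: "norm g = 1" "\<And>x. x \<in> X \<Longrightarrow> \<kappa> \<le> inner g (K x)" for g h
    proof -
      \<comment> \<open>Since \<open>norm g = 1\<close>, the embedding bounds the denominator by
        \<open>sqrt A\<close>, a bound common to all solutions.\<close>
      have "cont_diff_bounded (Cm_words m) X B (\<lambda>x. 1 / inner g (K x))"
        using emb[of g] g by (intro B(2)) auto
      from cont_diff_bounded_mult[OF W len emb[of h] this _ B(1)]
      have "cont_diff_bounded (Cm_words m) X (2 ^ m * (sqrt A * norm h) * B) (\<lambda>x. inner h (K x) * (1 / inner g (K x)))"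
        using sA by simp
      moreover have "2 ^ m * (sqrt A * norm h) * B = ?C * norm h" by (simp only: ac_simps)
      ultimately have *: "cont_diff_bounded (Cm_words m) X (?C * norm h) (\<lambda>x. inner h (K x) / inner g (K x))"
        by simp
      show ?thesis using cont_diff_bounded_imp_Cm_space[OF *] Cm_norm_le[OF I *] by blast
    qed
    then show "\<exists>C\<ge>0. \<forall>g h. norm g = 1 \<and> (\<forall>x\<in>X. \<kappa> \<le> inner g (K x)) \<longrightarrow>
      (\<lambda>x. inner h (K x) / inner g (K x)) \<in> Cm_space m X \<and>
      Cm_norm m X (\<lambda>x. inner h (K x) / inner g (K x)) \<le> C * norm h"
      using sA B(1) by (intro exI[of _ ?C]) auto
  qed
  show ?thesis using path ev by (rule weakstar_C1_path_conclusions)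
qed

theorem corollary5p10:
  fixes \<epsilon> :: real
  assumes "\<epsilon> > 0"
  shows
    "(\<forall>(X :: 'a::metric_space set) (c :: 'a \<Rightarrow> 'a \<Rightarrow> real)
        (ev :: 'h::{real_inner, banach, second_countable_topology} \<Rightarrow> 'a \<Rightarrow> real)
        (\<mu> :: real \<Rightarrow> 'a measure) (\<mu>' :: real \<Rightarrow> ('a \<Rightarrow> real) \<Rightarrow> real).
        compact X \<and>
        (\<lambda>(x, y). c x y) \<in> C_space (X \<times> X) \<and>
        admissible_cost \<epsilon> X c ev \<and>
        weakstar_C1_path (C_space X) (C_norm X) X \<mu> \<mu>'
        \<longrightarrow>
        bdd_above ((\<lambda>t. dual_norm (C_space X) (C_norm X) (\<mu>' t)) ` {0..1}) \<and>
        AC2_on (dual_space (C_space X) (C_norm X)) (dual_dist (C_space X) (C_norm X)) 0 1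
          (\<lambda>t. pairing (\<mu> t)) \<and>
        admissible_path \<epsilon> X c ev \<mu>)
     \<and>
     (\<forall>(m :: nat) (X :: 'b::euclidean_space set) (c :: 'b \<Rightarrow> 'b \<Rightarrow> real)
        (ev :: 'h \<Rightarrow> 'b \<Rightarrow> real)
        (\<mu> :: real \<Rightarrow> 'b measure) (\<mu>' :: real \<Rightarrow> ('b \<Rightarrow> real) \<Rightarrow> real).
        m \<ge> 1 \<and>
        (\<exists>U. open U \<and> bounded U \<and> X = closure U) \<and>
        (\<lambda>(x, y). c x y) \<in> Cmm_space m X \<and>
        admissible_cost \<epsilon> X c ev \<and>
        weakstar_C1_path (Cm_space m X) (Cm_norm m X) X \<mu> \<mu>'
        \<longrightarrow>
        bdd_above ((\<lambda>t. dual_norm (Cm_space m X) (Cm_norm m X) (\<mu>' t)) ` {0..1}) \<and>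
        AC2_on (dual_space (Cm_space m X) (Cm_norm m X)) (dual_dist (Cm_space m X) (Cm_norm m X)) 0 1
          (\<lambda>t. pairing (\<mu> t)) \<and>
        admissible_path \<epsilon> X c ev \<mu>)"
proof ((rule conjI; intro allI impI; elim conjE exE), goal_cases)
  case 1
  then show ?case by (intro C_space_path_conclusions[OF assms])
next
  case (2 m X c ev \<mu> \<mu>' U)
  then show ?case by (intro Cm_space_path_conclusions[OF assms, of U])
qed

end
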